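(* Let $\nu$ be a measure on $\mathbb{R}^n$ satisfying $d\nu=e^f d\gamma$ for a twice-differentiable function $f$, and for $x\in\mathbb{R}^n$ let $\nu_x$ be the measure $d\nu_x(y)=\frac{\exp(\langle x,y\rangle)\,d\nu(y)}{\int\exp(\langle x,z\rangle)\,d\nu(z)}$. Then for every $r>0$ there exists a point $x_0\in\mathbb{R}^n$ with $|x_0|\le r$ such that $$\mathrm{W}_2(\nu_{x_0},\gamma_u)^2\le 2\frac{\sqrt n}{r}\mathcal{D}(f)-\inf_{y\in\mathbb{R}^n}\Delta f(y),$$ where $\gamma_u$ is the Gaussian measure with identity covariance whose centroid $u$ equals the centroid of $\nu_{x_0}$.
   Context: $\gamma$ is the standard Gaussian measure on $\mathbb{R}^n$. $\mathcal{D}(f)=\mathbf{GW}(\{\nabla f(x):x\in\mathbb{R}^n\})$, where $\mathbf{GW}(K)=\mathbb{E}\sup_{x\in K}\langle x,\Gamma\rangle$, $\Gamma\sim N(0,\mathrm{Id}_n)$. $\mathrm{W}_2$ is the quadratic Wasserstein distance with respect to Euclidean distance. *)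

theory Defs
  imports "HOL-Analysis.Analysis"
begin

definition gauss :: "'a::euclidean_space measure" where
  "gauss = density lborel
     (\<lambda>x. ennreal ((2 * pi) powr (- real DIM('a) / 2) * exp (- (norm x)\<^sup>2 / 2)))"

definition gauss_centered :: "'a::euclidean_space \<Rightarrow> 'a measure" where
  "gauss_centered u = distr gauss borel (\<lambda>x. x + u)"

definition grad :: "('a::euclidean_space \<Rightarrow> real) \<Rightarrow> 'a \<Rightarrow> 'a" where
  "grad f x = (\<Sum>b\<in>Basis. frechet_derivative f (at x) b *\<^sub>R b)"

definition twice_differentiable :: "('a::euclidean_space \<Rightarrow> real) \<Rightarrow> bool" where
  "twice_differentiable f \<longleftrightarrow>
     (\<forall>x. f differentiable at x) \<and> (\<forall>x. grad f differentiable at x)"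

definition laplacian :: "('a::euclidean_space \<Rightarrow> real) \<Rightarrow> 'a \<Rightarrow> real" where
  "laplacian f x = (\<Sum>b\<in>Basis. frechet_derivative (grad f) (at x) b \<bullet> b)"

text \<open>Gaussian width GW(K) = E sup_{x in K} <x, Gamma>, as an extended real
  (positive part minus negative part of the extended-real supremum).\<close>
definition gaussian_width :: "'a::euclidean_space set \<Rightarrow> ereal" where
  "gaussian_width K =
     enn2ereal (\<integral>\<^sup>+ g. e2ennreal (SUP x\<in>K. ereal (x \<bullet> g)) \<partial>gauss)
   - enn2ereal (\<integral>\<^sup>+ g. e2ennreal (- (SUP x\<in>K. ereal (x \<bullet> g))) \<partial>gauss)"

definition grad_complexity :: "('a::euclidean_space \<Rightarrow> real) \<Rightarrow> ereal" where
  "grad_complexity f = gaussian_width (range (grad f))"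

definition nu_of :: "('a::euclidean_space \<Rightarrow> real) \<Rightarrow> 'a measure" where
  "nu_of f = density gauss (\<lambda>y. ennreal (exp (f y)))"

definition tilt :: "'a::euclidean_space measure \<Rightarrow> 'a \<Rightarrow> 'a measure" where
  "tilt \<nu> x = density \<nu>
     (\<lambda>y. ennreal (exp (x \<bullet> y)) / (\<integral>\<^sup>+ z. ennreal (exp (x \<bullet> z)) \<partial>\<nu>))"

definition centroid :: "'a::euclidean_space measure \<Rightarrow> 'a" where
  "centroid \<mu> = (\<integral> y. y \<partial>\<mu>)"

definition couplings :: "'a::euclidean_space measure \<Rightarrow> 'a measure \<Rightarrow> ('a \<times> 'a) measure set" where
  "couplings \<mu> \<nu> = {\<pi>. sets \<pi> = sets borel \<and>
       distr \<pi> borel fst = \<mu> \<and> distr \<pi> borel snd = \<nu>}"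

definition W2_sq :: "'a::euclidean_space measure \<Rightarrow> 'a measure \<Rightarrow> ennreal" where
  "W2_sq \<mu> \<nu> = (INF \<pi>\<in>couplings \<mu> \<nu>. \<integral>\<^sup>+ p. ennreal ((norm (fst p - snd p))\<^sup>2) \<partial>\<pi>)"

end

theory Submission
  imports Defs "HOL-Probability.Probability"
begin

text \<open>If the gradient of \<open>f\<close> is unbounded, its Gaussian width is infinite, so let it be bounded. Write
  \<open>m(x)\<close> for the mean of \<open>\<nabla>f\<close> under \<open>\<nu>\<^sub>x\<close>. Integration by parts gives \<open>m(x) = u - x\<close> for the centroid \<open>u\<close> of
  \<open>\<nu>\<^sub>x\<close>, and \<open>W\<^sub>2\<^sup>2(\<nu>\<^sub>x, \<gamma>\<^sub>u) \<le> \<integral>|\<nabla>f - m(x)|\<^sup>2 d\<nu>\<^sub>x\<close> since the squared distance to a Gaussian is at most the relative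
  Fisher information: on the line this is a computation with the monotone transport map, and in
  higher dimensions coordinates are transported one after the other. A second integration by parts
  bounds this variance by \<open>div m(x) - \<integral>\<Delta>f d\<nu>\<^sub>x\<close>. As \<open>\<Delta>f\<close> exists only pointwise, the lower bound on it is
  first turned into a weak one by comparing \<open>f\<close> with its heat flow through the maximum principle.
  Finally, averaging \<open>div m\<close> over the ball with weight \<open>r\<^sup>2 - |x|\<^sup>2\<close> produces \<open>2 \<integral>\<langle>m(x), x\<rangle>\<close> over the ball, where
  \<open>\<langle>m(x), x\<rangle>\<close> is at most the support function of the set of gradients; by homogeneity the integral of
  the latter is a multiple of its Gaussian mean.\<close>

section \<open>The Gaussian measure\<close>

text \<open>A second derivative that exists only pointwise need not be integrable, so no integration
  by parts may end on it; in the heat flow all second derivatives fall on the Gaussian kernel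
  instead. Coordinatewise transport succeeds because relative Fisher information tolerates
  integrating out a coordinate: partial derivatives of the logarithm of a marginal density are
  conditional means of the original ones, so Jensen applies, and costs of moves in orthogonal
  directions add. The centroid is the right centre: the gradient of the log density of \<nu>_x
  relative to \<gamma>_u is the gradient of f minus its mean, so Fisher information becomes a
  variance. The weight r^2 - |x|^2 has gradient -2x and vanishes on the sphere, so averaging a
  divergence against it leaves no surface term; a minimiser over the closed ball lies below the
  average and serves as x_0. Comparison with the norm gives the factor n(n+2) / ((n+1) r
  E|\<Gamma>|) in front of the width. With E|\<Gamma>| at least (3/4) sqrt n it is at most
  (4/3)(n+2)/(n+1) sqrt n / r, hence at most 2 sqrt n / r because n is at least 1.\<close>

definition gdens :: "'a::euclidean_space \<Rightarrow> real" where
  "gdens x = (2 * pi) powr (- real DIM('a) / 2) * exp (- (norm x)\<^sup>2 / 2)"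

lemma gauss_eq: "gauss = density lborel (\<lambda>x. ennreal (gdens x))"
  by (simp add: gauss_def gdens_def)

lemma gdens_pos [simp]: "gdens x > 0"
  by (simp add: gdens_def)

lemma gdens_nonneg [simp]: "0 \<le> gdens x"
  using gdens_pos[of x] by linarith

lemma continuous_gdens: "continuous_on UNIV gdens"
  unfolding gdens_def by (intro continuous_intros) auto

lemma gdens_measurable [measurable]: "gdens \<in> borel_measurable borel"
  using continuous_gdens by (rule borel_measurable_continuous_onI)

lemma gdens_real: "gdens (x::real) = std_normal_density x"
  by (simp add: gdens_def std_normal_density_def powr_minus powr_half_sqrt field_simps)

lemma gdens_prod:
  fixes x :: "'a::euclidean_space"
  shows "gdens x = (\<Prod>b\<in>Basis. std_normal_density (x \<bullet> b))"
proof -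
  have "(\<Prod>b\<in>Basis. std_normal_density (x \<bullet> b)) =
      (1 / sqrt (2*pi)) ^ DIM('a) * exp (\<Sum>b\<in>Basis. - (x \<bullet> b)\<^sup>2 / 2)"
    unfolding std_normal_density_def prod.distrib by (simp add: exp_sum)
  moreover have "(\<Sum>b\<in>Basis. - (x \<bullet> b)\<^sup>2 / 2) = - (norm x)\<^sup>2 / 2"
    unfolding power2_norm_eq_inner euclidean_inner[of x x]
    by (simp add: sum_negf sum_divide_distrib power2_eq_square)
  moreover have "(1 / sqrt (2*pi)) ^ DIM('a) = (2 * pi) powr (- real DIM('a) / 2)"
  proof -
    have "1 / sqrt (2*pi) = (2*pi) powr (-1/2)"
      by (simp add: powr_minus powr_half_sqrt field_simps)
    then show ?thesis
      by (simp add: powr_powr flip: powr_realpow)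
  qed
  ultimately show ?thesis by (simp add: gdens_def)
qed

lemma gdens_add: "gdens (x + v) = gdens x * exp (- (x \<bullet> v) - (norm v)\<^sup>2 / 2)"
proof -
  have "(norm (x + v))\<^sup>2 = (norm x)\<^sup>2 + 2 * (x \<bullet> v) + (norm v)\<^sup>2"
    by (simp add: power2_norm_eq_inner algebra_simps inner_commute)
  then show ?thesis
    by (simp add: gdens_def field_simps flip: exp_add)
qed

lemma sets_gauss [measurable_cong, simp]: "sets gauss = sets borel"
  by (simp add: gauss_eq)

lemma space_gauss [simp]: "space gauss = UNIV"
  by (simp add: gauss_eq)

lemma measurable_gauss [simp]: "measurable gauss N = measurable borel N"
  by (rule measurable_cong_sets) auto

lemma nn_integral_gauss:
  assumes [measurable]: "h \<in> borel_measurable borel"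
  shows "(\<integral>\<^sup>+x. h x \<partial>gauss) = (\<integral>\<^sup>+x. ennreal (gdens x) * h x \<partial>lborel)"
  unfolding gauss_eq by (rule nn_integral_density) auto

lemma integral_gauss:
  fixes h :: "'a::euclidean_space \<Rightarrow> 'b::{banach, second_countable_topology}"
  assumes [measurable]: "h \<in> borel_measurable borel"
  shows "(\<integral>x. h x \<partial>gauss) = (\<integral>x. gdens x *\<^sub>R h x \<partial>lborel)"
  unfolding gauss_eq by (rule integral_density) auto

lemma integrable_gauss_iff:
  fixes h :: "'a::euclidean_space \<Rightarrow> 'b::{banach, second_countable_topology}"
  assumes [measurable]: "h \<in> borel_measurable borel"
  shows "integrable gauss h \<longleftrightarrow> integrable lborel (\<lambda>x. gdens x *\<^sub>R h x)"
  unfolding gauss_eq by (rule integrable_density) auto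

lemma nn_integral_lborel_translate:
  fixes h :: "'a::euclidean_space \<Rightarrow> ennreal"
  assumes [measurable]: "h \<in> borel_measurable borel"
  shows "(\<integral>\<^sup>+x. h (x + v) \<partial>lborel) = (\<integral>\<^sup>+x. h x \<partial>lborel)"
  by (subst (2) lborel_distr_plus[of v, symmetric]) (simp add: nn_integral_distr add.commute)

lemma integral_lborel_translate:
  fixes h :: "'a::euclidean_space \<Rightarrow> real"
  assumes [measurable]: "h \<in> borel_measurable borel"
  shows "(\<integral>x. h (x + v) \<partial>lborel) = (\<integral>x. h x \<partial>lborel)"
  by (subst (2) lborel_distr_plus[of v, symmetric]) (simp add: integral_distr add.commute)

lemma integrable_lborel_translate:
  fixes h :: "'a::euclidean_space \<Rightarrow> real"
  assumes h: "integrable lborel h"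
  shows "integrable lborel (\<lambda>x. h (x + v))"
proof -
  have [measurable]: "h \<in> borel_measurable borel"
    using h by auto
  have "integrable (distr lborel borel ((+) v)) h"
    using h by (simp add: lborel_distr_plus)
  then show ?thesis by (simp add: integrable_distr_eq add.commute)
qed

text \<open>Cameron-Martin change of variables: the exponential factor is the ratio
  \<open>gdens (x + v) / gdens x\<close>. It later centres the tilted measures at their centroids;
  the real-valued twin moves increments of the heat flow onto the density.\<close>

lemma nn_integral_gauss_translate:
  fixes h :: "'a::euclidean_space \<Rightarrow> ennreal"
  assumes [measurable]: "h \<in> borel_measurable borel"
  shows "(\<integral>\<^sup>+x. h x \<partial>gauss) =
    (\<integral>\<^sup>+x. h (x + v) * ennreal (exp (- (x \<bullet> v) - (norm v)\<^sup>2 / 2)) \<partial>gauss)"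
proof -
  have "(\<integral>\<^sup>+x. h x \<partial>gauss) = (\<integral>\<^sup>+x. ennreal (gdens x) * h x \<partial>lborel)"
    by (rule nn_integral_gauss) simp
  also have "\<dots> = (\<integral>\<^sup>+x. ennreal (gdens (x + v)) * h (x + v) \<partial>lborel)"
    by (rule nn_integral_lborel_translate[symmetric]) simp
  also have "\<dots> = (\<integral>\<^sup>+x. ennreal (gdens x) * (h (x + v) * ennreal (exp (- (x \<bullet> v) - (norm v)\<^sup>2 / 2))) \<partial>lborel)"
    by (simp add: gdens_add ennreal_mult' mult_ac)
  also have "\<dots> = (\<integral>\<^sup>+x. h (x + v) * ennreal (exp (- (x \<bullet> v) - (norm v)\<^sup>2 / 2)) \<partial>gauss)"
    by (rule nn_integral_gauss[symmetric]) simp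
  finally show ?thesis .
qed

lemma integral_gauss_translate:
  fixes h :: "'a::euclidean_space \<Rightarrow> real"
  assumes [measurable]: "h \<in> borel_measurable borel"
  shows "(\<integral>x. h x \<partial>gauss) = (\<integral>x. h (x + v) * exp (- (x \<bullet> v) - (norm v)\<^sup>2 / 2) \<partial>gauss)"
proof -
  have "(\<integral>x. h x \<partial>gauss) = (\<integral>x. gdens x * h x \<partial>lborel)"
    by (simp add: integral_gauss)
  also have "\<dots> = (\<integral>x. gdens (x + v) * h (x + v) \<partial>lborel)"
    by (rule integral_lborel_translate[symmetric]) simp
  also have "\<dots> = (\<integral>x. h (x + v) * exp (- (x \<bullet> v) - (norm v)\<^sup>2 / 2) \<partial>gauss)"
    by (simp add: integral_gauss gdens_add mult_ac)
  finally show ?thesis .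
qed

text \<open>Completing the square makes \<open>exp (c * s)\<close> times the normal density a
  multiple of a translated normal density. The absolute value is handled by adding the cases
  \<open>c = C\<close> and \<open>c = - C\<close>.\<close>

lemma nn_integral_exp_abs_normal: "(\<integral>\<^sup>+s. ennreal (exp (C * \<bar>s\<bar>)) * ennreal (std_normal_density s) \<partial>lborel) < \<infinity>"
proof -
  have m: "(\<integral>\<^sup>+s. ennreal (std_normal_density s) \<partial>lborel) = 1"
    using prob_space.emeasure_space_1[OF prob_space_normal_density[of 1 0]]
    by (simp add: emeasure_density)
  have *: "(\<integral>\<^sup>+s. ennreal (exp (c * s)) * ennreal (std_normal_density s) \<partial>lborel) < \<infinity>" for c :: real
  proof -
    have "(\<integral>\<^sup>+s. ennreal (exp (c * s)) * ennreal (std_normal_density s) \<partial>lborel)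
       = (\<integral>\<^sup>+s. ennreal (exp (c\<^sup>2 / 2)) * ennreal (std_normal_density (s + (-c))) \<partial>lborel)"
      by (intro nn_integral_cong)
        (simp add: std_normal_density_def power2_eq_square field_simps
          flip: ennreal_mult exp_add)
    also have "\<dots> = ennreal (exp (c\<^sup>2 / 2)) * (\<integral>\<^sup>+s. ennreal (std_normal_density s) \<partial>lborel)"
      by (subst nn_integral_cmult, measurable)
        (subst nn_integral_lborel_translate[of "\<lambda>s. ennreal (std_normal_density s)"], simp_all)
    finally show ?thesis by (simp add: m)
  qed
  have "(\<integral>\<^sup>+s. ennreal (exp (C * \<bar>s\<bar>)) * ennreal (std_normal_density s) \<partial>lborel) \<le>
     (\<integral>\<^sup>+s. ennreal (exp (C * s)) * ennreal (std_normal_density s) + ennreal (exp ((-C) * s)) * ennreal (std_normal_density s) \<partial>lborel)"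
  proof (intro nn_integral_mono)
    fix s :: real
    have "exp (C * \<bar>s\<bar>) \<le> exp (C * s) + exp ((-C) * s)"
      by (cases "s \<ge> 0") auto
    then show "ennreal (exp (C * \<bar>s\<bar>)) * ennreal (std_normal_density s) \<le>
      ennreal (exp (C * s)) * ennreal (std_normal_density s) + ennreal (exp ((-C) * s)) * ennreal (std_normal_density s)"
      by (simp flip: ennreal_mult ennreal_plus distrib_right add: mult_right_mono)
  qed
  also have "\<dots> < \<infinity>"
    using *[of C] *[of "-C"] by (subst nn_integral_add) auto
  finally show ?thesis .
qed

lemma prob_space_gauss: "prob_space (gauss :: 'a::euclidean_space measure)"
proof
  have m: "(\<integral>\<^sup>+s. ennreal (std_normal_density s) \<partial>lborel) = 1"
    using prob_space.emeasure_space_1[OF prob_space_normal_density[of 1 0]]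
    by (simp add: emeasure_density)
  have "emeasure gauss (UNIV::'a set) = (\<integral>\<^sup>+x. ennreal (gdens (x::'a)) \<partial>lborel)"
    by (simp add: gauss_eq emeasure_density)
  also have "\<dots> = (\<integral>\<^sup>+x. (\<Prod>b\<in>Basis. ennreal (std_normal_density (x \<bullet> b))) \<partial>(lborel::'a measure))"
    by (simp add: gdens_prod prod_ennreal)
  also have "\<dots> = (\<Prod>b\<in>(Basis::'a set). (\<integral>\<^sup>+s. ennreal (std_normal_density s) \<partial>lborel))"
    by (rule nn_integral_lborel_prod) auto
  finally show "emeasure gauss (space (gauss::'a measure)) = 1" by (simp add: m)
qed

text \<open>The l1 norm dominates the Euclidean norm, and its exponential is a product over
  coordinates, so the integral factors into one-dimensional ones.\<close>

lemma integrable_gauss_exp_norm: "integrable gauss (\<lambda>x::'a::euclidean_space. exp (C * norm x))"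
proof (rule integrableI_nonneg)
  have "(\<integral>\<^sup>+x. ennreal (exp (C * norm (x::'a))) \<partial>gauss) \<le> (\<integral>\<^sup>+x. ennreal (exp (\<bar>C\<bar> * (\<Sum>b\<in>Basis. \<bar>(x::'a) \<bullet> b\<bar>))) \<partial>gauss)"
  proof (intro nn_integral_mono ennreal_leI)
    fix x :: 'a
    have "C * norm x \<le> \<bar>C\<bar> * norm x" by (simp add: mult_right_mono)
    also have "\<dots> \<le> \<bar>C\<bar> * (\<Sum>b\<in>Basis. \<bar>x \<bullet> b\<bar>)" by (intro mult_left_mono norm_le_l1) auto
    finally show "exp (C * norm x) \<le> exp (\<bar>C\<bar> * (\<Sum>b\<in>Basis. \<bar>x \<bullet> b\<bar>))" by simp
  qed
  also have "\<dots> = (\<integral>\<^sup>+x. (\<Prod>b\<in>Basis. ennreal (exp (\<bar>C\<bar> * \<bar>x \<bullet> b\<bar>)) * ennreal (std_normal_density (x \<bullet> b))) \<partial>(lborel::'a measure))"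
    by (subst nn_integral_gauss)
       (auto simp: gdens_prod prod_ennreal exp_sum sum_distrib_left ennreal_mult prod.distrib mult.commute prod_nonneg
          intro!: nn_integral_cong)
  also have "\<dots> = (\<Prod>b\<in>(Basis::'a set). (\<integral>\<^sup>+s. ennreal (exp (\<bar>C\<bar> * \<bar>s\<bar>)) * ennreal (std_normal_density s) \<partial>lborel))"
    by (rule nn_integral_lborel_prod) auto
  also have "\<dots> < \<infinity>"
    using nn_integral_exp_abs_normal[of "\<bar>C\<bar>"]
    by (simp add: power_less_top_ennreal)
  finally show "(\<integral>\<^sup>+x. ennreal (exp (C * norm (x::'a))) \<partial>gauss) < \<infinity>" .
qed auto

text \<open>Proved by translations only: substitute \<open>s = x \<bullet> b + t\<close>, shift \<open>x\<close> by \<open>- t b\<close>, and use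
  that the ratio \<open>gdens (x - t b) / gdens x\<close> depends on \<open>x \<bullet> b\<close> alone.\<close>
lemma gauss_disintegrate:
  fixes h :: "'a::euclidean_space \<Rightarrow> ennreal"
  assumes b: "b \<in> Basis" and [measurable]: "h \<in> borel_measurable borel"
  shows "(\<integral>\<^sup>+x. \<integral>\<^sup>+s. h (x + (s - x \<bullet> b) *\<^sub>R b) \<partial>gauss \<partial>gauss) = (\<integral>\<^sup>+x. h x \<partial>gauss)"
proof -
  have m1: "(\<integral>\<^sup>+t. ennreal (gdens (t::real)) \<partial>lborel) = 1"
    using prob_space.emeasure_space_1[OF prob_space_gauss[where 'a=real]]
    by (simp add: gauss_eq emeasure_density)
  have key: "gdens (x + (-t) *\<^sub>R b) * gdens (x \<bullet> b) = gdens x * gdens (t + (- (x \<bullet> b)))" for x and t :: real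
    using b unfolding gdens_add
    by (simp add: power2_eq_square) (simp add: gdens_def power2_eq_square field_simps flip: exp_add)
  have "(\<integral>\<^sup>+x. \<integral>\<^sup>+s. h (x + (s - x \<bullet> b) *\<^sub>R b) \<partial>gauss \<partial>gauss)
     = (\<integral>\<^sup>+x. \<integral>\<^sup>+s. ennreal (gdens x) * (ennreal (gdens s) * h (x + (s - x \<bullet> b) *\<^sub>R b)) \<partial>lborel \<partial>lborel)"
    by (simp add: nn_integral_gauss nn_integral_cmult)
  also have "\<dots> = (\<integral>\<^sup>+x. \<integral>\<^sup>+t. ennreal (gdens x) * (ennreal (gdens (t + x \<bullet> b)) * h (x + t *\<^sub>R b)) \<partial>lborel \<partial>lborel)"
  proof (rule nn_integral_cong)
    fix x :: 'a
    show "(\<integral>\<^sup>+s. ennreal (gdens x) * (ennreal (gdens s) * h (x + (s - x \<bullet> b) *\<^sub>R b)) \<partial>lborel) =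
      (\<integral>\<^sup>+t. ennreal (gdens x) * (ennreal (gdens (t + x \<bullet> b)) * h (x + t *\<^sub>R b)) \<partial>lborel)"
      using nn_integral_lborel_translate[of "\<lambda>s. ennreal (gdens x) * (ennreal (gdens s) * h (x + (s - x \<bullet> b) *\<^sub>R b))" "x \<bullet> b"]
      by simp
  qed
  also have "\<dots> = (\<integral>\<^sup>+t. \<integral>\<^sup>+x. ennreal (gdens x) * (ennreal (gdens (t + x \<bullet> b)) * h (x + t *\<^sub>R b)) \<partial>lborel \<partial>lborel)"
    by (rule lborel_pair.Fubini') measurable
  also have "\<dots> = (\<integral>\<^sup>+t. \<integral>\<^sup>+x. ennreal (gdens (x + (-t) *\<^sub>R b)) * (ennreal (gdens (x \<bullet> b)) * h x) \<partial>lborel \<partial>lborel)"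
  proof (rule nn_integral_cong)
    fix t :: real
    show "(\<integral>\<^sup>+x. ennreal (gdens x) * (ennreal (gdens (t + x \<bullet> b)) * h (x + t *\<^sub>R b)) \<partial>lborel) =
       (\<integral>\<^sup>+x. ennreal (gdens (x + (-t) *\<^sub>R b)) * (ennreal (gdens (x \<bullet> b)) * h x) \<partial>lborel)"
      using b nn_integral_lborel_translate[of "\<lambda>x. ennreal (gdens x) * (ennreal (gdens (t + x \<bullet> b)) * h (x + t *\<^sub>R b))" "(-t) *\<^sub>R b"]
      by (simp add: inner_diff_left)
  qed
  also have "\<dots> = (\<integral>\<^sup>+x. \<integral>\<^sup>+t. ennreal (gdens (x + (-t) *\<^sub>R b)) * (ennreal (gdens (x \<bullet> b)) * h x) \<partial>lborel \<partial>lborel)"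
    by (rule lborel_pair.Fubini') measurable
  also have "\<dots> = (\<integral>\<^sup>+x. \<integral>\<^sup>+t. (ennreal (gdens x) * h x) * ennreal (gdens (t + (- (x \<bullet> b)))) \<partial>lborel \<partial>lborel)"
  proof (intro nn_integral_cong)
    fix x :: 'a and t :: real
    have "ennreal (gdens (x + (-t) *\<^sub>R b)) * ennreal (gdens (x \<bullet> b)) = ennreal (gdens x) * ennreal (gdens (t + (- (x \<bullet> b))))"
      unfolding ennreal_mult[OF gdens_nonneg gdens_nonneg, symmetric] key ..
    then show "ennreal (gdens (x + (-t) *\<^sub>R b)) * (ennreal (gdens (x \<bullet> b)) * h x) = ennreal (gdens x) * h x * ennreal (gdens (t + - (x \<bullet> b)))"
      by (metis mult.assoc mult.commute)
  qed
  also have "\<dots> = (\<integral>\<^sup>+x. (ennreal (gdens x) * h x) \<partial>lborel)"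
  proof (rule nn_integral_cong)
    fix x :: 'a
    show "(\<integral>\<^sup>+t. (ennreal (gdens x) * h x) * ennreal (gdens (t + (- (x \<bullet> b)))) \<partial>lborel) = ennreal (gdens x) * h x"
      by (subst nn_integral_cmult) (simp, subst nn_integral_lborel_translate[of "\<lambda>t. ennreal (gdens t)"], simp, simp add: m1)
  qed
  also have "\<dots> = (\<integral>\<^sup>+x. h x \<partial>gauss)"
    by (simp add: nn_integral_gauss)
  finally show ?thesis .
qed

section \<open>Integrals depending on a parameter\<close>

lemma has_real_derivative_integral:
  fixes H H' :: "real \<Rightarrow> 'a \<Rightarrow> real"
  assumes e: "0 < e"
    and int: "\<And>t. \<bar>t - t0\<bar> < e \<Longrightarrow> integrable M (H t)"
    and der: "\<And>t z. \<bar>t - t0\<bar> < e \<Longrightarrow> z \<in> space M \<Longrightarrow> ((\<lambda>t. H t z) has_real_derivative H' t z) (at t)"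
    and bound: "\<And>t z. \<bar>t - t0\<bar> < e \<Longrightarrow> z \<in> space M \<Longrightarrow> \<bar>H' t z\<bar> \<le> w z"
    and w: "integrable M w" and meas: "H' t0 \<in> borel_measurable M"
  shows "((\<lambda>t. \<integral>z. H t z \<partial>M) has_real_derivative (\<integral>z. H' t0 z \<partial>M)) (at t0)"
  unfolding DERIV_def tendsto_at_iff_sequentially
proof (intro allI impI)
  fix X :: "nat \<Rightarrow> real"
  assume X0: "\<forall>i. X i \<in> UNIV - {0}" and X: "X \<longlonglongrightarrow> 0"
  \<comment> \<open>Finitely many \<open>X n\<close> may lie outside the interval of radius
    \<open>e\<close>. Replacing them by the admissible nonzero value \<open>e / 2\<close> gives a
    sequence to which the domination applies at every index.\<close>
  define Y where "Y n = (if \<bar>X n\<bar> < e then X n else e / 2)" for n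
  have ev: "\<forall>\<^sub>F n in sequentially. X n = Y n"
    using order_tendstoD(2)[OF tendsto_rabs[OF X], of e] e by (auto simp: Y_def elim!: eventually_mono)
  have Y: "Y \<longlonglongrightarrow> 0"
    by (rule Lim_transform_eventually[OF X ev])
  have Yn: "\<bar>Y n\<bar> < e" "Y n \<noteq> 0" for n
    using X0[rule_format, of n] e by (auto simp: Y_def)
  have bd: "\<bar>(H (t0 + Y n) z - H t0 z) / Y n\<bar> \<le> w z" if z: "z \<in> space M" for n z
  proof -
    have "\<bar>H (t0 + Y n) z - H t0 z\<bar> \<le> w z * \<bar>(t0 + Y n) - t0\<bar>"
      unfolding real_norm_def[symmetric]
    proof (rule field_differentiable_bound[where S="{t. \<bar>t - t0\<bar> < e}" and f'="\<lambda>t. H' t z"])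
      show "convex {t. \<bar>t - t0\<bar> < e}"
        using convex_ball[of t0 e] by (simp add: ball_def dist_real_def abs_minus_commute)
    qed (use der bound z Yn[of n] e in \<open>auto intro: has_field_derivative_at_within\<close>)
    then show ?thesis using Yn[of n] by (simp add: field_simps)
  qed
  have "(\<lambda>n. \<integral>z. (H (t0 + Y n) z - H t0 z) / Y n \<partial>M) \<longlonglongrightarrow> (\<integral>z. H' t0 z \<partial>M)"
  proof (rule integral_dominated_convergence[OF _ _ w])
    show "AE z in M. (\<lambda>n. (H (t0 + Y n) z - H t0 z) / Y n) \<longlonglongrightarrow> H' t0 z"
    proof (rule AE_I2)
      fix z assume "z \<in> space M"
      then have "((\<lambda>h. (H (t0 + h) z - H t0 z) / h) \<longlongrightarrow> H' t0 z) (at 0)"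
        using der[of t0 z] e by (simp add: DERIV_def)
      then have "(((\<lambda>h. (H (t0 + h) z - H t0 z) / h) \<circ> Y) \<longlonglongrightarrow> H' t0 z)"
        using Y Yn unfolding tendsto_at_iff_sequentially by auto
      then show "(\<lambda>n. (H (t0 + Y n) z - H t0 z) / Y n) \<longlonglongrightarrow> H' t0 z" by (simp add: comp_def)
    qed
    show "\<And>n. (\<lambda>z. (H (t0 + Y n) z - H t0 z) / Y n) \<in> borel_measurable M"
      using int Yn e by (intro borel_measurable_divide borel_measurable_diff borel_measurable_integrable[of M] int) auto
  qed (use meas bd in auto)
  moreover have "(\<integral>z. (H (t0 + Y n) z - H t0 z) / Y n \<partial>M) = ((\<integral>z. H (t0 + Y n) z \<partial>M) - (\<integral>z. H t0 z \<partial>M)) / Y n" for n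
    using int[of "t0 + Y n"] int[of t0] Yn[of n] e by (simp add: Bochner_Integration.integral_diff)
  ultimately have "(\<lambda>n. ((\<integral>z. H (t0 + Y n) z \<partial>M) - (\<integral>z. H t0 z \<partial>M)) / Y n) \<longlonglongrightarrow> (\<integral>z. H' t0 z \<partial>M)"
    by (simp add: Yn)
  then show "((\<lambda>h. ((\<integral>z. H (t0 + h) z \<partial>M) - (\<integral>z. H t0 z \<partial>M)) / h) \<circ> X) \<longlonglongrightarrow> (\<integral>z. H' t0 z \<partial>M)"
    unfolding comp_def by (rule Lim_transform_eventually) (use ev in \<open>auto elim: eventually_mono\<close>)
qed

text \<open>The bounds are locally uniform in the parameter \<open>x\<close>, which is what dominated convergence in
  integrals over \<open>z\<close> requires. Functions of \<open>z\<close> alone are treated with a dummy parameter.\<close>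

definition lin_growth :: "('p::euclidean_space \<Rightarrow> 'a::euclidean_space \<Rightarrow> 'b::real_normed_vector) \<Rightarrow> bool" where
  "lin_growth T \<longleftrightarrow> continuous_on UNIV (\<lambda>p. T (fst p) (snd p)) \<and>
     (\<forall>R. \<exists>C\<ge>0. \<forall>x z. norm x \<le> R \<longrightarrow> norm (T x z) \<le> C * (1 + norm z))"

definition exp_growth :: "('p::euclidean_space \<Rightarrow> 'a::euclidean_space \<Rightarrow> real) \<Rightarrow> bool" where
  "exp_growth H \<longleftrightarrow> continuous_on UNIV (\<lambda>p. H (fst p) (snd p)) \<and>
     (\<forall>R. \<exists>C\<ge>0. \<forall>x z. norm x \<le> R \<longrightarrow> \<bar>H x z\<bar> \<le> exp (C * (1 + norm z)))"

lemma lin_growthE: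
  assumes "lin_growth T"
  obtains C where "C \<ge> 0" "\<And>x z. norm x \<le> R \<Longrightarrow> norm (T x z) \<le> C * (1 + norm z)"
  using assms unfolding lin_growth_def by meson

lemma exp_growthE:
  assumes "exp_growth T"
  obtains C where "C \<ge> 0" "\<And>x z. norm x \<le> R \<Longrightarrow> \<bar>T x z\<bar> \<le> exp (C * (1 + norm z))"
  using assms unfolding exp_growth_def by meson

lemma lin_growthI:
  assumes "continuous_on UNIV (\<lambda>p. T (fst p) (snd p))"
    and "\<And>R. \<exists>C\<ge>0. \<forall>x z. norm x \<le> R \<longrightarrow> norm (T x z) \<le> C * (1 + norm z)"
  shows "lin_growth T"
  using assms unfolding lin_growth_def by auto

lemma exp_growthI:
  assumes "continuous_on UNIV (\<lambda>p. H (fst p) (snd p))"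
    and "\<And>R. \<exists>C\<ge>0. \<forall>x z. norm x \<le> R \<longrightarrow> \<bar>H x z\<bar> \<le> exp (C * (1 + norm z))"
  shows "exp_growth H"
  using assms unfolding exp_growth_def by auto

lemma lin_growth_cont: "lin_growth T \<Longrightarrow> continuous_on UNIV (\<lambda>p. T (fst p) (snd p))"
  by (simp add: lin_growth_def)

lemma exp_growth_cont: "exp_growth T \<Longrightarrow> continuous_on UNIV (\<lambda>p. T (fst p) (snd p))"
  by (simp add: exp_growth_def)

lemma continuous_bounded_on_norm_le:
  fixes \<phi> :: "'p::euclidean_space \<Rightarrow> 'b::real_normed_vector"
  assumes "continuous_on UNIV \<phi>"
  obtains B where "B \<ge> 0" "\<And>x. norm x \<le> R \<Longrightarrow> norm (\<phi> x) \<le> B"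
proof -
  have "compact (\<phi> ` cball 0 R)"
    using assms by (intro compact_continuous_image) (auto intro: continuous_on_subset)
  then have "bounded (\<phi> ` cball 0 R)" by (rule compact_imp_bounded)
  then obtain B where "\<forall>y\<in>\<phi> ` cball 0 R. norm y \<le> B"
    unfolding bounded_iff by auto
  then have "\<And>x. norm x \<le> R \<Longrightarrow> norm (\<phi> x) \<le> max 0 B"
    by (simp add: le_max_iff_disj)
  then show thesis using that[of "max 0 B"] by simp
qed

lemma lin_growth_param:
  fixes \<phi> :: "'p::euclidean_space \<Rightarrow> 'b::real_normed_vector"
  assumes "continuous_on UNIV \<phi>"
  shows "lin_growth (\<lambda>x (z :: 'c::euclidean_space). \<phi> x)"
proof (rule lin_growthI)
  show "continuous_on UNIV (\<lambda>p. \<phi> (fst p))"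
    using assms by (intro continuous_on_compose2[OF assms] continuous_intros) auto
  fix R
  obtain B where B: "B \<ge> 0" "\<And>x. norm x \<le> R \<Longrightarrow> norm (\<phi> x) \<le> B"
    using continuous_bounded_on_norm_le[OF assms, where R="R"] by blast
  have "norm (\<phi> x) \<le> B * (1 + norm z)" if "norm x \<le> R" for x and z :: 'c
    using B(2)[OF that] B(1) by (simp add: distrib_left add_increasing2)
  then show "\<exists>C\<ge>0. \<forall>x (z :: 'c). norm x \<le> R \<longrightarrow> norm (\<phi> x) \<le> C * (1 + norm z)"
    using B(1) by (intro exI[of _ B]) auto
qed

lemma lin_growth_const: "lin_growth (\<lambda>x z. c)"
  by (rule lin_growth_param) auto

lemma lin_growth_fst: "lin_growth (\<lambda>x z. x)"
  by (rule lin_growth_param) auto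

lemma lin_growth_snd: "lin_growth (\<lambda>x z. z)"
  by (rule lin_growthI) (auto intro!: continuous_intros exI[of _ 1])

lemma lin_growth_add:
  assumes "lin_growth S" "lin_growth T"
  shows "lin_growth (\<lambda>x z. S x z + T x z)"
proof (rule lin_growthI)
  show "continuous_on UNIV (\<lambda>p. S (fst p) (snd p) + T (fst p) (snd p))"
    using assms by (intro continuous_intros lin_growth_cont)
  fix R
  obtain C where C: "C \<ge> 0" "\<And>x z. norm x \<le> R \<Longrightarrow> norm (S x z) \<le> C * (1 + norm z)"
    using lin_growthE[OF assms(1), where R="R"] by blast
  obtain D where D: "D \<ge> 0" "\<And>x z. norm x \<le> R \<Longrightarrow> norm (T x z) \<le> D * (1 + norm z)"
    using lin_growthE[OF assms(2), where R="R"] by blast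
  have "norm (S x z + T x z) \<le> (C + D) * (1 + norm z)" if "norm x \<le> R" for x z
    unfolding distrib_right using C(2)[OF that, of z] D(2)[OF that, of z] by (rule norm_triangle_mono)
  then show "\<exists>C\<ge>0. \<forall>x z. norm x \<le> R \<longrightarrow> norm (S x z + T x z) \<le> C * (1 + norm z)"
    using C D by (intro exI[of _ "C + D"]) auto
qed

lemma lin_growth_bounded_linear:
  assumes "lin_growth S" "bounded_linear h"
  shows "lin_growth (\<lambda>x z. h (S x z))"
proof (rule lin_growthI)
  interpret bounded_linear h by fact
  show "continuous_on UNIV (\<lambda>p. h (S (fst p) (snd p)))"
    using assms by (intro continuous_on continuous_intros lin_growth_cont)
  fix R
  obtain C where C: "C \<ge> 0" "\<And>x z. norm x \<le> R \<Longrightarrow> norm (S x z) \<le> C * (1 + norm z)"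
    using lin_growthE[OF assms(1), where R="R"] by blast
  obtain K where K: "0 < K" "\<And>x. norm (h x) \<le> norm x * K"
    using pos_bounded by blast
  have "norm (h (S x z)) \<le> (C * K) * (1 + norm z)" if "norm x \<le> R" for x z
    using order_trans[OF K(2)[of "S x z"] mult_right_mono[OF C(2)[OF that, of z], of K]] K(1) by (simp add: mult_ac)
  then show "\<exists>C\<ge>0. \<forall>x z. norm x \<le> R \<longrightarrow> norm (h (S x z)) \<le> C * (1 + norm z)"
    using C(1) K(1) by (intro exI[of _ "C * K"]) auto
qed

lemma lin_growth_scaleR_param:
  fixes \<phi> :: "'p::euclidean_space \<Rightarrow> real"
  assumes "continuous_on UNIV \<phi>" "lin_growth T"
  shows "lin_growth (\<lambda>x z. \<phi> x *\<^sub>R T x z)"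
proof (rule lin_growthI)
  show "continuous_on UNIV (\<lambda>p. \<phi> (fst p) *\<^sub>R T (fst p) (snd p))"
    using assms by (intro continuous_intros lin_growth_cont continuous_on_compose2[OF assms(1)]) auto
  fix R
  obtain C where C: "C \<ge> 0" "\<And>x z. norm x \<le> R \<Longrightarrow> norm (T x z) \<le> C * (1 + norm z)"
    using lin_growthE[OF assms(2), where R="R"] by blast
  obtain B where B: "B \<ge> 0" "\<And>x. norm x \<le> R \<Longrightarrow> norm (\<phi> x) \<le> B"
    using continuous_bounded_on_norm_le[OF assms(1), where R="R"] by blast
  have "norm (\<phi> x *\<^sub>R T x z) \<le> (B * C) * (1 + norm z)" if "norm x \<le> R" for x z
    using mult_mono[OF B(2)[OF that] C(2)[OF that, of z]] B(1) by (simp add: mult_ac)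
  then show "\<exists>C\<ge>0. \<forall>x z. norm x \<le> R \<longrightarrow> norm (\<phi> x *\<^sub>R T x z) \<le> C * (1 + norm z)"
    using C(1) B(1) by (intro exI[of _ "B * C"]) auto
qed

lemma lin_growth_minus: "lin_growth S \<Longrightarrow> lin_growth (\<lambda>x z. - S x z)"
  using lin_growth_bounded_linear[OF _ bounded_linear_minus[OF bounded_linear_ident]] by auto

lemma lin_growth_diff: "lin_growth S \<Longrightarrow> lin_growth T \<Longrightarrow> lin_growth (\<lambda>x z. S x z - T x z)"
  using lin_growth_add[OF _ lin_growth_minus] by auto

lemma lin_growth_inner_const: "lin_growth S \<Longrightarrow> lin_growth (\<lambda>x z. S x z \<bullet> b)"
  using lin_growth_bounded_linear[OF _ bounded_linear_inner_left] by auto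

lemma lin_growth_inner_const': "lin_growth S \<Longrightarrow> lin_growth (\<lambda>x z. b \<bullet> S x z)"
  using lin_growth_bounded_linear[OF _ bounded_linear_inner_right] by auto

lemma lin_growth_scaleR_const: "lin_growth S \<Longrightarrow> lin_growth (\<lambda>x z. S x z *\<^sub>R b)"
  using lin_growth_bounded_linear[OF _ bounded_linear_scaleR_left] by auto

lemma lin_growth_inner_param:
  assumes "lin_growth T"
  shows "lin_growth (\<lambda>x z. x \<bullet> T x z)"
proof (rule lin_growthI)
  show "continuous_on UNIV (\<lambda>p. fst p \<bullet> T (fst p) (snd p))"
    using assms by (intro continuous_intros lin_growth_cont) auto
  fix R
  obtain C where C: "C \<ge> 0" "\<And>x z. norm x \<le> R \<Longrightarrow> norm (T x z) \<le> C * (1 + norm z)"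
    using lin_growthE[OF assms, where R="R"] by blast
  have "norm (x \<bullet> T x z) \<le> (\<bar>R\<bar> * C) * (1 + norm z)" if "norm x \<le> R" for x z
  proof -
    have "norm (x \<bullet> T x z) \<le> norm x * norm (T x z)" by (simp add: Cauchy_Schwarz_ineq2)
    also have "\<dots> \<le> \<bar>R\<bar> * (C * (1 + norm z))"
      using that C by (intro mult_mono) auto
    finally show ?thesis by simp
  qed
  then show "\<exists>C\<ge>0. \<forall>x z. norm x \<le> R \<longrightarrow> norm (x \<bullet> T x z) \<le> C * (1 + norm z)"
    using C(1) by (intro exI[of _ "\<bar>R\<bar> * C"]) auto
qed

lemma lin_growth_compose:
  assumes g: "continuous_on UNIV g" "\<And>y. norm (g y) \<le> C * (1 + norm y)" and T: "lin_growth T"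
  shows "lin_growth (\<lambda>x z. g (T x z))"
proof (rule lin_growthI)
  show "continuous_on UNIV (\<lambda>p. g (T (fst p) (snd p)))"
    using assms by (intro continuous_on_compose2[OF g(1)] lin_growth_cont) auto
  fix R
  obtain D where D: "D \<ge> 0" "\<And>x z. norm x \<le> R \<Longrightarrow> norm (T x z) \<le> D * (1 + norm z)"
    using lin_growthE[OF T, where R="R"] by blast
  have C: "0 \<le> C"
    using order_trans[OF norm_ge_zero g(2)[of 0]] by simp
  have "norm (g (T x z)) \<le> (C * (1 + D)) * (1 + norm z)" if "norm x \<le> R" for x z
  proof -
    have "norm (g (T x z)) \<le> C * (1 + D * (1 + norm z))"
      using g(2)[of "T x z"] mult_left_mono[OF D(2)[OF that, of z] C] by (simp add: distrib_left)
    also have "\<dots> \<le> C * ((1 + D) * (1 + norm z))"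
      using C by (intro mult_left_mono) (auto simp: algebra_simps)
    finally show ?thesis by simp
  qed
  then show "\<exists>C\<ge>0. \<forall>x z. norm x \<le> R \<longrightarrow> norm (g (T x z)) \<le> C * (1 + norm z)"
    using C D(1) by (intro exI[of _ "C * (1 + D)"]) auto
qed

lemma exp_growth_exp:
  assumes "lin_growth T"
  shows "exp_growth (\<lambda>x z. exp (T x z))"
proof (rule exp_growthI)
  show "continuous_on UNIV (\<lambda>p. exp (T (fst p) (snd p)))"
    using assms by (intro continuous_intros lin_growth_cont)
  fix R
  obtain C where "C \<ge> 0" "\<And>x z. norm x \<le> R \<Longrightarrow> norm (T x z) \<le> C * (1 + norm z)"
    using lin_growthE[OF assms, where R="R"] by blast
  then show "\<exists>C\<ge>0. \<forall>x z. norm x \<le> R \<longrightarrow> \<bar>exp (T x z)\<bar> \<le> exp (C * (1 + norm z))"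
    by (intro exI[of _ C]) (auto dest: abs_le_D1)
qed

lemma exp_growth_lin:
  assumes "lin_growth T"
  shows "exp_growth T"
proof (rule exp_growthI)
  show "continuous_on UNIV (\<lambda>p. T (fst p) (snd p))"
    using assms by (rule lin_growth_cont)
  fix R
  obtain C where C: "C \<ge> 0" "\<And>x z. norm x \<le> R \<Longrightarrow> norm (T x z) \<le> C * (1 + norm z)"
    using lin_growthE[OF assms, where R="R"] by blast
  have "\<bar>T x z\<bar> \<le> exp (C * (1 + norm z))" if "norm x \<le> R" for x z
    using C(2)[OF that, of z] exp_ge_add_one_self[of "C * (1 + norm z)"] by (simp del: exp_ge_add_one_self)
  then show "\<exists>C\<ge>0. \<forall>x z. norm x \<le> R \<longrightarrow> \<bar>T x z\<bar> \<le> exp (C * (1 + norm z))"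
    using C by (intro exI[of _ C]) auto
qed

lemma exp_growth_mult:
  assumes "exp_growth S" "exp_growth T"
  shows "exp_growth (\<lambda>x z. S x z * T x z)"
proof (rule exp_growthI)
  show "continuous_on UNIV (\<lambda>p. S (fst p) (snd p) * T (fst p) (snd p))"
    using assms by (intro continuous_intros exp_growth_cont)
  fix R
  obtain C where C: "C \<ge> 0" "\<And>x z. norm x \<le> R \<Longrightarrow> \<bar>S x z\<bar> \<le> exp (C * (1 + norm z))"
    using exp_growthE[OF assms(1), where R="R"] by blast
  obtain D where D: "D \<ge> 0" "\<And>x z. norm x \<le> R \<Longrightarrow> \<bar>T x z\<bar> \<le> exp (D * (1 + norm z))"
    using exp_growthE[OF assms(2), where R="R"] by blast
  have "\<bar>S x z * T x z\<bar> \<le> exp ((C + D) * (1 + norm z))" if "norm x \<le> R" for x z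
    using mult_mono[OF C(2)[OF that, of z] D(2)[OF that, of z]] by (simp add: abs_mult distrib_right exp_add)
  then show "\<exists>C\<ge>0. \<forall>x z. norm x \<le> R \<longrightarrow> \<bar>S x z * T x z\<bar> \<le> exp (C * (1 + norm z))"
    using C D by (intro exI[of _ "C + D"]) auto
qed

lemma exp_growth_add:
  assumes "exp_growth S" "exp_growth T"
  shows "exp_growth (\<lambda>x z. S x z + T x z)"
proof (rule exp_growthI)
  show "continuous_on UNIV (\<lambda>p. S (fst p) (snd p) + T (fst p) (snd p))"
    using assms by (intro continuous_intros exp_growth_cont)
  fix R
  obtain C where C: "C \<ge> 0" "\<And>x z. norm x \<le> R \<Longrightarrow> \<bar>S x z\<bar> \<le> exp (C * (1 + norm z))"
    using exp_growthE[OF assms(1), where R="R"] by blast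
  obtain D where D: "D \<ge> 0" "\<And>x z. norm x \<le> R \<Longrightarrow> \<bar>T x z\<bar> \<le> exp (D * (1 + norm z))"
    using exp_growthE[OF assms(2), where R="R"] by blast
  \<comment> \<open>The extra \<open>1\<close> in the exponent absorbs the factor 2 of the sum,
    because \<open>1 + norm z\<close> is at least 1.\<close>
  have "\<bar>S x z + T x z\<bar> \<le> exp ((C + D + 1) * (1 + norm z))" if "norm x \<le> R" for x z
  proof -
    define n where "n = 1 + norm z"
    have n: "n \<ge> 1" by (simp add: n_def)
    have "\<bar>S x z + T x z\<bar> \<le> exp (C * n) + exp (D * n)"
      unfolding n_def using C(2)[OF that, of z] D(2)[OF that, of z] by linarith
    also have "\<dots> \<le> exp ((C + D) * n) + exp ((C + D) * n)"
      using C(1) D(1) n by (intro add_mono) (auto intro!: mult_right_mono)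
    also have "\<dots> = 2 * exp ((C + D) * n)" by simp
    also have "\<dots> \<le> exp n * exp ((C + D) * n)"
    proof (rule mult_right_mono)
      show "2 \<le> exp n" using n exp_ge_add_one_self[of n] by linarith
    qed simp
    finally show ?thesis by (simp add: n_def algebra_simps flip: exp_add)
  qed
  then show "\<exists>C\<ge>0. \<forall>x z. norm x \<le> R \<longrightarrow> \<bar>S x z + T x z\<bar> \<le> exp (C * (1 + norm z))"
    using C D by (intro exI[of _ "C + D + 1"]) auto
qed

lemma exp_growth_const: "exp_growth (\<lambda>x z. c)"
  by (intro exp_growth_lin lin_growth_const)

lemma exp_growth_minus: "exp_growth S \<Longrightarrow> exp_growth (\<lambda>x z. - S x z)"
  using exp_growth_mult[OF exp_growth_const[of "-1"]] by simp

lemma exp_growth_diff: "exp_growth S \<Longrightarrow> exp_growth T \<Longrightarrow> exp_growth (\<lambda>x z. S x z - T x z)"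
  using exp_growth_add[OF _ exp_growth_minus] by auto

lemma exp_growth_abs: "exp_growth S \<Longrightarrow> exp_growth (\<lambda>x z. \<bar>S x z\<bar>)"
  unfolding exp_growth_def by (auto intro!: continuous_intros)

lemma exp_growth_power: "exp_growth S \<Longrightarrow> exp_growth (\<lambda>x z. S x z ^ k)"
  by (induction k) (auto intro: exp_growth_const exp_growth_mult)

lemma exp_growth_sum: "(\<And>i. i \<in> I \<Longrightarrow> exp_growth (S i)) \<Longrightarrow> exp_growth (\<lambda>x z. \<Sum>i\<in>I. S i x z)"
  by (induction I rule: infinite_finite_induct) (auto intro: exp_growth_const exp_growth_add)

lemma exp_growth_bounded_compose:
  assumes g: "continuous_on UNIV g" "\<And>y. \<bar>g y\<bar> \<le> (C::real)" and T: "lin_growth T"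
  shows "exp_growth (\<lambda>x z. g (T x z))"
proof (intro exp_growth_lin lin_growth_compose[OF g(1) _ T])
  fix y
  have "0 \<le> C" using g(2)[of y] by linarith
  then show "norm (g y) \<le> C * (1 + norm y)"
    using g(2)[of y] by (simp add: distrib_left add_increasing2)
qed

text \<open>Serves to restrict a parametrised family to a line, and, with constant
  \<open>\<phi>\<close>, to freeze its parameter.\<close>

lemma exp_growth_reparam:
  assumes H: "exp_growth H" and \<phi>: "continuous_on UNIV \<phi>"
  shows "exp_growth (\<lambda>q z. H (\<phi> q) z)"
proof (rule exp_growthI)
  show "continuous_on UNIV (\<lambda>p. H (\<phi> (fst p)) (snd p))"
    by (rule continuous_on_compose2[OF exp_growth_cont[OF H], of _ "\<lambda>p. (\<phi> (fst p), snd p)", simplified])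
      (intro continuous_intros continuous_on_compose2[OF \<phi>], auto)
  fix R
  obtain B where "B \<ge> 0" "\<And>x. norm x \<le> R \<Longrightarrow> norm (\<phi> x) \<le> B"
    using continuous_bounded_on_norm_le[OF \<phi>, where R="R"] by blast
  moreover obtain C where "C \<ge> 0" "\<And>x z. norm x \<le> B \<Longrightarrow> \<bar>H x z\<bar> \<le> exp (C * (1 + norm z))"
    using exp_growthE[OF H, where R="B"] by blast
  ultimately show "\<exists>C\<ge>0. \<forall>x z. norm x \<le> R \<longrightarrow> \<bar>H (\<phi> x) z\<bar> \<le> exp (C * (1 + norm z))"
    by (intro exI[of _ C]) auto
qed

lemmas growth_intros = lin_growth_const lin_growth_fst lin_growth_snd lin_growth_add lin_growth_diff lin_growth_minus
  lin_growth_inner_const lin_growth_inner_const' lin_growth_scaleR_const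
  exp_growth_const exp_growth_add exp_growth_diff exp_growth_mult exp_growth_minus exp_growth_exp exp_growth_power exp_growth_sum

lemma exp_growth_slice_cont: "exp_growth H \<Longrightarrow> continuous_on UNIV (H x)"
  using continuous_on_compose2[OF exp_growth_cont, of H UNIV "\<lambda>z. (x, z)"]
  by (simp add: continuous_on_Pair)

lemma exp_growth_slice_cont': "exp_growth H \<Longrightarrow> continuous_on UNIV (\<lambda>x. H x z)"
  using continuous_on_compose2[OF exp_growth_cont, of H UNIV "\<lambda>x. (x, z)"]
  by (simp add: continuous_on_Pair)

lemma exp_growth_measurable: "exp_growth H \<Longrightarrow> H x \<in> borel_measurable borel"
  by (intro borel_measurable_continuous_onI exp_growth_slice_cont)

lemma integrable_gauss_exp: "integrable gauss (\<lambda>z::'a::euclidean_space. exp (C * (1 + norm z)))"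
  using integrable_mult_right[OF integrable_gauss_exp_norm[of C, where 'a='a], of "exp C"]
  by (simp add: distrib_left exp_add)

lemma exp_growth_integrable:
  assumes "exp_growth H"
  shows "integrable gauss (H x)"
proof -
  obtain C where "C \<ge> 0" and C: "\<And>y z. norm y \<le> norm x \<Longrightarrow> \<bar>H y z\<bar> \<le> exp (C * (1 + norm z))"
    using exp_growthE[OF assms, where R="norm x"] by blast
  show ?thesis
    by (rule Bochner_Integration.integrable_bound[OF integrable_gauss_exp[of C]])
      (use C exp_growth_measurable[OF assms] in auto)
qed

lemma exp_growth_integral_continuous:
  fixes H :: "'p::euclidean_space \<Rightarrow> 'a::euclidean_space \<Rightarrow> real"
  assumes H: "exp_growth H"
  shows "continuous_on UNIV (\<lambda>x. \<integral>z. H x z \<partial>gauss)"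
  unfolding continuous_on_sequentially
proof (intro allI ballI impI)
  fix x and a :: "'p" and X :: "nat \<Rightarrow> 'p"
  assume "(\<forall>n. X n \<in> UNIV) \<and> X \<longlonglongrightarrow> a"
  then have X: "X \<longlonglongrightarrow> a" by simp
  then have "Bseq X" by (intro convergent_imp_Bseq convergentI)
  then obtain R where R: "\<And>n. norm (X n) \<le> R" unfolding Bseq_def by auto
  obtain C where "C \<ge> 0" and C: "\<And>x z. norm x \<le> R \<Longrightarrow> \<bar>H x z\<bar> \<le> exp (C * (1 + norm z))"
    using exp_growthE[OF H, where R="R"] by blast
  show "((\<lambda>x. \<integral>z. H x z \<partial>gauss) \<circ> X) \<longlonglongrightarrow> (\<integral>z. H a z \<partial>gauss)"
    unfolding comp_def
  proof (rule integral_dominated_convergence[OF _ _ integrable_gauss_exp[of C]])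
    show "AE z in gauss. (\<lambda>n. H (X n) z) \<longlonglongrightarrow> H a z"
      by (intro AE_I2 continuous_on_tendsto_compose[OF exp_growth_slice_cont'[OF H] X]) auto
  qed (use C R exp_growth_measurable[OF H] in auto)
qed

lemma exp_growth_has_derivative:
  fixes H H' :: "real \<Rightarrow> 'a::euclidean_space \<Rightarrow> real"
  assumes H: "exp_growth H" and H': "exp_growth H'"
    and der: "\<And>t z. ((\<lambda>t. H t z) has_real_derivative H' t z) (at t)"
  shows "((\<lambda>t. \<integral>z. H t z \<partial>gauss) has_real_derivative (\<integral>z. H' t z \<partial>gauss)) (at t)"
proof -
  obtain C where "C \<ge> 0" and C: "\<And>s z. norm s \<le> \<bar>t\<bar> + 1 \<Longrightarrow> \<bar>H' s z\<bar> \<le> exp (C * (1 + norm z))"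
    using exp_growthE[OF H', where R="\<bar>t\<bar> + 1"] by blast
  show ?thesis
    by (rule has_real_derivative_integral[where e=1 and w="\<lambda>z. exp (C * (1 + norm z))"])
      (auto intro!: exp_growth_integrable[OF H] der C integrable_gauss_exp exp_growth_measurable[OF H'])
qed

section \<open>Integration by parts and monotone transport on the line\<close>

text \<open>Integrate \<open>G (x + t *\<^sub>R b)\<close> over \<open>t\<close> in the unit
  interval and over all \<open>x\<close>. The inner integral over \<open>t\<close> is
  \<open>F (x + b) - F x\<close>, whose integral over \<open>x\<close> vanishes by translation
  invariance; in the other order one obtains the integral of \<open>G\<close>. Thus no decay of
  \<open>F\<close> along lines has to be discussed. The finite exceptional sets admit functions with
  a kink, such as the truncated paraboloid used later.\<close>

lemma integral_partial_zero:
  fixes F G :: "'a::euclidean_space \<Rightarrow> real"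
  assumes F: "integrable lborel F" and G: "integrable lborel G"
    and bd: "\<And>x. \<bar>G x\<bar> \<le> B"
    and cont: "\<And>x. continuous_on UNIV (\<lambda>t. F (x + t *\<^sub>R b))"
    and der: "\<And>x. \<exists>N. finite N \<and> (\<forall>t. t \<notin> N \<longrightarrow> ((\<lambda>t. F (x + t *\<^sub>R b)) has_real_derivative G (x + t *\<^sub>R b)) (at t))"
  shows "(\<integral>x. G x \<partial>lborel) = 0"
proof -
  have [measurable]: "F \<in> borel_measurable borel" "G \<in> borel_measurable borel"
    using F G by auto
  let ?I = "\<lambda>t. indicator {0..1::real} t :: real"
  have line: "(\<integral>t. ?I t * G (x + t *\<^sub>R b) \<partial>lborel) = F (x + b) - F x" for x
  proof -
    have si: "set_integrable lborel {0..1} (\<lambda>t. G (x + t *\<^sub>R b))"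
      unfolding set_integrable_def
    proof (rule Bochner_Integration.integrable_bound)
      show "integrable lborel (\<lambda>t. B * ?I t)" by simp
      show "AE t in lborel. norm (?I t *\<^sub>R G (x + t *\<^sub>R b)) \<le> norm (B * ?I t)"
        using bd by (intro AE_I2) (auto simp: indicator_def intro: order_trans[OF bd abs_ge_self])
    qed simp
    obtain N where N: "finite N" "\<And>t. t \<notin> N \<Longrightarrow> ((\<lambda>t. F (x + t *\<^sub>R b)) has_real_derivative G (x + t *\<^sub>R b)) (at t)"
      using der[of x] by auto
    have "((\<lambda>t. G (x + t *\<^sub>R b)) has_integral (F (x + 1 *\<^sub>R b) - F (x + 0 *\<^sub>R b))) {0..1}"
      using N cont[of x]
      by (intro fundamental_theorem_of_calculus_interior_strong[where S=N])
        (auto simp: has_real_derivative_iff_has_vector_derivative intro: continuous_on_subset)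
    then show ?thesis
      using set_borel_integral_eq_integral(2)[OF si] by (simp add: integral_unique set_lebesgue_integral_def)
  qed
  have nn: "(\<integral>\<^sup>+x. \<integral>\<^sup>+t. ennreal (norm (?I t * G (x + t *\<^sub>R b))) \<partial>lborel \<partial>lborel) < \<infinity>"
  proof -
    have "(\<integral>\<^sup>+x. \<integral>\<^sup>+t. ennreal (norm (?I t * G (x + t *\<^sub>R b))) \<partial>lborel \<partial>lborel)
       = (\<integral>\<^sup>+t. \<integral>\<^sup>+x. ennreal (norm (?I t * G (x + t *\<^sub>R b))) \<partial>lborel \<partial>lborel)"
      by (rule lborel_pair.Fubini') measurable
    also have "\<dots> = (\<integral>\<^sup>+t. indicator {0..1::real} t * (\<integral>\<^sup>+x. ennreal (norm (G x)) \<partial>lborel) \<partial>lborel)"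
    proof (rule nn_integral_cong)
      fix t :: real
      show "(\<integral>\<^sup>+x. ennreal (norm (?I t * G (x + t *\<^sub>R b))) \<partial>lborel) = indicator {0..1::real} t * (\<integral>\<^sup>+x. ennreal (norm (G x)) \<partial>lborel)"
        using nn_integral_lborel_translate[of "\<lambda>x. ennreal (norm (G x))" "t *\<^sub>R b"]
        by (auto simp: indicator_def)
    qed
    also have "\<dots> = (\<integral>\<^sup>+x. ennreal (norm (G x)) \<partial>lborel)"
      by (simp add: nn_integral_multc)
    also have "\<dots> < \<infinity>" using G by (simp add: integrable_iff_bounded)
    finally show ?thesis .
  qed
  have int: "integrable (lborel \<Otimes>\<^sub>M lborel) (\<lambda>(x, t). ?I t * G (x + t *\<^sub>R b))"
    unfolding integrable_iff_bounded
    using nn by (subst lborel.nn_integral_fst[symmetric]) (auto simp: split_beta')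
  have "(\<integral>x. \<integral>t. ?I t * G (x + t *\<^sub>R b) \<partial>lborel \<partial>lborel) = (\<integral>t. \<integral>x. ?I t * G (x + t *\<^sub>R b) \<partial>lborel \<partial>lborel)"
    using lborel_pair.Fubini_integral[OF int] by simp
  also have "\<dots> = (\<integral>t. ?I t * (\<integral>x. G x \<partial>lborel) \<partial>lborel)"
    using integral_lborel_translate[of G] by simp
  also have "\<dots> = (\<integral>x. G x \<partial>lborel)" by simp
  also have "(\<integral>x. \<integral>t. ?I t * G (x + t *\<^sub>R b) \<partial>lborel \<partial>lborel) = (\<integral>x. F (x + b) - F x \<partial>lborel)"
    unfolding line ..
  also have "\<dots> = 0"
    using F integrable_lborel_translate[OF F] integral_lborel_translate[of F]
    by (simp add: Bochner_Integration.integral_diff)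
  finally show ?thesis by simp
qed

lemma exp_gdens_integrable: "integrable lborel (\<lambda>x::'a::euclidean_space. exp (C * (1 + norm x)) * gdens x)"
  using integrable_gauss_exp[of C, where 'a='a] by (subst (asm) integrable_gauss_iff) (auto simp: mult.commute)

text \<open>Provides the uniform bound on derivatives that \<open>integral_partial_zero\<close> asks
  for; it is \<open>0 \<le> (C - norm x)\<^sup>2\<close> rearranged.\<close>

lemma exp_gdens_bounded: "exp (C * (1 + norm x)) * gdens (x::'a::euclidean_space) \<le> exp (C + C\<^sup>2 / 2) * gdens (0::'a)"
proof -
  have "C * (1 + norm x) - (norm x)\<^sup>2 / 2 \<le> C + C\<^sup>2 / 2"
    using zero_le_power2[of "C - norm x"] by (simp add: power2_diff algebra_simps)
  then have "exp (C * (1 + norm x)) * exp (- (norm x)\<^sup>2 / 2) \<le> exp (C + C\<^sup>2 / 2)"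
    by (simp flip: exp_add)
  then show ?thesis
    by (simp add: gdens_def mult.left_commute mult_left_mono)
qed

lemma partial_at_shift:
  fixes F :: "'a::real_vector \<Rightarrow> real"
  assumes "\<And>x. ((\<lambda>t. F (x + t *\<^sub>R b)) has_real_derivative G x) (at 0)"
  shows "((\<lambda>t. F (x + t *\<^sub>R b)) has_real_derivative G (x + t *\<^sub>R b)) (at t)"
proof -
  have "(\<lambda>s. F (x + (s + t) *\<^sub>R b)) = (\<lambda>s. F ((x + t *\<^sub>R b) + s *\<^sub>R b))"
    by (simp add: algebra_simps)
  then show ?thesis
    using assms[of "x + t *\<^sub>R b"] DERIV_shift[of "\<lambda>t. F (x + t *\<^sub>R b)" "G (x + t *\<^sub>R b)" 0 t]
    by simp
qed

lemma integral_partial_zero':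
  fixes F G :: "'a::euclidean_space \<Rightarrow> real"
  assumes contF: "continuous_on UNIV F" and G[measurable]: "G \<in> borel_measurable borel"
    and Fb: "\<And>x. \<bar>F x\<bar> \<le> exp (C * (1 + norm x)) * gdens x"
    and Gb: "\<And>x. \<bar>G x\<bar> \<le> exp (C * (1 + norm x)) * gdens x"
    and der: "\<And>x. ((\<lambda>t. F (x + t *\<^sub>R b)) has_real_derivative G x) (at 0)"
  shows "(\<integral>x. G x \<partial>lborel) = 0" "integrable lborel G"
proof -
  have [measurable]: "F \<in> borel_measurable borel"
    using contF by (rule borel_measurable_continuous_onI)
  show iG: "integrable lborel G"
    by (rule Bochner_Integration.integrable_bound[OF exp_gdens_integrable[of C]]) (use Gb in auto)
  show "(\<integral>x. G x \<partial>lborel) = 0"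
  proof (rule integral_partial_zero[where F=F and b=b])
    show "integrable lborel F"
      by (rule Bochner_Integration.integrable_bound[OF exp_gdens_integrable[of C]]) (use Fb in auto)
    show "\<bar>G x\<bar> \<le> exp (C + C\<^sup>2 / 2) * gdens (0::'a)" for x
      using order_trans[OF Gb exp_gdens_bounded] .
    show "continuous_on UNIV (\<lambda>t. F (x + t *\<^sub>R b))" for x
      by (intro continuous_on_compose2[OF contF] continuous_intros) auto
    show "\<exists>N. finite N \<and> (\<forall>t. t \<notin> N \<longrightarrow> ((\<lambda>t. F (x + t *\<^sub>R b)) has_real_derivative G (x + t *\<^sub>R b)) (at t))" for x
    proof (intro exI[of _ "{}"] conjI allI impI)
      fix t
      show "((\<lambda>t. F (x + t *\<^sub>R b)) has_real_derivative G (x + t *\<^sub>R b)) (at t)"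
        using der by (rule partial_at_shift)
    qed simp
  qed (rule iG)
qed

lemma gdens_line_derivative:
  "((\<lambda>t. gdens (x + t *\<^sub>R b)) has_real_derivative (- (x \<bullet> b) * gdens x)) (at 0)"
proof -
  have "gdens (x + t *\<^sub>R b) = gdens x * exp (- (t * (x \<bullet> b)) - t\<^sup>2 * (norm b)\<^sup>2 / 2)" for t
    by (simp add: gdens_add power_mult_distrib)
  moreover have "((\<lambda>t. gdens x * exp (- (t * (x \<bullet> b)) - t\<^sup>2 * (norm b)\<^sup>2 / 2)) has_real_derivative (- (x \<bullet> b) * gdens x)) (at 0)"
    by (rule derivative_eq_intros refl | simp)+
  ultimately show ?thesis by simp
qed

text \<open>Stein's identity: the derivative of \<open>F * gdens\<close> along \<open>b\<close> is
  \<open>(G - (x \<bullet> b) * F) * gdens\<close>, and its integral vanishes. The centroid formula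
  and the passage from the Laplacian of the heat flow to first derivatives both rest on it.\<close>

lemma gauss_parts:
  fixes F G :: "'a::euclidean_space \<Rightarrow> real"
  assumes F: "exp_growth (\<lambda>_::real. F)" and G: "exp_growth (\<lambda>_::real. G)"
    and der: "\<And>x. ((\<lambda>t. F (x + t *\<^sub>R b)) has_real_derivative G x) (at 0)"
  shows "(\<integral>x. G x \<partial>gauss) = (\<integral>x. (x \<bullet> b) * F x \<partial>gauss)"
proof -
  have yF: "exp_growth (\<lambda>_::real. \<lambda>x. (x \<bullet> b) * F x)"
    by (intro growth_intros F exp_growth_lin)
  have D: "exp_growth (\<lambda>_::real. \<lambda>x. G x - (x \<bullet> b) * F x)"
    by (intro growth_intros F G exp_growth_lin)
  \<comment> \<open>Adding the two absolute values yields one exponential bound valid for the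
    function and for its derivative together.\<close>
  have FD: "exp_growth (\<lambda>_::real. \<lambda>x. \<bar>F x\<bar> + \<bar>G x - (x \<bullet> b) * F x\<bar>)"
    by (intro growth_intros exp_growth_abs F D)
  obtain C where C: "C \<ge> 0" "\<And>t x. norm (t::real) \<le> 0 \<Longrightarrow> \<bar>\<bar>F x\<bar> + \<bar>G x - (x \<bullet> b) * F x\<bar>\<bar> \<le> exp (C * (1 + norm x))"
    using exp_growthE[OF FD, where R=0] by blast
  have Cb: "\<bar>F x\<bar> + \<bar>G x - (x \<bullet> b) * F x\<bar> \<le> exp (C * (1 + norm x))" for x
    using C(2)[of 0 x] by simp
  have "(\<integral>x. (G x - (x \<bullet> b) * F x) * gdens x \<partial>lborel) = 0"
  proof (rule integral_partial_zero'(1)[where F="\<lambda>x. F x * gdens x" and C=C and b=b])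
    show "continuous_on UNIV (\<lambda>x. F x * gdens x)"
      by (intro continuous_intros exp_growth_slice_cont[OF F] continuous_gdens)
    show "(\<lambda>x. (G x - x \<bullet> b * F x) * gdens x) \<in> borel_measurable borel"
      using exp_growth_measurable[OF D] by simp
    fix x
    show "\<bar>F x * gdens x\<bar> \<le> exp (C * (1 + norm x)) * gdens x"
      using Cb[of x] by (simp add: abs_mult mult_right_mono)
    show "\<bar>(G x - x \<bullet> b * F x) * gdens x\<bar> \<le> exp (C * (1 + norm x)) * gdens x"
      using Cb[of x] by (simp add: abs_mult mult_right_mono)
    show "((\<lambda>t. F (x + t *\<^sub>R b) * gdens (x + t *\<^sub>R b)) has_real_derivative (G x - x \<bullet> b * F x) * gdens x) (at 0)"
      using DERIV_mult[OF der gdens_line_derivative, of x x] by (simp add: algebra_simps)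
  qed
  then have "(\<integral>x. G x - (x \<bullet> b) * F x \<partial>gauss) = 0"
    using exp_growth_measurable[OF D] by (subst integral_gauss) (auto simp: mult.commute)
  then show ?thesis
    using exp_growth_integrable[OF G] exp_growth_integrable[OF yF]
    by (simp add: Bochner_Integration.integral_diff)
qed

section \<open>Distribution functions of positive densities on the line\<close>

definition pcdf :: "(real \<Rightarrow> real) \<Rightarrow> real \<Rightarrow> real" where
  "pcdf p x = (\<integral>s. indicator {..x} s * p s \<partial>lborel)"

locale pos_density =
  fixes p :: "real \<Rightarrow> real"
  assumes cont: "continuous_on UNIV p" and pos: "\<And>x. 0 < p x"
    and integrable: "integrable lborel p" and total: "(\<integral>x. p x \<partial>lborel) = 1"
begin

lemma meas [measurable]: "p \<in> borel_measurable borel"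
  using cont by (rule borel_measurable_continuous_onI)

abbreviation "M \<equiv> density lborel (\<lambda>x. ennreal (p x))"

lemma measure_M: "A \<in> sets borel \<Longrightarrow> measure M A = (\<integral>s. indicator A s * p s \<partial>lborel)"
proof -
  assume A[measurable]: "A \<in> sets borel"
  have "emeasure M A = (\<integral>\<^sup>+s. ennreal (indicator A s * p s) \<partial>lborel)"
    by (subst emeasure_density) (auto intro!: nn_integral_cong simp: indicator_def)
  also have "\<dots> = ennreal (\<integral>s. indicator A s * p s \<partial>lborel)"
    using pos integrable
    by (intro nn_integral_eq_integral integrable_mult_indicator[where 'b=real, simplified]) (auto simp: less_imp_le)
  finally show ?thesis
    using pos by (simp add: measure_def less_imp_le integral_nonneg_AE)
qed

lemma rd: "real_distribution M"
proof -
  have "emeasure M UNIV = ennreal (\<integral>x. p x \<partial>lborel)"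
    using pos integrable by (simp add: emeasure_density nn_integral_eq_integral less_imp_le)
  then have "prob_space M" by (intro prob_spaceI) (simp add: total)
  then show ?thesis
    by (simp add: real_distribution_def real_distribution_axioms_def)
qed

sublocale real_distribution M by (rule rd)

lemma pcdf_eq: "pcdf p = cdf M"
  by (rule ext) (simp add: pcdf_def cdf_def2 measure_M)

text \<open>The fundamental theorem of calculus is applied on a compact interval: near
  \<open>x\<close> the distribution function is its value at \<open>x - 1\<close> plus an integral
  starting there, and \<open>x\<close> is interior to \<open>{x - 1..x + 1}\<close>.\<close>

lemma pcdf_derivative: "(pcdf p has_real_derivative p x) (at x)"
proof -
  have eq: "pcdf p y = pcdf p (x - 1) + integral {x - 1..y} p" if "x - 1 \<le> y" for y
  proof -
    have si: "set_integrable lborel {x - 1<..y} p"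
      using integrable unfolding set_integrable_def by (intro integrable_mult_indicator) auto
    have "pcdf p y - pcdf p (x - 1) = measure M {x - 1<..y}"
      unfolding pcdf_eq using that by (cases "x - 1 = y") (auto simp: cdf_diff_eq)
    also have "\<dots> = (LINT s:{x - 1<..y}|lborel. p s)"
      by (simp add: measure_M set_lebesgue_integral_def)
    also have "\<dots> = integral {x - 1<..y} p"
      using si by (rule set_borel_integral_eq_integral)
    also have "\<dots> = integral {x - 1..y} p"
      by (rule integral_spike_set) (auto intro!: negligible_subset[OF negligible_sing[of "x - 1"]])
    finally show ?thesis by simp
  qed
  have "((\<lambda>y. integral {x - 1..y} p) has_real_derivative p x) (at x within {x - 1..x + 1})"
    by (rule integral_has_real_derivative) (auto intro: continuous_on_subset[OF cont])
  then have "((\<lambda>y. integral {x - 1..y} p) has_real_derivative p x) (at x)"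
    by (simp add: at_within_Icc_at)
  then have "((\<lambda>y. pcdf p (x - 1) + integral {x - 1..y} p) has_real_derivative p x) (at x)"
    using DERIV_add[OF DERIV_const] by fastforce
  then show ?thesis
    by (rule has_field_derivative_transform_within_open[where S="{x - 1<..}"]) (auto intro: eq[symmetric])
qed

lemma pcdf_strict_mono: "x < y \<Longrightarrow> pcdf p x < pcdf p y"
  using pcdf_derivative pos by (intro DERIV_pos_imp_increasing[of x y "pcdf p"]) auto

lemma pcdf_less_iff: "pcdf p x < pcdf p y \<longleftrightarrow> x < y"
  using pcdf_strict_mono by (metis less_asym linorder_neqE)

lemma pcdf_le_iff: "pcdf p x \<le> pcdf p y \<longleftrightarrow> x \<le> y"
  using pcdf_less_iff by (meson not_le)

lemma pcdf_inject: "pcdf p x = pcdf p y \<longleftrightarrow> x = y"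
  using pcdf_le_iff by (metis order_antisym order_refl)

lemma pcdf_pos: "0 < pcdf p x"
proof -
  have "0 \<le> pcdf p (x - 1)" by (simp add: pcdf_eq cdf_nonneg)
  also have "\<dots> < pcdf p x" by (rule pcdf_strict_mono) simp
  finally show ?thesis .
qed

lemma pcdf_less_1: "pcdf p x < 1"
proof -
  have "pcdf p x < pcdf p (x + 1)" by (rule pcdf_strict_mono) simp
  also have "\<dots> \<le> 1" by (simp add: pcdf_eq cdf_bounded_prob)
  finally show ?thesis .
qed

lemma pcdf_isCont: "isCont (pcdf p) x"
  using pcdf_derivative by (rule DERIV_isCont)

lemma pcdf_surj:
  assumes "0 < u" "u < 1"
  shows "\<exists>x. pcdf p x = u"
proof -
  obtain a where a: "pcdf p a < u"
    using order_tendstoD(2)[OF cdf_lim_at_bot assms(1)] unfolding pcdf_eq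
    by (metis eventually_at_bot_linorder order_refl)
  obtain b where b: "u < pcdf p b"
    using order_tendstoD(1)[OF cdf_lim_at_top_prob assms(2)] unfolding pcdf_eq
    by (metis eventually_at_top_linorder order_refl)
  have "a \<le> b" using a b pcdf_le_iff by (meson less_imp_le order_trans)
  then show ?thesis
    using IVT[of "pcdf p" a u b] a b pcdf_isCont by auto
qed

lemma integral_split: "pcdf p x + (\<integral>s. indicator {x<..} s * p s \<partial>lborel) = 1"
proof -
  have "pcdf p x + (\<integral>s. indicator {x<..} s * p s \<partial>lborel) =
     (\<integral>s. indicator {..x} s * p s + indicator {x<..} s * p s \<partial>lborel)"
    unfolding pcdf_def using integrable
    by (intro Bochner_Integration.integral_add[symmetric] integrable_mult_indicator[where 'b=real, simplified]) auto
  also have "\<dots> = (\<integral>s. p s \<partial>lborel)"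
    by (intro Bochner_Integration.integral_cong) (auto simp: indicator_def)
  finally show ?thesis by (simp add: total)
qed

end

text \<open>Compare the integrands below \<open>x\<close> or above \<open>x\<close>, depending on which density is larger at \<open>x\<close>.\<close>
lemma pcdf_le_of_increasing_ratio:
  assumes p: "pos_density p" and q: "pos_density q"
    and ratio: "\<And>s t. s \<le> t \<Longrightarrow> p s * q t \<le> p t * q s"
  shows "pcdf p x \<le> pcdf q x"
proof -
  interpret p: pos_density p by fact
  interpret q: pos_density q by fact
  have ii: "A \<in> sets borel \<Longrightarrow> integrable lborel (\<lambda>s. indicator A s * p s)"
     "A \<in> sets borel \<Longrightarrow> integrable lborel (\<lambda>s. indicator A s * q s)" for A
    using p.integrable q.integrable by (intro integrable_mult_indicator[where 'b=real, simplified]; simp)+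
  show ?thesis
  proof (cases "p x \<le> q x")
    case True
    have le: "p s \<le> q s" if "s \<le> x" for s
    proof -
      have "p s * q x \<le> p x * q s" using ratio[OF that] .
      also have "\<dots> \<le> q x * q s" using True q.pos[of s] by (simp add: mult_right_mono)
      finally show ?thesis using q.pos[of x] by (simp add: mult.commute)
    qed
    show ?thesis unfolding pcdf_def
      by (intro integral_mono ii) (auto simp: indicator_def le)
  next
    case False
    have le: "q s \<le> p s" if "x \<le> s" for s
    proof -
      have "p x * q s \<le> p s * q x" using ratio[OF that] .
      also have "\<dots> \<le> p s * p x" using False p.pos[of s] by (simp add: mult_left_mono)
      finally show ?thesis using p.pos[of x] by (simp add: mult.commute)
    qed
    have "(\<integral>s. indicator {x<..} s * q s \<partial>lborel) \<le> (\<integral>s. indicator {x<..} s * p s \<partial>lborel)"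
      by (intro integral_mono ii) (auto simp: indicator_def le)
    then show ?thesis using p.integral_split[of x] q.integral_split[of x] by linarith
  qed
qed

text \<open>The increasing rearrangement of \<open>p\<close> onto \<open>q\<close>. For positive
  densities the described \<open>y\<close> exists uniquely, since \<open>pcdf q\<close> maps the
  line bijectively onto the open unit interval.\<close>

definition transport :: "(real \<Rightarrow> real) \<Rightarrow> (real \<Rightarrow> real) \<Rightarrow> real \<Rightarrow> real" where
  "transport p q x = (THE y. pcdf q y = pcdf p x)"

text \<open>The two equivalences turn any bound on the map into a comparison of distribution
  functions; the displacement bound and measurability in a parameter are obtained that way. The
  derivative is the Jacobian equation \<open>q (T x) * T' x = p x\<close>, and the image measure is
  identified by its distribution function, since \<open>T x \<le> y\<close> exactly when
  \<open>x \<le> z\<close> for the point \<open>z\<close> with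
  \<open>pcdf p z = pcdf q y\<close>.\<close>

lemma
  assumes p: "pos_density p" and q: "pos_density q"
  shows transport_le_iff: "transport p q x \<le> y \<longleftrightarrow> pcdf p x \<le> pcdf q y"
    and le_transport_iff: "y \<le> transport p q x \<longleftrightarrow> pcdf q y \<le> pcdf p x"
    and transport_derivative: "(transport p q has_real_derivative p x / q (transport p q x)) (at x)"
    and distr_transport: "distr (density lborel (\<lambda>x. ennreal (p x))) borel (transport p q) = density lborel (\<lambda>x. ennreal (q x))"
proof -
  interpret p: pos_density p by fact
  interpret q: pos_density q by fact
  have ex: "\<exists>!y. pcdf q y = pcdf p x" for x
    using q.pcdf_surj[OF p.pcdf_pos p.pcdf_less_1] q.pcdf_inject by metis
  have T: "pcdf q (transport p q x) = pcdf p x" for x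
    unfolding transport_def using ex by (rule theI')
  show le: "transport p q x \<le> y \<longleftrightarrow> pcdf p x \<le> pcdf q y" for x y
    by (metis T q.pcdf_le_iff)
  show "y \<le> transport p q x \<longleftrightarrow> pcdf q y \<le> pcdf p x" for x y
    by (metis T q.pcdf_le_iff)
  define Q where "Q u = (THE y. pcdf q y = u)" for u
  have QF: "Q (pcdf q y) = y" for y
    unfolding Q_def using q.pcdf_inject by (intro the_equality) auto
  have FQ: "pcdf q (Q u) = u" if "0 < u" "u < 1" for u
    using q.pcdf_surj[OF that] QF by metis
  have TQ: "transport p q x = Q (pcdf p x)" for x
    by (simp add: transport_def Q_def)
  have contQ: "isCont Q (pcdf q y)" for y
    by (rule isCont_inverse_function[of 1]) (auto simp: QF q.pcdf_isCont)
  show "(transport p q has_real_derivative p x / q (transport p q x)) (at x)" for x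
  proof -
    have "(Q has_real_derivative inverse (q (transport p q x))) (at (pcdf p x))"
    proof (rule DERIV_inverse_function[of "pcdf q" _ _ _ 0 1])
      show "(pcdf q has_real_derivative q (transport p q x)) (at (Q (pcdf p x)))"
        using q.pcdf_derivative by (simp add: TQ)
      show "q (transport p q x) \<noteq> 0" using q.pos by (metis less_irrefl)
      show "isCont Q (pcdf p x)" using contQ[of "transport p q x"] by (simp add: T)
    qed (auto simp: p.pcdf_pos p.pcdf_less_1 FQ)
    from DERIV_chain2[OF this p.pcdf_derivative] show ?thesis
      by (simp add: TQ[abs_def] field_simps)
  qed
  have "mono (transport p q)"
    by (rule monoI) (simp add: le T p.pcdf_le_iff)
  then have [measurable]: "transport p q \<in> borel_measurable borel"
    by (rule borel_measurable_mono)
  show "distr p.M borel (transport p q) = q.M"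
  proof (rule cdf_unique[OF _ q.rd])
    show "real_distribution (distr p.M borel (transport p q))"
      by (intro p.real_distribution_distr) simp
    show "cdf (distr p.M borel (transport p q)) = cdf q.M"
    proof
      fix y
      obtain z where z: "pcdf p z = pcdf q y"
        using p.pcdf_surj[OF q.pcdf_pos q.pcdf_less_1] by metis
      have "cdf (distr p.M borel (transport p q)) y = measure p.M (transport p q -` {..y} \<inter> UNIV)"
        by (simp add: cdf_def2 measure_distr)
      also have "transport p q -` {..y} \<inter> UNIV = {..z}"
        by (auto simp: le z[symmetric] p.pcdf_le_iff)
      also have "measure p.M {..z} = cdf q.M y"
        using z by (simp add: p.pcdf_eq q.pcdf_eq cdf_def2)
      finally show "cdf (distr p.M borel (transport p q)) y = cdf q.M y" .
    qed
  qed
qed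

lemma lin_growth_norm: "lin_growth S \<Longrightarrow> lin_growth (\<lambda>x z. norm (S x z))"
  unfolding lin_growth_def by (auto intro!: continuous_intros)

section \<open>Lipschitz perturbations of the Gaussian density on the line\<close>

lemma integral_gdens: "(\<integral>x. gdens (x::'a::euclidean_space) \<partial>lborel) = 1"
proof -
  interpret prob_space "gauss :: 'a measure" by (rule prob_space_gauss)
  have "(\<integral>x. 1 \<partial>(gauss::'a measure)) = (1::real)" using prob_space by simp
  then show ?thesis by (subst (asm) integral_gauss) auto
qed

lemma integrable_gdens: "integrable lborel (gdens :: 'a::euclidean_space \<Rightarrow> real)"
  using integral_gdens[where 'a='a] not_integrable_integral_eq by fastforce

lemma pos_density_gdens_shift: "pos_density (\<lambda>s. gdens (s + a))"
proof
  show "continuous_on UNIV (\<lambda>s::real. gdens (s + a))"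
    by (intro continuous_on_compose2[OF continuous_gdens] continuous_intros) auto
qed (use integrable_lborel_translate[OF integrable_gdens] integral_lborel_translate[of gdens a] integral_gdens in auto)

lemma pos_density_gdens: "pos_density gdens"
  using pos_density_gdens_shift[of 0] by simp

lemma pcdf_gdens_shift: "pcdf (\<lambda>s. gdens (s + a)) x = pcdf gdens (x + a)"
proof -
  have "pcdf (\<lambda>s. gdens (s + a)) x = (\<integral>s. indicator {..x + a} (s + a) * gdens (s + a) \<partial>lborel)"
    unfolding pcdf_def by (intro Bochner_Integration.integral_cong) (auto simp: indicator_def)
  also have "\<dots> = pcdf gdens (x + a)"
    unfolding pcdf_def by (rule integral_lborel_translate) simp
  finally show ?thesis .
qed

definition tilted :: "(real \<Rightarrow> real) \<Rightarrow> real \<Rightarrow> real" where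
  "tilted g s = exp (g s) * gdens s / (\<integral>u. exp (g u) \<partial>gauss)"

locale lipschitz_potential =
  fixes g g' :: "real \<Rightarrow> real" and L :: real
  assumes der: "\<And>x. (g has_real_derivative g' x) (at x)"
    and cont': "continuous_on UNIV g'" and bound: "\<And>x. \<bar>g' x\<bar> \<le> L"
begin

definition Z where "Z = (\<integral>u. exp (g u) \<partial>gauss)"

definition T where "T = transport (tilted g) gdens"

lemma L_nonneg: "0 \<le> L"
  using bound[of 0] by linarith

lemma cont: "continuous_on UNIV g"
  using der by (auto intro!: continuous_at_imp_continuous_on DERIV_isCont)

lemma meas [measurable]: "g \<in> borel_measurable borel" "g' \<in> borel_measurable borel"
  using cont cont' by (auto intro: borel_measurable_continuous_onI)

lemma lip: "\<bar>g x - g y\<bar> \<le> L * \<bar>x - y\<bar>"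
  using field_differentiable_bound[of UNIV g g' L x y] der bound by simp

lemma growth: "\<bar>g x\<bar> \<le> (\<bar>g 0\<bar> + L) * (1 + \<bar>x\<bar>)"
proof -
  have "\<bar>g x\<bar> \<le> \<bar>g 0\<bar> + L * \<bar>x\<bar>" using lip[of x 0] by simp
  also have "\<dots> \<le> (\<bar>g 0\<bar> + L) * (1 + \<bar>x\<bar>)" using L_nonneg by (simp add: algebra_simps)
  finally show ?thesis .
qed

lemma exp_growth_g: "exp_growth (\<lambda>_::real. \<lambda>s. exp (g s))"
  using growth by (intro exp_growth_exp lin_growth_compose[OF cont, of "\<bar>g 0\<bar> + L"] growth_intros) auto

lemma integrable_exp_g: "integrable gauss (\<lambda>s. exp (g s))"
  using exp_growth_integrable[OF exp_growth_g] .

lemma Z_pos: "0 < Z"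
proof -
  interpret prob_space "gauss :: real measure" by (rule prob_space_gauss)
  have "0 \<le> Z" unfolding Z_def by simp
  moreover have "Z \<noteq> 0"
    using integral_nonneg_eq_0_iff_AE[OF integrable_exp_g] by (simp add: Z_def)
  ultimately show ?thesis by simp
qed

lemma tilted_eq: "tilted g s = exp (g s) * gdens s / Z"
  by (simp add: tilted_def Z_def)

lemma pos_density_tilted: "pos_density (tilted g)"
proof
  show "continuous_on UNIV (tilted g)"
    unfolding tilted_eq[abs_def] using Z_pos by (intro continuous_intros cont continuous_gdens) auto
  show "0 < tilted g x" for x
    using Z_pos by (simp add: tilted_eq)
  have "integrable lborel (\<lambda>s. gdens s * exp (g s))"
    using integrable_exp_g by (subst (asm) integrable_gauss_iff) auto
  then show "integrable lborel (tilted g)"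
    by (simp add: tilted_eq[abs_def] mult.commute)
  have "Z = (\<integral>s. gdens s * exp (g s) \<partial>lborel)"
    unfolding Z_def by (subst integral_gauss) auto
  then show "(\<integral>s. tilted g s \<partial>lborel) = 1"
    using Z_pos by (simp add: tilted_eq[abs_def] mult.commute)
qed

lemmas T_derivative = transport_derivative[OF pos_density_tilted pos_density_gdens, folded T_def]

lemma T_cont: "continuous_on UNIV T"
  using T_derivative by (auto intro!: continuous_at_imp_continuous_on DERIV_isCont)

lemma T_meas [measurable]: "T \<in> borel_measurable borel"
  using T_cont by (rule borel_measurable_continuous_onI)

text \<open>The ratio of \<open>tilted g s\<close> to \<open>gdens (s + L)\<close> is a constant
  times \<open>exp (g s + L * s)\<close>, which increases because \<open>g\<close> is
  \<open>L\<close>-Lipschitz; likewise the ratio of \<open>gdens (s - L)\<close> to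
  \<open>tilted g s\<close>. So the tilted law lies stochastically between the Gaussians with means
  \<open>- L\<close> and \<open>L\<close>. This keeps \<open>T\<close> at bounded distance from the
  identity, which controls all terms at infinity in \<open>T_cost\<close>.\<close>

lemma T_displacement: "\<bar>T x - x\<bar> \<le> L"
proof -
  have shift: "gdens (s + a) = gdens s * (exp (- (s * a)) * exp (- a\<^sup>2 / 2))" for s a :: real
    by (simp add: gdens_add flip: exp_add)
  have "pcdf (tilted g) x \<le> pcdf (\<lambda>s. gdens (s + L)) x"
  proof (rule pcdf_le_of_increasing_ratio[OF pos_density_tilted pos_density_gdens_shift])
    fix s t :: real assume st: "s \<le> t"
    have "g s + - (t * L) \<le> g t + - (s * L)" using lip[of s t] st by (simp add: algebra_simps)
    then have "exp (g s + - (t * L)) * (gdens s * gdens t * exp (- L\<^sup>2 / 2) / Z) \<le> exp (g t + - (s * L)) * (gdens s * gdens t * exp (- L\<^sup>2 / 2) / Z)"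
      using Z_pos by (intro mult_right_mono) auto
    then show "tilted g s * gdens (t + L) \<le> tilted g t * gdens (s + L)"
      unfolding shift tilted_eq exp_add by (simp add: mult_ac)
  qed
  then have 1: "T x \<le> x + L"
    by (simp add: T_def transport_le_iff[OF pos_density_tilted pos_density_gdens] pcdf_gdens_shift)
  have "pcdf (\<lambda>s. gdens (s + (- L))) x \<le> pcdf (tilted g) x"
  proof (rule pcdf_le_of_increasing_ratio[OF pos_density_gdens_shift pos_density_tilted])
    fix s t :: real assume st: "s \<le> t"
    have "g t + s * L \<le> g s + t * L" using lip[of s t] st by (simp add: algebra_simps)
    then have "exp (g t + - (s * - L)) * (gdens s * gdens t * exp (- L\<^sup>2 / 2) / Z) \<le> exp (g s + - (t * - L)) * (gdens s * gdens t * exp (- L\<^sup>2 / 2) / Z)"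
      using Z_pos by (intro mult_right_mono) auto
    then show "gdens (s + - L) * tilted g t \<le> gdens (t + - L) * tilted g s"
      unfolding shift tilted_eq exp_add by (simp add: mult_ac)
  qed
  then have 2: "x - L \<le> T x"
    unfolding pcdf_gdens_shift by (simp add: T_def le_transport_iff[OF pos_density_tilted pos_density_gdens])
  show ?thesis using 1 2 by linarith
qed

text \<open>The weight stays unnormalised on purpose: when the potential is the restriction of a
  function to a line, the factor \<open>Z\<close> is the value of the marginal density
  there.\<close>

lemma nn_integral_T:
  assumes [measurable]: "h \<in> borel_measurable borel"
  shows "(\<integral>\<^sup>+s. h (T s) * ennreal (exp (g s)) \<partial>gauss) = ennreal Z * (\<integral>\<^sup>+s. h s \<partial>gauss)"
proof -
  have [measurable]: "tilted g \<in> borel_measurable borel"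
    unfolding tilted_eq[abs_def] by measurable
  have "(\<integral>\<^sup>+s. h s \<partial>gauss) = (\<integral>\<^sup>+s. h s \<partial>distr (density lborel (\<lambda>x. ennreal (tilted g x))) borel T)"
    using distr_transport[OF pos_density_tilted pos_density_gdens] by (simp add: T_def gauss_eq)
  also have "\<dots> = (\<integral>\<^sup>+s. ennreal (tilted g s) * h (T s) \<partial>lborel)"
    by (simp add: nn_integral_distr nn_integral_density)
  finally have "ennreal Z * (\<integral>\<^sup>+s. h s \<partial>gauss) = (\<integral>\<^sup>+s. ennreal Z * (ennreal (tilted g s) * h (T s)) \<partial>lborel)"
    by (simp add: nn_integral_cmult)
  also have "\<dots> = (\<integral>\<^sup>+s. ennreal (gdens s) * (h (T s) * ennreal (exp (g s))) \<partial>lborel)"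
  proof (rule nn_integral_cong)
    fix s
    have "ennreal Z * ennreal (tilted g s) = ennreal (gdens s) * ennreal (exp (g s))"
      using Z_pos by (simp add: tilted_eq mult.commute flip: ennreal_mult)
    then show "ennreal Z * (ennreal (tilted g s) * h (T s)) = ennreal (gdens s) * (h (T s) * ennreal (exp (g s)))"
      by (simp add: mult.assoc[symmetric]) (simp add: mult_ac)
  qed
  also have "\<dots> = (\<integral>\<^sup>+s. h (T s) * ennreal (exp (g s)) \<partial>gauss)"
    by (simp add: nn_integral_gauss)
  finally show ?thesis by simp
qed

text \<open>With \<open>p = tilted g\<close>, \<open>q = gdens (T x)\<close> and \<open>T' = p / q\<close>, the function \<open>W = (x - T x) (p - q)\<close> satisfies
  \<open>W' = (x - T) g' p - (x - T)\<^sup>2 p - (1 - T')\<^sup>2 q\<close> and vanishes at infinity.\<close>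
lemma T_cost:
  "(\<integral>\<^sup>+s. ennreal ((T s - s)\<^sup>2 * exp (g s)) \<partial>gauss) \<le> (\<integral>\<^sup>+s. ennreal ((g' s)\<^sup>2 * exp (g s)) \<partial>gauss)"
proof -
  define p where "p = tilted g"
  define q where "q x = gdens (T x)" for x
  define W where "W x = (x - T x) * (p x - q x)" for x
  define D where "D x = (x - T x) * g' x * p x - (x - T x)\<^sup>2 * p x - (1 - p x / q x)\<^sup>2 * q x" for x
  have q_pos: "q x > 0" and p_pos: "p x > 0" for x
    using Z_pos by (auto simp: q_def p_def tilted_eq)
  have p_cont: "continuous_on UNIV p"
    using pos_density.cont[OF pos_density_tilted] by (simp add: p_def)
  have q_cont: "continuous_on UNIV q"
    unfolding q_def by (intro continuous_on_compose2[OF continuous_gdens T_cont]) auto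
  have p_der: "(p has_real_derivative (g' x - x) * p x) (at x)" for x
  proof -
    have "((\<lambda>x. gdens x :: real) has_real_derivative - x * gdens x) (at x)"
      using partial_at_shift[OF gdens_line_derivative[where 'a=real and b=1], where x=0 and t=x] by simp
    then show ?thesis
      unfolding p_def tilted_eq[abs_def] using Z_pos
      by (auto intro!: derivative_eq_intros der simp: field_simps)
  qed
  have q_der: "(q has_real_derivative - T x * p x) (at x)" for x
  proof -
    have "((\<lambda>x. gdens x :: real) has_real_derivative - T x * gdens (T x)) (at (T x))"
      using partial_at_shift[OF gdens_line_derivative[where 'a=real and b=1], where x=0 and t="T x"] by simp
    moreover have "gdens (T x) \<noteq> 0" using gdens_pos[of "T x"] by linarith
    ultimately show ?thesis
      using DERIV_chain2[OF _ T_derivative, of "gdens"] by (fastforce simp: q_def[abs_def] p_def)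
  qed
  have T_der: "(T has_real_derivative p x / q x) (at x)" for x
    using T_derivative by (simp add: p_def q_def)
  have W_der: "(W has_real_derivative D x) (at x)" for x
  proof -
    have "(W has_real_derivative (1 - p x / q x) * (p x - q x) + (x - T x) * ((g' x - x) * p x + T x * p x)) (at x)"
      unfolding W_def by (rule derivative_eq_intros T_der p_der q_der refl | simp)+
    moreover have "(1 - p x / q x) * (p x - q x) + (x - T x) * ((g' x - x) * p x + T x * p x) = D x"
      using q_pos[of x] by (simp add: D_def field_simps power2_eq_square)
    ultimately show ?thesis by simp
  qed
  \<comment> \<open>Large enough for \<open>e\<close> to dominate \<open>p / gdens\<close>,
    \<open>q / gdens\<close> and \<open>p / q\<close> at once. The summand \<open>3 * L\<close> adds
    the slope \<open>L\<close> of \<open>g\<close> to the allowance \<open>2 * L\<close> in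
    \<open>u\<close>; \<open>\<bar>ln Z\<bar>\<close> covers the normalisation and
    \<open>L\<^sup>2\<close> the quadratic part of \<open>u\<close>.\<close>
  define c where "c = \<bar>g 0\<bar> + 3 * L + \<bar>ln Z\<bar> + L\<^sup>2"
  define e where "e x = exp (c * (1 + norm x))" for x :: real
  have c: "c \<ge> 0" using L_nonneg by (simp add: c_def)
  have ratio: "exp (g x) / Z * exp u \<le> e x" if u: "u \<le> 2 * (L * \<bar>x\<bar>) + L\<^sup>2" for x u
  proof -
    have "g x - ln Z + u \<le> \<bar>g 0\<bar> + L * \<bar>x\<bar> + \<bar>ln Z\<bar> + (2 * (L * \<bar>x\<bar>) + L\<^sup>2)"
      using lip[of x 0] u by simp
    also have "\<dots> \<le> c * (1 + norm x)"
      using L_nonneg by (simp add: c_def algebra_simps)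
    finally have "exp (g x - ln Z + u) \<le> e x" by (simp add: e_def)
    then show ?thesis using Z_pos by (simp add: exp_add exp_diff)
  qed
  have xd: "\<bar>x * (T x - x)\<bar> \<le> L * \<bar>x\<bar>" for x
    using mult_left_mono[OF T_displacement[of x], of "\<bar>x\<bar>"] by (simp add: abs_mult mult.commute)
  have d2: "(T x - x)\<^sup>2 \<le> L\<^sup>2" for x
    using power_mono[OF T_displacement[of x], of 2] by simp
  have q_eq: "q x = gdens x * exp (- (x * (T x - x)) - (T x - x)\<^sup>2 / 2)" for x
    using gdens_add[of x "T x - x"] by (simp add: q_def)
  have p_le: "p x \<le> e x * gdens x" for x
    using ratio[of 0 x] L_nonneg mult_right_mono[of "exp (g x) / Z" "e x" "gdens x"] by (simp add: p_def tilted_eq)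
  have q_le: "q x \<le> e x * gdens x" for x
  proof -
    have "- (x * (T x - x)) - (T x - x)\<^sup>2 / 2 \<le> L * \<bar>x\<bar>"
      using xd[of x] zero_le_power2[of "T x - x"] by linarith
    also have "\<dots> \<le> c * \<bar>x\<bar>"
      using L_nonneg by (intro mult_right_mono) (auto simp: c_def)
    also have "\<dots> \<le> c * (1 + norm x)" using c by (simp add: distrib_left)
    finally show ?thesis unfolding q_eq e_def by (simp add: mult.commute)
  qed
  have pq_le: "p x / q x \<le> e x" for x
  proof -
    have "q x = gdens x / exp (x * (T x - x) + (T x - x)\<^sup>2 / 2)"
      unfolding q_eq by (simp only: divide_inverse exp_minus[symmetric] minus_add_distrib diff_conv_add_uminus)
    then have "p x / q x = exp (g x) / Z * exp (x * (T x - x) + (T x - x)\<^sup>2 / 2)"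
      using gdens_pos[of x] by (simp add: p_def tilted_eq less_imp_neq[THEN not_sym])
    also have "\<dots> \<le> e x"
    proof (rule ratio)
      have "0 \<le> L * \<bar>x\<bar>" "0 \<le> L\<^sup>2" using L_nonneg by auto
      then show "x * (T x - x) + (T x - x)\<^sup>2 / 2 \<le> 2 * (L * \<bar>x\<bar>) + L\<^sup>2"
        using abs_le_D1[OF xd[of x]] d2[of x] by linarith
    qed
    finally show ?thesis .
  qed
  \<comment> \<open>Collects the prefactors of \<open>gdens\<close> in the bounds for
    \<open>W\<close> and \<open>D\<close>, so that one constant \<open>C\<close> serves both. The
    square of \<open>e\<close> comes from the term \<open>p\<^sup>2 / q\<close>.\<close>
  define K where "K x = 2 * L\<^sup>2 * e x + e x + e x ^ 2 + 2 * L * e x" for x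
  have "exp_growth (\<lambda>_::real. K)"
    unfolding K_def e_def by (intro growth_intros lin_growth_norm lin_growth_bounded_linear[OF _ bounded_linear_mult_right])
  then obtain C where "C \<ge> 0" and C: "\<And>t x. norm (t::real) \<le> 0 \<Longrightarrow> \<bar>K x\<bar> \<le> exp (C * (1 + norm x))"
    using exp_growthE[where R=0] by blast
  have K: "K x * gdens x \<le> exp (C * (1 + norm x)) * gdens x" for x
    using C[of 0 x] by (intro mult_right_mono) auto
  have e_pos: "e x > 0" for x by (simp add: e_def)
  have W_bd: "\<bar>W x\<bar> \<le> exp (C * (1 + norm x)) * gdens x" for x
  proof -
    have pq: "\<bar>p x - q x\<bar> \<le> e x * gdens x + e x * gdens x"
      using p_le[of x] q_le[of x] p_pos[of x] q_pos[of x] by linarith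
    have "\<bar>W x\<bar> = \<bar>T x - x\<bar> * \<bar>p x - q x\<bar>" by (simp add: W_def abs_mult abs_minus_commute)
    also have "\<dots> \<le> L * (e x * gdens x + e x * gdens x)"
      by (rule mult_mono[OF T_displacement pq L_nonneg abs_ge_zero])
    also have "\<dots> = (2 * L * e x) * gdens x" by simp
    also have "\<dots> \<le> K x * gdens x"
      using e_pos[of x] by (intro mult_right_mono) (auto simp: K_def)
    also note K
    finally show ?thesis .
  qed
  have ie: "integrable lborel (\<lambda>x. h x * p x)" if [measurable]: "h \<in> borel_measurable borel" and h: "\<And>x. \<bar>h x\<bar> \<le> B" for h B
  proof (rule Bochner_Integration.integrable_bound)
    show "integrable lborel (\<lambda>x. B * p x)"
      using pos_density.integrable[OF pos_density_tilted] by (simp add: p_def)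
    have [measurable]: "p \<in> borel_measurable borel"
      using p_cont by (rule borel_measurable_continuous_onI)
    show "(\<lambda>x. h x * p x) \<in> borel_measurable lborel" by simp
    show "AE x in lborel. norm (h x * p x) \<le> norm (B * p x)"
      using p_pos h by (intro AE_I2) (auto simp: abs_mult less_imp_le intro!: mult_right_mono order_trans[OF h abs_ge_self])
  qed
  have D_bd: "\<bar>D x\<bar> \<le> exp (C * (1 + norm x)) * gdens x" for x
  proof -
    have 1: "\<bar>(x - T x) * g' x * p x\<bar> \<le> L * L * (e x * gdens x)"
      unfolding abs_mult using T_displacement[of x] bound[of x] p_le[of x] p_pos[of x] L_nonneg
      by (intro mult_mono) (auto simp: abs_minus_commute)
    have 2: "\<bar>(x - T x)\<^sup>2 * p x\<bar> \<le> L\<^sup>2 * (e x * gdens x)"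
      unfolding abs_mult using d2[of x] p_le[of x] p_pos[of x]
      by (intro mult_mono) (auto simp: power2_commute)
    have 3: "\<bar>(1 - p x / q x)\<^sup>2 * q x\<bar> \<le> e x * gdens x + e x * (e x * gdens x)"
    proof -
      have "\<bar>(1 - p x / q x)\<^sup>2 * q x\<bar> = (1 - p x / q x)\<^sup>2 * q x"
        using q_pos[of x] by (simp add: abs_mult)
      also have "\<dots> = q x - 2 * p x + p x / q x * p x"
        using q_pos[of x] by (simp add: field_simps power2_eq_square)
      also have "\<dots> \<le> q x + p x / q x * p x" using p_pos[of x] by simp
      also have "\<dots> \<le> e x * gdens x + e x * (e x * gdens x)"
        using q_le[of x] pq_le[of x] p_le[of x] e_pos[of x] p_pos[of x] q_pos[of x]
        by (intro add_mono mult_mono) auto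
      finally show ?thesis .
    qed
    have "\<bar>D x\<bar> \<le> L * L * (e x * gdens x) + L\<^sup>2 * (e x * gdens x) + (e x * gdens x + e x * (e x * gdens x))"
      unfolding D_def using 1 2 3 by linarith
    also have "\<dots> = (2 * L\<^sup>2 * e x + e x + e x ^ 2) * gdens x"
      by (simp add: algebra_simps power2_eq_square)
    also have "\<dots> \<le> K x * gdens x"
      using e_pos[of x] L_nonneg by (intro mult_right_mono) (auto simp: K_def)
    also note K
    finally show ?thesis .
  qed
  have [measurable]: "p \<in> borel_measurable borel" "q \<in> borel_measurable borel"
    using p_cont q_cont by (auto intro: borel_measurable_continuous_onI)
  have W_cont: "continuous_on UNIV W"
    unfolding W_def by (intro continuous_intros T_cont p_cont q_cont)
  have D_line: "((\<lambda>t. W (x + t *\<^sub>R 1)) has_real_derivative D x) (at 0)" for x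
    using W_der[of x] DERIV_shift[of W "D x" 0 x] by (simp add: add.commute)
  have D_meas: "D \<in> borel_measurable borel" unfolding D_def by measurable
  note D0 = integral_partial_zero'[OF W_cont D_meas W_bd D_bd D_line]
  have g2: "(g' x)\<^sup>2 \<le> L\<^sup>2" for x
    using power_mono[OF bound[of x], of 2] by simp
  have i1: "integrable lborel (\<lambda>x. (T x - x)\<^sup>2 * p x)"
    by (rule ie[where B="L\<^sup>2"]) (use d2 in auto)
  have i2: "integrable lborel (\<lambda>x. (g' x)\<^sup>2 * p x)"
    by (rule ie[where B="L\<^sup>2"]) (use g2 in auto)
  \<comment> \<open>Since \<open>D\<close> integrates to zero, \<open>2 * D\<close> may be added.
    With \<open>a = x - T x\<close> and \<open>b = g' x\<close> the integrand becomes
    \<open>b\<^sup>2 * p - (a - b)\<^sup>2 * p - 2 * (1 - p / q)\<^sup>2 * q\<close>, so completing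
    the square gives the constant 1.\<close>
  have "(\<integral>x. (T x - x)\<^sup>2 * p x \<partial>lborel) = (\<integral>x. (T x - x)\<^sup>2 * p x + 2 * D x \<partial>lborel)"
    using D0 i1 by simp
  also have "\<dots> \<le> (\<integral>x. (g' x)\<^sup>2 * p x \<partial>lborel)"
  proof (rule integral_mono)
    fix x
    have "0 \<le> ((x - T x) - g' x)\<^sup>2 * p x + 2 * ((1 - p x / q x)\<^sup>2 * q x)"
      using p_pos[of x] q_pos[of x] by (intro add_nonneg_nonneg mult_nonneg_nonneg) auto
    moreover have "a\<^sup>2 * u + 2 * (a * b * u - a\<^sup>2 * u - v) \<le> b\<^sup>2 * u" if "0 \<le> (a - b)\<^sup>2 * u + 2 * v" for a b u v :: real
      using that by (simp add: power2_diff algebra_simps)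
    ultimately show "(T x - x)\<^sup>2 * p x + 2 * D x \<le> (g' x)\<^sup>2 * p x"
      unfolding D_def power2_commute[of "T x" x] by blast
  qed (use i1 i2 D0 in auto)
  finally have le: "(\<integral>x. (T x - x)\<^sup>2 * p x \<partial>lborel) \<le> (\<integral>x. (g' x)\<^sup>2 * p x \<partial>lborel)" .
  have conv: "(\<integral>\<^sup>+s. ennreal (h s * exp (g s)) \<partial>gauss) = ennreal Z * ennreal (\<integral>s. h s * p s \<partial>lborel)"
    if [measurable]: "h \<in> borel_measurable borel" and h: "\<And>s. 0 \<le> h s" and i: "integrable lborel (\<lambda>s. h s * p s)" for h
  proof -
    have "(\<integral>\<^sup>+s. ennreal (h s * exp (g s)) \<partial>gauss) = (\<integral>\<^sup>+s. ennreal Z * ennreal (h s * p s) \<partial>lborel)"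
      using Z_pos h by (subst nn_integral_gauss) (auto simp: p_def tilted_eq mult_ac simp flip: ennreal_mult intro!: nn_integral_cong)
    also have "\<dots> = ennreal Z * ennreal (\<integral>s. h s * p s \<partial>lborel)"
      using i h p_pos by (simp add: nn_integral_cmult nn_integral_eq_integral less_imp_le)
    finally show ?thesis .
  qed
  show ?thesis
    using le i1 i2 by (simp add: conv mult_left_mono ennreal_leI)
qed

end

section \<open>Transport to the Gaussian, one coordinate at a time\<close>

interpretation gauss: prob_space "gauss :: 'a::euclidean_space measure"
  by (rule prob_space_gauss)

text \<open>The growth bound would follow from the bounds on the partial derivatives, but it is easier to
  propagate it separately when a coordinate is integrated out.\<close>
definition C1_bounded :: "('a::euclidean_space \<Rightarrow> real) \<Rightarrow> ('a \<Rightarrow> 'a \<Rightarrow> real) \<Rightarrow> real \<Rightarrow> bool" where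
  "C1_bounded g G L \<longleftrightarrow> continuous_on UNIV g \<and> (\<exists>C. \<forall>x. \<bar>g x\<bar> \<le> C * (1 + norm x)) \<and>
     (\<forall>c\<in>Basis. continuous_on UNIV (G c) \<and> (\<forall>x. \<bar>G c x\<bar> \<le> L) \<and>
        (\<forall>x. ((\<lambda>t. g (x + t *\<^sub>R c)) has_real_derivative G c x) (at 0)))"

text \<open>The parameter is the coordinate along \<open>b\<close> itself, not a displacement from
  \<open>x\<close>; therefore all points of one line induce the same parametrisation.\<close>

definition on_line :: "'a::euclidean_space \<Rightarrow> 'a \<Rightarrow> real \<Rightarrow> 'a" where
  "on_line b x s = x + (s - x \<bullet> b) *\<^sub>R b"

lemma on_line_inner: "b \<in> Basis \<Longrightarrow> on_line b x s \<bullet> b = s"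
  by (simp add: on_line_def inner_add_left)

lemma on_line_inner_other: "b \<in> Basis \<Longrightarrow> c \<in> Basis \<Longrightarrow> c \<noteq> b \<Longrightarrow> on_line b x s \<bullet> c = x \<bullet> c"
  by (simp add: on_line_def inner_add_left inner_not_same_Basis)

lemma on_line_on_line: "b \<in> Basis \<Longrightarrow> on_line b (on_line b x s) = on_line b x"
  by (rule ext) (simp add: on_line_def inner_add_left algebra_simps)

lemma on_line_shift: "b \<in> Basis \<Longrightarrow> c \<in> Basis \<Longrightarrow> c \<noteq> b \<Longrightarrow> on_line b (x + t *\<^sub>R c) s = on_line b x s + t *\<^sub>R c"
  by (simp add: on_line_def inner_add_left inner_not_same_Basis)

lemma on_line_shift_same: "b \<in> Basis \<Longrightarrow> on_line b (x + t *\<^sub>R b) s = on_line b x s"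
  by (simp add: on_line_def inner_add_left algebra_simps)

lemma on_line_add: "on_line b x (s + t) = on_line b x s + t *\<^sub>R b"
  by (simp add: on_line_def algebra_simps)

lemma lin_growth_on_line: "lin_growth (\<lambda>x s. on_line b x s)"
  unfolding on_line_def by (intro growth_intros)

lemma on_line_measurable [measurable (raw)]:
  assumes [measurable]: "X \<in> borel_measurable N" "S \<in> borel_measurable N"
  shows "(\<lambda>w. on_line b (X w) (S w)) \<in> borel_measurable N"
  unfolding on_line_def by measurable

text \<open>Resampling one coordinate preserves the Gaussian. This plays the role of a product
  decomposition into a line and its orthogonal complement, and lets every statement on the line be
  integrated over the whole space.\<close>

lemma gauss_on_line:
  fixes h :: "'a::euclidean_space \<Rightarrow> ennreal"
  assumes "b \<in> Basis" "h \<in> borel_measurable borel"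
  shows "(\<integral>\<^sup>+x. \<integral>\<^sup>+s. h (on_line b x s) \<partial>gauss \<partial>gauss) = (\<integral>\<^sup>+x. h x \<partial>gauss)"
  unfolding on_line_def using gauss_disintegrate[OF assms] .

text \<open>The log density, relative to the Gaussian, of the law in which the coordinate along
  \<open>b\<close> has been integrated out and replaced by an independent standard normal. It
  remains a function on the whole space, constant in direction \<open>b\<close>, so the dimension
  never changes during the induction.\<close>

definition marginal :: "'a::euclidean_space \<Rightarrow> ('a \<Rightarrow> real) \<Rightarrow> 'a \<Rightarrow> real" where
  "marginal b g x = ln (\<integral>s. exp (g (on_line b x s)) \<partial>gauss)"

text \<open>Differentiating the logarithm of an integral yields the conditional mean of
  \<open>G c\<close> given the coordinates other than the one along \<open>b\<close>.\<close>

definition marginal_partial :: "'a::euclidean_space \<Rightarrow> ('a \<Rightarrow> real) \<Rightarrow> ('a \<Rightarrow> 'a \<Rightarrow> real) \<Rightarrow> 'a \<Rightarrow> 'a \<Rightarrow> real" where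
  "marginal_partial b g G c x = (if c = b then 0 else
     (\<integral>s. G c (on_line b x s) * exp (g (on_line b x s)) \<partial>gauss) / (\<integral>s. exp (g (on_line b x s)) \<partial>gauss))"

definition coord_map :: "'a::euclidean_space \<Rightarrow> ('a \<Rightarrow> real) \<Rightarrow> 'a \<Rightarrow> 'a" where
  "coord_map b g x = on_line b x (transport (tilted (\<lambda>s. g (on_line b x s))) gdens (x \<bullet> b))"

section \<open>Integrating out and transporting a single coordinate\<close>

locale C1_potential =
  fixes g :: "'a::euclidean_space \<Rightarrow> real" and G :: "'a \<Rightarrow> 'a \<Rightarrow> real" and L :: real
  assumes C1: "C1_bounded g G L"
begin

lemma cont: "continuous_on UNIV g"
  using C1 by (simp add: C1_bounded_def)

lemma contG: "c \<in> Basis \<Longrightarrow> continuous_on UNIV (G c)"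
  using C1 by (simp add: C1_bounded_def)

lemma boundG: "c \<in> Basis \<Longrightarrow> \<bar>G c x\<bar> \<le> L"
  using C1 by (simp add: C1_bounded_def)

lemma der: "c \<in> Basis \<Longrightarrow> ((\<lambda>t. g (x + t *\<^sub>R c)) has_real_derivative G c x) (at 0)"
  using C1 by (simp add: C1_bounded_def)

lemma growthE:
  obtains C where "0 \<le> C" "\<And>x. norm (g x) \<le> C * (1 + norm x)"
proof -
  obtain C where C: "\<And>x. \<bar>g x\<bar> \<le> C * (1 + norm x)"
    using C1 by (auto simp: C1_bounded_def)
  have "0 \<le> C" using order_trans[OF abs_ge_zero C[of 0]] by simp
  then show thesis using C that by auto
qed

lemma lin_growth_g: "lin_growth A \<Longrightarrow> lin_growth (\<lambda>x z. g (A x z))"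
  by (rule growthE) (rule lin_growth_compose[OF cont])

lemma exp_growth_G: "c \<in> Basis \<Longrightarrow> lin_growth A \<Longrightarrow> exp_growth (\<lambda>x z. G c (A x z))"
  by (rule exp_growth_bounded_compose[OF contG boundG])

lemma exp_growth_line: "exp_growth (\<lambda>x s. exp (g (on_line b x s)))"
  by (intro exp_growth_exp lin_growth_g lin_growth_on_line)

lemma exp_growth_line_G: "c \<in> Basis \<Longrightarrow> exp_growth (\<lambda>x s. G c (on_line b x s) * exp (g (on_line b x s)))"
  by (intro exp_growth_mult exp_growth_line exp_growth_G lin_growth_on_line)

lemma meas [measurable]: "g \<in> borel_measurable borel"
  using cont by (rule borel_measurable_continuous_onI)

lemma measG [measurable]: "c \<in> Basis \<Longrightarrow> G c \<in> borel_measurable borel"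
  using contG by (rule borel_measurable_continuous_onI)

context
  fixes b :: 'a assumes b: "b \<in> Basis"
begin

lemma line_potential: "lipschitz_potential (\<lambda>s. g (on_line b x s)) (\<lambda>s. G b (on_line b x s)) L"
proof
  have cl: "continuous_on UNIV (on_line b x)"
    unfolding on_line_def by (intro continuous_intros)
  show "((\<lambda>s. g (on_line b x s)) has_real_derivative G b (on_line b x s)) (at s)" for s
  proof -
    have "((\<lambda>t. g (on_line b x s + t *\<^sub>R b)) has_real_derivative G b (on_line b x s)) (at 0)"
      by (rule der[OF b])
    then show ?thesis
      using DERIV_shift[of "\<lambda>s. g (on_line b x s)" _ 0 s] by (simp add: on_line_add add.commute[of _ s])
  qed
  show "continuous_on UNIV (\<lambda>s. G b (on_line b x s))"
    by (rule continuous_on_compose2[OF contG[OF b] cl]) auto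
  show "\<bar>G b (on_line b x s)\<bar> \<le> L" for s by (rule boundG[OF b])
qed

lemma line_mass_pos: "0 < (\<integral>s. exp (g (on_line b x s)) \<partial>gauss)"
  using lipschitz_potential.Z_pos[OF line_potential] by (simp add: lipschitz_potential.Z_def[OF line_potential])

lemma exp_marginal: "exp (marginal b g x) = (\<integral>s. exp (g (on_line b x s)) \<partial>gauss)"
  unfolding marginal_def by (rule exp_ln[OF line_mass_pos])

lemma marginal_on_line: "marginal b g (on_line b x s) = marginal b g x"
  by (simp add: marginal_def on_line_on_line[OF b])

lemma marginal_cont: "continuous_on UNIV (marginal b g)"
  unfolding marginal_def using exp_growth_integral_continuous[OF exp_growth_line] line_mass_pos
  by (intro continuous_on_ln) (auto simp: less_imp_neq[THEN not_sym])

lemma marginal_meas [measurable]: "marginal b g \<in> borel_measurable borel"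
  using marginal_cont by (rule borel_measurable_continuous_onI)

lemma marginal_shift_same: "marginal b g (x + t *\<^sub>R b) = marginal b g x"
  by (simp add: marginal_def on_line_shift_same[OF b])

lemma marginal_shift_other:
  assumes "c \<in> Basis" "\<And>x t. g (x + t *\<^sub>R c) = g x"
  shows "marginal b g (x + t *\<^sub>R c) = marginal b g x"
  using assms b by (cases "c = b") (auto simp: marginal_def on_line_shift_same on_line_shift)

text \<open>A partial derivative of the marginal is a weighted average of values of
  \<open>G c\<close>, hence obeys the same bound \<open>L\<close>. With this the class of potentials
  is stable under the induction over coordinates.\<close>

lemma C1_bounded_marginal: "C1_bounded (marginal b g) (marginal_partial b g G) L"
  unfolding C1_bounded_def
proof (intro conjI ballI allI)
  have L: "0 \<le> L" using boundG[OF b, of 0] by linarith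
  show "continuous_on UNIV (marginal b g)" by (rule marginal_cont)
  show "\<exists>C. \<forall>x. \<bar>marginal b g x\<bar> \<le> C * (1 + norm x)"
  proof -
    obtain C where C: "0 \<le> C" "\<And>x. norm (g x) \<le> C * (1 + norm x)"
      using growthE by blast
    \<comment> \<open>On a line \<open>\<bar>g\<bar>\<close> is at most
      \<open>C * (1 + 2 * norm x) + C * norm s\<close>. The line integral therefore lies between
      multiples of \<open>I (- C)\<close> and \<open>I C\<close>, and its logarithm grows at most
      linearly in \<open>norm x\<close>.\<close>
    define I where "I c = (\<integral>s. exp (c * norm (s::real)) \<partial>gauss)" for c
    have I_pos: "0 < I c" for c
    proof -
      have "0 \<le> I c" unfolding I_def by simp
      moreover have "I c \<noteq> 0"
        using integral_nonneg_eq_0_iff_AE[OF integrable_gauss_exp_norm[of c, where 'a=real]] by (simp add: I_def)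
      ultimately show ?thesis by simp
    qed
    have on: "norm (on_line b x s) \<le> 2 * norm x + norm s" for x s
    proof -
      have "norm (on_line b x s) \<le> norm x + \<bar>s - x \<bullet> b\<bar>"
        unfolding on_line_def using b by (intro norm_triangle_le) simp
      moreover have "\<bar>x \<bullet> b\<bar> \<le> norm x" using b by (rule Basis_le_norm)
      ultimately show ?thesis by simp
    qed
    have gb: "\<bar>g (on_line b x s)\<bar> \<le> C * (1 + 2 * norm x) + C * norm s" for x s
    proof -
      have "\<bar>g (on_line b x s)\<bar> \<le> C * (1 + norm (on_line b x s))" using C(2) by simp
      also have "\<dots> \<le> C * (1 + (2 * norm x + norm s))"
        using on C(1) by (intro mult_left_mono add_left_mono) auto
      finally show ?thesis by (simp add: algebra_simps)
    qed
    have up: "marginal b g x \<le> C * (1 + 2 * norm x) + ln (I C)" for x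
    proof -
      have "(\<integral>s. exp (g (on_line b x s)) \<partial>gauss) \<le> (\<integral>s. exp (C * (1 + 2 * norm x)) * exp (C * norm (s::real)) \<partial>gauss)"
      proof (intro integral_mono)
        fix s
        have "g (on_line b x s) \<le> C * (1 + 2 * norm x) + C * norm s" using gb[of x s] by simp
        then show "exp (g (on_line b x s)) \<le> exp (C * (1 + 2 * norm x)) * exp (C * norm s)"
          by (simp flip: exp_add)
      qed (use exp_growth_integrable[OF exp_growth_line] integrable_gauss_exp_norm[where 'a=real] in auto)
      also have "\<dots> = exp (C * (1 + 2 * norm x)) * I C" by (simp add: I_def)
      also have "\<dots> = exp (C * (1 + 2 * norm x) + ln (I C))" using I_pos by (simp add: exp_add)
      finally show ?thesis by (simp flip: exp_marginal)
    qed
    have low: "- (C * (1 + 2 * norm x)) + ln (I (-C)) \<le> marginal b g x" for x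
    proof -
      have "exp (- (C * (1 + 2 * norm x)) + ln (I (-C))) = exp (- (C * (1 + 2 * norm x))) * I (-C)" unfolding exp_add using I_pos by simp
      also have "\<dots> = (\<integral>s. exp (- (C * (1 + 2 * norm x))) * exp ((-C) * norm (s::real)) \<partial>gauss)" unfolding I_def by simp
      also have "\<dots> \<le> (\<integral>s. exp (g (on_line b x s)) \<partial>gauss)"
      proof (intro integral_mono)
        fix s
        have "- (C * (1 + 2 * norm x)) + (-C) * norm s \<le> g (on_line b x s)" using gb[of x s] by simp
        then show "exp (- (C * (1 + 2 * norm x))) * exp ((-C) * norm s) \<le> exp (g (on_line b x s))"
          by (simp flip: exp_add)
      qed (use exp_growth_integrable[OF exp_growth_line] integrable_gauss_exp_norm[of "-C", where 'a=real] in auto)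
      finally show ?thesis by (simp flip: exp_marginal)
    qed
    define D where "D = 2 * C + \<bar>ln (I C)\<bar> + \<bar>ln (I (-C))\<bar>"
    have "\<bar>marginal b g x\<bar> \<le> D * (1 + norm x)" for x
    proof -
      have "\<bar>marginal b g x\<bar> \<le> C * (1 + 2 * norm x) + \<bar>ln (I C)\<bar> + \<bar>ln (I (-C))\<bar>"
        using up[of x] low[of x] by linarith
      also have "\<dots> \<le> D * (1 + norm x)"
        using C(1) by (simp add: D_def algebra_simps)
      finally show ?thesis .
    qed
    then show ?thesis by blast
  qed
  fix c :: 'a assume c: "c \<in> Basis"
  show "continuous_on UNIV (marginal_partial b g G c)"
  proof (cases "c = b")
    case False
    then show ?thesis unfolding marginal_partial_def
      using exp_growth_integral_continuous[OF exp_growth_line] exp_growth_integral_continuous[OF exp_growth_line_G[OF c]] line_mass_pos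
      by (auto intro!: continuous_on_divide simp: less_imp_neq[THEN not_sym])
  qed (simp add: marginal_partial_def)
  show "\<bar>marginal_partial b g G c x\<bar> \<le> L" for x
  proof (cases "c = b")
    case False
    have "\<bar>\<integral>s. G c (on_line b x s) * exp (g (on_line b x s)) \<partial>gauss\<bar> \<le> (\<integral>s. L * exp (g (on_line b x s)) \<partial>gauss)"
      using exp_growth_integrable[OF exp_growth_line] exp_growth_integrable[OF exp_growth_line_G[OF c]] boundG[OF c]
      by (intro integral_abs_bound[THEN order_trans] integral_mono integrable_abs) (auto simp: abs_mult)
    then show ?thesis using False line_mass_pos[of x] by (simp add: marginal_partial_def divide_le_eq)
  qed (simp add: marginal_partial_def L)
  show "((\<lambda>t. marginal b g (x + t *\<^sub>R c)) has_real_derivative marginal_partial b g G c x) (at 0)" for x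
  proof (cases "c = b")
    case True
    then show ?thesis by (simp add: marginal_partial_def marginal_shift_same)
  next
    case False
    have cx: "continuous_on UNIV (\<lambda>t::real. x + t *\<^sub>R c)" by (intro continuous_intros)
    have "((\<lambda>t. \<integral>s. exp (g (on_line b (x + t *\<^sub>R c) s)) \<partial>gauss) has_real_derivative
        (\<integral>s. G c (on_line b (x + 0 *\<^sub>R c) s) * exp (g (on_line b (x + 0 *\<^sub>R c) s)) \<partial>gauss)) (at 0)"
    proof (rule exp_growth_has_derivative[OF exp_growth_reparam[OF exp_growth_line cx] exp_growth_reparam[OF exp_growth_line_G[OF c] cx]])
      fix t s
      have "((\<lambda>t. g (on_line b x s + t *\<^sub>R c)) has_real_derivative G c (on_line b x s + t *\<^sub>R c)) (at t)"
        using der[OF c] by (rule partial_at_shift)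
      then show "((\<lambda>t. exp (g (on_line b (x + t *\<^sub>R c) s))) has_real_derivative
          G c (on_line b (x + t *\<^sub>R c) s) * exp (g (on_line b (x + t *\<^sub>R c) s))) (at t)"
        unfolding on_line_shift[OF b c False] by (auto intro!: derivative_eq_intros)
    qed
    then show ?thesis
      unfolding marginal_def marginal_partial_def using line_mass_pos[of x] False
      by (auto intro!: derivative_eq_intros)
  qed
qed

lemma coord_map_on_line:
  "coord_map b g (on_line b x s) = on_line b x (transport (tilted (\<lambda>s. g (on_line b x s))) gdens s)"
  by (simp add: coord_map_def on_line_on_line[OF b] on_line_inner[OF b])

lemma coord_map_inner_other: "c \<in> Basis \<Longrightarrow> c \<noteq> b \<Longrightarrow> coord_map b g x \<bullet> c = x \<bullet> c"
  by (simp add: coord_map_def on_line_inner_other[OF b])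

text \<open>Sublevel sets of the transported coordinate are described by inequalities between
  distribution functions, thanks to \<open>transport_le_iff\<close>; these functions are parameter
  integrals of a jointly measurable integrand and hence measurable in \<open>x\<close>.\<close>

lemma coord_map_meas [measurable]: "coord_map b g \<in> borel_measurable borel"
proof -
  have "(\<lambda>x. transport (tilted (\<lambda>s. g (on_line b x s))) gdens (x \<bullet> b)) \<in> borel_measurable borel"
    unfolding borel_measurable_iff_le
  proof
    fix a
    have le: "transport (tilted (\<lambda>s. g (on_line b x s))) gdens (x \<bullet> b) \<le> a \<longleftrightarrow>
       pcdf (tilted (\<lambda>s. g (on_line b x s))) (x \<bullet> b) \<le> pcdf gdens a" for x
      by (rule transport_le_iff[OF lipschitz_potential.pos_density_tilted[OF line_potential] pos_density_gdens])
    have [measurable]: "(\<lambda>x. pcdf (tilted (\<lambda>s. g (on_line b x s))) (x \<bullet> b)) \<in> borel_measurable borel"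
    proof -
      have [measurable]: "(\<lambda>x. \<integral>u. exp (g (on_line b x u)) \<partial>gauss) \<in> borel_measurable borel"
        using exp_growth_integral_continuous[OF exp_growth_line] by (rule borel_measurable_continuous_onI)
      have "pcdf (tilted (\<lambda>s. g (on_line b x s))) (x \<bullet> b) = (\<integral>s. (if s \<le> x \<bullet> b then tilted (\<lambda>s. g (on_line b x s)) s else 0) \<partial>lborel)" for x
        unfolding pcdf_def by (intro Bochner_Integration.integral_cong) auto
      then show ?thesis unfolding tilted_def by simp
    qed
    show "{w \<in> space borel. transport (tilted (\<lambda>s. g (on_line b w s))) gdens (w \<bullet> b) \<le> a} \<in> sets borel"
      unfolding le by measurable
  qed
  then show ?thesis unfolding coord_map_def[abs_def] by measurable
qed

text \<open>On each line the rearrangement carries the weight \<open>exp g\<close> to the Gaussian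
  times the mass of the line, and that mass is \<open>exp (marginal b g x)\<close>. So one move
  replaces the log density \<open>g\<close> by its marginal.\<close>

lemma nn_integral_coord_map:
  assumes [measurable]: "h \<in> borel_measurable borel"
  shows "(\<integral>\<^sup>+x. h (coord_map b g x) * ennreal (exp (g x)) \<partial>gauss) = (\<integral>\<^sup>+x. h x * ennreal (exp (marginal b g x)) \<partial>gauss)"
proof -
  have "(\<integral>\<^sup>+x. h (coord_map b g x) * ennreal (exp (g x)) \<partial>gauss) =
     (\<integral>\<^sup>+x. \<integral>\<^sup>+s. h (coord_map b g (on_line b x s)) * ennreal (exp (g (on_line b x s))) \<partial>gauss \<partial>gauss)"
    by (rule gauss_on_line[OF b, symmetric]) simp
  also have "\<dots> = (\<integral>\<^sup>+x. \<integral>\<^sup>+s. h (on_line b x s) * ennreal (exp (marginal b g (on_line b x s))) \<partial>gauss \<partial>gauss)"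
  proof (rule nn_integral_cong)
    fix x
    interpret l: lipschitz_potential "\<lambda>s. g (on_line b x s)" "\<lambda>s. G b (on_line b x s)" L by (rule line_potential)
    have "(\<integral>\<^sup>+s. h (coord_map b g (on_line b x s)) * ennreal (exp (g (on_line b x s))) \<partial>gauss) =
       (\<integral>\<^sup>+s. h (on_line b x (l.T s)) * ennreal (exp (g (on_line b x s))) \<partial>gauss)"
      by (simp add: coord_map_on_line l.T_def)
    also have "\<dots> = ennreal l.Z * (\<integral>\<^sup>+s. h (on_line b x s) \<partial>gauss)"
      by (rule l.nn_integral_T) simp
    also have "\<dots> = (\<integral>\<^sup>+s. h (on_line b x s) * ennreal (exp (marginal b g (on_line b x s))) \<partial>gauss)"
      unfolding marginal_on_line by (simp add: nn_integral_multc mult.commute exp_marginal l.Z_def)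
    finally show "(\<integral>\<^sup>+s. h (coord_map b g (on_line b x s)) * ennreal (exp (g (on_line b x s))) \<partial>gauss) =
       (\<integral>\<^sup>+s. h (on_line b x s) * ennreal (exp (marginal b g (on_line b x s))) \<partial>gauss)" .
  qed
  also have "\<dots> = (\<integral>\<^sup>+x. h x * ennreal (exp (marginal b g x)) \<partial>gauss)"
    by (rule gauss_on_line[OF b]) simp
  finally show ?thesis .
qed

lemma coord_map_cost:
  "(\<integral>\<^sup>+x. ennreal ((coord_map b g x \<bullet> b - x \<bullet> b)\<^sup>2 * exp (g x)) \<partial>gauss) \<le> (\<integral>\<^sup>+x. ennreal ((G b x)\<^sup>2 * exp (g x)) \<partial>gauss)"
proof -
  have [measurable]: "G b \<in> borel_measurable borel" by (rule measG[OF b])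
  have "(\<integral>\<^sup>+x. ennreal ((coord_map b g x \<bullet> b - x \<bullet> b)\<^sup>2 * exp (g x)) \<partial>gauss) =
     (\<integral>\<^sup>+x. \<integral>\<^sup>+s. ennreal ((coord_map b g (on_line b x s) \<bullet> b - on_line b x s \<bullet> b)\<^sup>2 * exp (g (on_line b x s))) \<partial>gauss \<partial>gauss)"
    by (rule gauss_on_line[OF b, symmetric]) simp
  also have "\<dots> \<le> (\<integral>\<^sup>+x. \<integral>\<^sup>+s. ennreal ((G b (on_line b x s))\<^sup>2 * exp (g (on_line b x s))) \<partial>gauss \<partial>gauss)"
  proof (rule nn_integral_mono)
    fix x
    interpret l: lipschitz_potential "\<lambda>s. g (on_line b x s)" "\<lambda>s. G b (on_line b x s)" L by (rule line_potential)
    show "(\<integral>\<^sup>+s. ennreal ((coord_map b g (on_line b x s) \<bullet> b - on_line b x s \<bullet> b)\<^sup>2 * exp (g (on_line b x s))) \<partial>gauss)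
       \<le> (\<integral>\<^sup>+s. ennreal ((G b (on_line b x s))\<^sup>2 * exp (g (on_line b x s))) \<partial>gauss)"
      using l.T_cost by (simp add: coord_map_on_line on_line_inner[OF b] l.T_def)
  qed
  also have "\<dots> = (\<integral>\<^sup>+x. ennreal ((G b x)\<^sup>2 * exp (g x)) \<partial>gauss)"
    by (rule gauss_on_line[OF b]) simp
  finally show ?thesis .
qed

text \<open>Conditional Jensen inequality: with \<open>m\<close> the conditional mean of
  \<open>G c\<close> on a line, expanding the weighted integral of the nonnegative square of
  \<open>G c - m\<close> gives the claim there. Thus the Fisher information of the remaining
  coordinates does not grow when \<open>b\<close> is integrated out.\<close>

lemma marginal_partial_cost:
  assumes c: "c \<in> Basis" "c \<noteq> b"
  shows "(\<integral>\<^sup>+x. ennreal ((marginal_partial b g G c x)\<^sup>2 * exp (marginal b g x)) \<partial>gauss) \<le> (\<integral>\<^sup>+x. ennreal ((G c x)\<^sup>2 * exp (g x)) \<partial>gauss)"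
proof -
  have [measurable]: "G c \<in> borel_measurable borel" by (rule measG[OF c(1)])
  have "(\<integral>\<^sup>+x. ennreal ((marginal_partial b g G c x)\<^sup>2 * exp (marginal b g x)) \<partial>gauss) \<le>
     (\<integral>\<^sup>+x. \<integral>\<^sup>+s. ennreal ((G c (on_line b x s))\<^sup>2 * exp (g (on_line b x s))) \<partial>gauss \<partial>gauss)"
  proof (rule nn_integral_mono)
    fix x
    define m where "m = marginal_partial b g G c x"
    let ?e = "\<lambda>s. exp (g (on_line b x s))" and ?G = "\<lambda>s. G c (on_line b x s)"
    have i: "integrable gauss ?e" "integrable gauss (\<lambda>s. ?G s * ?e s)"
      using exp_growth_integrable[OF exp_growth_line] exp_growth_integrable[OF exp_growth_line_G[OF c(1)]] by auto
    have "exp_growth (\<lambda>x s. (G c (on_line b x s))\<^sup>2 * exp (g (on_line b x s)))"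
      using c by (intro exp_growth_mult exp_growth_power exp_growth_line exp_growth_G lin_growth_on_line)
    from exp_growth_integrable[OF this] have i2: "integrable gauss (\<lambda>s. (?G s)\<^sup>2 * ?e s)" .
    have m: "(\<integral>s. ?G s * ?e s \<partial>gauss) = m * exp (marginal b g x)"
      unfolding exp_marginal m_def marginal_partial_def using c line_mass_pos[of x] by simp
    have "0 \<le> (\<integral>s. (?G s - m)\<^sup>2 * ?e s \<partial>gauss)" by simp
    also have "\<dots> = (\<integral>s. (?G s)\<^sup>2 * ?e s - 2 * m * (?G s * ?e s) + m\<^sup>2 * ?e s \<partial>gauss)"
      by (intro Bochner_Integration.integral_cong) (auto simp: power2_diff algebra_simps)
    also have "\<dots> = (\<integral>s. (?G s)\<^sup>2 * ?e s \<partial>gauss) - 2 * m * (m * exp (marginal b g x)) + m\<^sup>2 * exp (marginal b g x)"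
      using i i2 by (simp add: m exp_marginal)
    finally have "m\<^sup>2 * exp (marginal b g x) \<le> (\<integral>s. (?G s)\<^sup>2 * ?e s \<partial>gauss)"
      by (simp add: power2_eq_square)
    then show "ennreal ((marginal_partial b g G c x)\<^sup>2 * exp (marginal b g x)) \<le> (\<integral>\<^sup>+s. ennreal ((?G s)\<^sup>2 * ?e s) \<partial>gauss)"
      using i2 by (simp add: nn_integral_eq_integral m_def ennreal_leI)
  qed
  also have "\<dots> = (\<integral>\<^sup>+x. ennreal ((G c x)\<^sup>2 * exp (g x)) \<partial>gauss)"
    by (rule gauss_on_line[OF b]) simp
  finally show ?thesis .
qed

end

end

lemma constant_of_invariant:
  fixes g :: "'a::euclidean_space \<Rightarrow> real"
  assumes inv: "\<And>c x t. c \<in> Basis \<Longrightarrow> g (x + t *\<^sub>R c) = g x"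
  shows "g x = g 0"
proof -
  have "g (\<Sum>c\<in>A. (x \<bullet> c) *\<^sub>R c) = g 0" if "finite A" "A \<subseteq> Basis" for A
    using that
  proof (induction A)
    case (insert c A)
    then have "g ((\<Sum>c\<in>A. (x \<bullet> c) *\<^sub>R c) + (x \<bullet> c) *\<^sub>R c) = g 0"
      by (subst inv) auto
    then show ?case using insert by (simp add: add.commute)
  qed simp
  from this[of Basis] show ?thesis by (simp add: euclidean_representation)
qed

text \<open>Induction over the set \<open>A\<close> of coordinates on which \<open>g\<close> may
  depend. For a further coordinate \<open>b\<close> the map \<open>coord_map b g\<close> leads from
  \<open>g\<close> to its marginal, which is constant along \<open>b\<close>, and the map supplied
  for the marginal is composed after it. That the latter fixes all coordinates outside
  \<open>A\<close> is part of the claim because the orthogonality of successive moves depends on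
  it.\<close>

lemma gaussian_transport_partial:
  fixes g :: "'a::euclidean_space \<Rightarrow> real"
  assumes "finite A" "A \<subseteq> Basis" "C1_bounded g G L"
    and "\<And>c x t. c \<in> Basis - A \<Longrightarrow> g (x + t *\<^sub>R c) = g x"
    and "(\<integral>\<^sup>+x. ennreal (exp (g x)) \<partial>gauss) = 1"
  shows "\<exists>S \<in> borel_measurable borel. (\<forall>x. \<forall>c\<in>Basis - A. S x \<bullet> c = x \<bullet> c) \<and>
     (\<forall>h\<in>borel_measurable borel. (\<integral>\<^sup>+x. h (S x) * ennreal (exp (g x)) \<partial>gauss) = (\<integral>\<^sup>+x. h x \<partial>gauss)) \<and>
     (\<integral>\<^sup>+x. ennreal ((norm (S x - x))\<^sup>2 * exp (g x)) \<partial>gauss) \<le> (\<Sum>c\<in>A. \<integral>\<^sup>+x. ennreal ((G c x)\<^sup>2 * exp (g x)) \<partial>gauss)"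
  using assms
proof (induction A arbitrary: g G)
  case empty
  have g: "g x = g 0" for x
    using empty.prems(3) by (intro constant_of_invariant) auto
  have "(\<integral>\<^sup>+x. ennreal (exp (g 0)) \<partial>(gauss::'a measure)) = 1"
    using empty.prems(4) g by (metis (no_types, lifting) nn_integral_cong)
  \<comment> \<open>A constant log density of total mass one is zero, so the identity transports the
    measure at no cost.\<close>
  then have "g 0 = 0" by (simp add: gauss.emeasure_space_1[simplified])
  then have g0: "g x = 0" for x using g by simp
  show ?case
    by (rule bexI[of _ "\<lambda>x. x"]) (auto simp: g0)
next
  case (insert b A)
  interpret C1_potential g G L by (rule C1_potential.intro) (rule insert.prems)
  have b: "b \<in> Basis" using insert.prems by auto
  let ?m = "marginal b g" and ?G = "marginal_partial b g G"
  have [measurable]: "?m \<in> borel_measurable borel" by (rule marginal_meas[OF b])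
  have [measurable]: "coord_map b g \<in> borel_measurable borel" by (rule coord_map_meas[OF b])
  have "\<exists>S \<in> borel_measurable borel. (\<forall>x. \<forall>c\<in>Basis - A. S x \<bullet> c = x \<bullet> c) \<and>
     (\<forall>h\<in>borel_measurable borel. (\<integral>\<^sup>+x. h (S x) * ennreal (exp (?m x)) \<partial>gauss) = (\<integral>\<^sup>+x. h x \<partial>gauss)) \<and>
     (\<integral>\<^sup>+x. ennreal ((norm (S x - x))\<^sup>2 * exp (?m x)) \<partial>gauss) \<le> (\<Sum>c\<in>A. \<integral>\<^sup>+x. ennreal ((?G c x)\<^sup>2 * exp (?m x)) \<partial>gauss)"
  proof (rule insert.IH)
    show "A \<subseteq> Basis" using insert.prems by auto
    show "C1_bounded ?m ?G L" by (rule C1_bounded_marginal[OF b])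
    show "?m (x + t *\<^sub>R c) = ?m x" if "c \<in> Basis - A" for c x t
    proof (cases "c = b")
      case True then show ?thesis using marginal_shift_same[OF b] by simp
    next
      case False then show ?thesis
        using that insert.prems(3) by (intro marginal_shift_other[OF b]) auto
    qed
    show "(\<integral>\<^sup>+x. ennreal (exp (?m x)) \<partial>gauss) = 1"
      using nn_integral_coord_map[OF b, of "\<lambda>_. 1"] insert.prems(4) by simp
  qed
  then obtain S where [measurable]: "S \<in> borel_measurable borel"
    and S1: "\<And>x c. c\<in>Basis - A \<Longrightarrow> S x \<bullet> c = x \<bullet> c"
    and S2: "\<And>h. h\<in>borel_measurable borel \<Longrightarrow> (\<integral>\<^sup>+x. h (S x) * ennreal (exp (?m x)) \<partial>gauss) = (\<integral>\<^sup>+x. h x \<partial>gauss)"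
    and S3: "(\<integral>\<^sup>+x. ennreal ((norm (S x - x))\<^sup>2 * exp (?m x)) \<partial>gauss) \<le> (\<Sum>c\<in>A. \<integral>\<^sup>+x. ennreal ((?G c x)\<^sup>2 * exp (?m x)) \<partial>gauss)"
    by blast
  show ?case
  proof (intro bexI[of _ "\<lambda>x. S (coord_map b g x)"] conjI allI ballI)
    show "S (coord_map b g x) \<bullet> c = x \<bullet> c" if "c \<in> Basis - insert b A" for x c
      using that S1 coord_map_inner_other[OF b] by auto
    show "(\<integral>\<^sup>+x. h (S (coord_map b g x)) * ennreal (exp (g x)) \<partial>gauss) = (\<integral>\<^sup>+x. h x \<partial>gauss)"
      if [measurable]: "h \<in> borel_measurable borel" for h
      using nn_integral_coord_map[OF b, of "\<lambda>x. h (S x)"] S2[of h] by simp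
    \<comment> \<open>The first move is parallel to \<open>b\<close>, and \<open>S\<close> leaves
      the coordinate along \<open>b\<close> unchanged; Pythagoras adds the squared lengths without a
      cross term.\<close>
    have split: "(norm (S (coord_map b g x) - x))\<^sup>2 =
       (norm (S (coord_map b g x) - coord_map b g x))\<^sup>2 + (coord_map b g x \<bullet> b - x \<bullet> b)\<^sup>2" for x
    proof -
      define y where "y = coord_map b g x"
      have yx: "y - x = (y \<bullet> b - x \<bullet> b) *\<^sub>R b"
        by (rule euclidean_eqI) (use b coord_map_inner_other[OF b, of _ x] in \<open>auto simp: y_def inner_diff_left inner_Basis\<close>)
      have "(S y - y) \<bullet> b = 0"
        using S1[of b y] b insert.hyps by (simp add: inner_diff_left)
      then have "orthogonal (S y - y) (y - x)"
        by (subst yx) (simp add: orthogonal_def)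
      then have "(norm ((S y - y) + (y - x)))\<^sup>2 = (norm (S y - y))\<^sup>2 + (norm (y - x))\<^sup>2"
        by (rule norm_add_Pythagorean)
      then show ?thesis using b yx by (simp add: y_def)
    qed
    have "(\<integral>\<^sup>+x. ennreal ((norm (S (coord_map b g x) - x))\<^sup>2 * exp (g x)) \<partial>gauss) =
       (\<integral>\<^sup>+x. ennreal ((norm (S (coord_map b g x) - coord_map b g x))\<^sup>2) * ennreal (exp (g x))
            + ennreal ((coord_map b g x \<bullet> b - x \<bullet> b)\<^sup>2 * exp (g x)) \<partial>gauss)"
      by (simp add: split distrib_right flip: ennreal_mult ennreal_plus)
    also have "\<dots> = (\<integral>\<^sup>+x. ennreal ((norm (S (coord_map b g x) - coord_map b g x))\<^sup>2) * ennreal (exp (g x)) \<partial>gauss)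
            + (\<integral>\<^sup>+x. ennreal ((coord_map b g x \<bullet> b - x \<bullet> b)\<^sup>2 * exp (g x)) \<partial>gauss)"
      by (rule nn_integral_add) auto
    also have "(\<integral>\<^sup>+x. ennreal ((norm (S (coord_map b g x) - coord_map b g x))\<^sup>2) * ennreal (exp (g x)) \<partial>gauss) =
        (\<integral>\<^sup>+x. ennreal ((norm (S x - x))\<^sup>2 * exp (?m x)) \<partial>gauss)"
      using nn_integral_coord_map[OF b, of "\<lambda>x. ennreal ((norm (S x - x))\<^sup>2)"] by (simp flip: ennreal_mult)
    also have "\<dots> \<le> (\<Sum>c\<in>A. \<integral>\<^sup>+x. ennreal ((G c x)\<^sup>2 * exp (g x)) \<partial>gauss)"
      using insert.hyps insert.prems(1)
      by (intro order_trans[OF S3] sum_mono marginal_partial_cost[OF b]) auto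
    also note coord_map_cost[OF b]
    finally show "(\<integral>\<^sup>+x. ennreal ((norm (S (coord_map b g x) - x))\<^sup>2 * exp (g x)) \<partial>gauss) \<le>
        (\<Sum>c\<in>insert b A. \<integral>\<^sup>+x. ennreal ((G c x)\<^sup>2 * exp (g x)) \<partial>gauss)"
      using insert.hyps by (simp add: add.commute)
  qed measurable
qed

theorem gaussian_transport:
  fixes g :: "'a::euclidean_space \<Rightarrow> real"
  assumes "C1_bounded g G L" "(\<integral>\<^sup>+x. ennreal (exp (g x)) \<partial>gauss) = 1"
  obtains S where "S \<in> borel_measurable borel"
     "\<And>h. h\<in>borel_measurable borel \<Longrightarrow> (\<integral>\<^sup>+x. h (S x) * ennreal (exp (g x)) \<partial>gauss) = (\<integral>\<^sup>+x. h x \<partial>gauss)"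
     "(\<integral>\<^sup>+x. ennreal ((norm (S x - x))\<^sup>2 * exp (g x)) \<partial>gauss) \<le> (\<Sum>c\<in>Basis. \<integral>\<^sup>+x. ennreal ((G c x)\<^sup>2 * exp (g x)) \<partial>gauss)"
  using gaussian_transport_partial[of Basis, OF _ _ assms(1) _ assms(2)] by auto

section \<open>Heat flow of a function with bounded gradient\<close>

lemma lin_growth_scaleR_left: "lin_growth T \<Longrightarrow> lin_growth (\<lambda>x z. r *\<^sub>R T x z)"
  by (rule lin_growth_scaleR_param) auto

lemma has_derivative_grad:
  assumes "f differentiable (at x)"
  shows "(f has_derivative (\<lambda>h. grad f x \<bullet> h)) (at x)"
proof -
  have D: "(f has_derivative frechet_derivative f (at x)) (at x)"
    using assms by (simp add: frechet_derivative_works)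
  then interpret bounded_linear "frechet_derivative f (at x)" by (rule has_derivative_bounded_linear)
  have "frechet_derivative f (at x) = (\<lambda>h. grad f x \<bullet> h)"
  proof
    fix h
    have "frechet_derivative f (at x) h = frechet_derivative f (at x) (\<Sum>b\<in>Basis. (h \<bullet> b) *\<^sub>R b)"
      by (simp add: euclidean_representation)
    also have "\<dots> = grad f x \<bullet> h"
      by (simp add: sum scaleR grad_def inner_sum_left inner_commute[of h] mult.commute)
    finally show "frechet_derivative f (at x) h = grad f x \<bullet> h" .
  qed
  then show ?thesis using D by simp
qed

text \<open>If \<open>l\<close> were negative, \<open>k'\<close> would be negative immediately to
  the right of its zero at 0 and \<open>k\<close> would fall below its minimum. Differentiability of
  \<open>k'\<close> is used at the single point 0, so a second derivative without any continuity
  qualifies.\<close>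

lemma second_derivative_nonneg_at_min:
  fixes k k' :: "real \<Rightarrow> real"
  assumes k: "\<And>s. (k has_real_derivative k' s) (at s)" and k': "(k' has_real_derivative l) (at 0)"
    and min: "\<And>s. k 0 \<le> k s"
  shows "0 \<le> l"
proof (rule ccontr)
  assume "\<not> 0 \<le> l"
  then obtain d where d: "d > 0" "\<And>h. 0 < h \<Longrightarrow> h < d \<Longrightarrow> k' h < k' 0"
    using DERIV_neg_dec_right[OF k'] by auto
  have k0: "k' 0 = 0"
    using DERIV_local_min[OF k[of 0], of 1] min by auto
  have "k (d / 2) < k 0"
  proof (rule DERIV_neg_imp_decreasing_open[of 0 "d / 2" k])
    show "continuous_on {0..d / 2} k"
      using k by (auto intro!: continuous_at_imp_continuous_on DERIV_isCont)
  qed (use d k k0 in force)+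
  then show False using min[of "d / 2"] by simp
qed

locale bounded_gradient =
  fixes f :: "'a::euclidean_space \<Rightarrow> real" and L :: real
  assumes twice: "twice_differentiable f" and grad_bound: "\<And>x. norm (grad f x) \<le> L"
begin

abbreviation df :: "'a \<Rightarrow> 'a \<Rightarrow> real" where "df b x \<equiv> grad f x \<bullet> b"

lemma grad_derivative: "(f has_derivative (\<lambda>h. grad f x \<bullet> h)) (at x)"
  using twice by (intro has_derivative_grad) (simp add: twice_differentiable_def)

lemma grad_cont: "continuous_on UNIV (grad f)"
  using twice by (auto simp: twice_differentiable_def intro!: continuous_at_imp_continuous_on differentiable_imp_continuous_within)

lemma f_cont: "continuous_on UNIV f"
  using twice by (auto simp: twice_differentiable_def intro!: continuous_at_imp_continuous_on differentiable_imp_continuous_within)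

lemma L_nonneg: "0 \<le> L"
  using order_trans[OF norm_ge_zero grad_bound[of 0]] .

lemma lipschitz: "\<bar>f x - f y\<bar> \<le> L * norm (x - y)"
proof -
  have "norm (f x - f y) \<le> L * norm (x - y)"
  proof (rule differentiable_bound[of UNIV])
    show "onorm (\<lambda>h. grad f z \<bullet> h) \<le> L" for z
      by (rule onorm_le) (use order_trans[OF Cauchy_Schwarz_ineq2 mult_right_mono[OF grad_bound]] in auto)
  qed (auto intro: grad_derivative has_derivative_at_withinI)
  then show ?thesis by simp
qed

lemma line_derivative: "((\<lambda>t. f (x + t *\<^sub>R v)) has_real_derivative (grad f (x + t *\<^sub>R v) \<bullet> v)) (at t)"
proof -
  have "((\<lambda>t. x + t *\<^sub>R v) has_derivative (\<lambda>h. h *\<^sub>R v)) (at t)"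
    by (auto intro!: derivative_eq_intros)
  from has_derivative_compose[OF this grad_derivative]
  show ?thesis by (simp add: has_field_derivative_def mult.commute[of _ "grad f (x + t *\<^sub>R v) \<bullet> v"])
qed

lemma grad_line_derivative:
  "((\<lambda>t. df b (x + t *\<^sub>R b)) has_real_derivative (frechet_derivative (grad f) (at x) b \<bullet> b)) (at 0)"
proof -
  have g: "(grad f has_derivative frechet_derivative (grad f) (at x)) (at x)"
    using twice by (simp add: twice_differentiable_def frechet_derivative_works)
  then interpret bounded_linear "frechet_derivative (grad f) (at x)" by (rule has_derivative_bounded_linear)
  have "((\<lambda>t. x + t *\<^sub>R b) has_derivative (\<lambda>h. h *\<^sub>R b)) (at (0::real))"
    by (auto intro!: derivative_eq_intros)
  from has_derivative_compose[OF this, of "grad f" "frechet_derivative (grad f) (at x)"] g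
  have "((\<lambda>t. grad f (x + t *\<^sub>R b)) has_derivative (\<lambda>h. frechet_derivative (grad f) (at x) (h *\<^sub>R b))) (at (0::real))"
    by simp
  from has_derivative_inner_left[OF this, of b]
  show ?thesis by (simp add: has_field_derivative_def scaleR mult.commute[of _ "frechet_derivative (grad f) (at x) b \<bullet> b"])
qed

lemma df_bound: "b \<in> Basis \<Longrightarrow> \<bar>df b x\<bar> \<le> L"
  using Basis_le_norm[of b "grad f x"] grad_bound[of x] by (simp add: order_trans)

lemma f_growth: "\<bar>f x\<bar> \<le> (\<bar>f 0\<bar> + L) * (1 + norm x)"
proof -
  have "\<bar>f x\<bar> \<le> \<bar>f 0\<bar> + L * norm x" using lipschitz[of x 0] by simp
  also have "\<dots> \<le> (\<bar>f 0\<bar> + L) * (1 + norm x)" using L_nonneg by (simp add: algebra_simps)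
  finally show ?thesis .
qed

lemma C1_bounded_f: "C1_bounded f df L"
  unfolding C1_bounded_def
  using f_cont f_growth df_bound line_derivative[where t=0] by (auto intro!: continuous_intros grad_cont)

sublocale C1_potential f df L
  by (rule C1_potential.intro) (rule C1_bounded_f)

text \<open>The parameter \<open>\<tau>\<close> is a standard deviation: heat time is
  \<open>\<tau>\<^sup>2 / 2\<close>, and the heat equation says that the
  \<open>\<tau>\<close>-derivative is \<open>\<tau>\<close> times the Laplacian. This explains the
  terms \<open>c * \<tau>\<^sup>2 / 2\<close> below.\<close>

definition heat :: "real \<Rightarrow> 'a \<Rightarrow> real" where "heat \<tau> x = (\<integral>z. f (x + \<tau> *\<^sub>R z) \<partial>gauss)"
definition heat_partial :: "'a \<Rightarrow> real \<Rightarrow> 'a \<Rightarrow> real" where "heat_partial b \<tau> x = (\<integral>z. df b (x + \<tau> *\<^sub>R z) \<partial>gauss)"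
text \<open>The link between time and space: summed over the basis this is the
  \<open>\<tau>\<close>-derivative of \<open>heat\<close>, and divided by \<open>\<tau>\<close> it
  is the second derivative of \<open>heat\<close> along \<open>b\<close>.\<close>

definition heat_moment :: "'a \<Rightarrow> real \<Rightarrow> 'a \<Rightarrow> real" where "heat_moment b \<tau> x = (\<integral>z. df b (x + \<tau> *\<^sub>R z) * (z \<bullet> b) \<partial>gauss)"

lemma growth_arg: "lin_growth (\<lambda>p z. snd p + fst p *\<^sub>R z)"
  by (intro lin_growth_add lin_growth_param lin_growth_scaleR_param lin_growth_snd continuous_intros)

lemma heat_cont: "continuous_on UNIV (\<lambda>p. heat (fst p) (snd p))"
  unfolding heat_def by (rule exp_growth_integral_continuous) (intro exp_growth_lin lin_growth_g growth_arg)

lemma heat_partial_cont: "b \<in> Basis \<Longrightarrow> continuous_on UNIV (\<lambda>p. heat_partial b (fst p) (snd p))"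
  unfolding heat_partial_def by (rule exp_growth_integral_continuous) (intro exp_growth_G growth_arg)

lemma heat_moment_cont: "b \<in> Basis \<Longrightarrow> continuous_on UNIV (\<lambda>p. heat_moment b (fst p) (snd p))"
  unfolding heat_moment_def by (rule exp_growth_integral_continuous)
    (intro exp_growth_mult exp_growth_G growth_arg exp_growth_lin growth_intros)

lemma heat_0: "heat 0 x = f x"
  by (simp add: heat_def gauss.prob_space[simplified])

lemma heat_partial_0: "heat_partial b 0 x = df b x"
  by (simp add: heat_partial_def gauss.prob_space[simplified])

lemma int_f: "integrable gauss (\<lambda>z. f (x + \<tau> *\<^sub>R z))"
  using exp_growth_integrable[OF exp_growth_lin[OF lin_growth_g[OF growth_arg]], of "(\<tau>, x)"] by simp

lemma int_df: "b \<in> Basis \<Longrightarrow> integrable gauss (\<lambda>z. df b (x + \<tau> *\<^sub>R z))"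
  using exp_growth_integrable[OF exp_growth_G[OF _ growth_arg], of b "(\<tau>, x)"] by simp

lemma int_norm: "integrable gauss (\<lambda>z::'a. norm z)"
  using exp_growth_integrable[OF exp_growth_lin[OF lin_growth_norm[OF lin_growth_snd]]] .

lemma int_moment: "b \<in> Basis \<Longrightarrow> integrable gauss (\<lambda>z. df b (x + \<tau> *\<^sub>R z) * (z \<bullet> b))"
proof -
  assume b: "b \<in> Basis"
  have "exp_growth (\<lambda>p z. df b (snd p + fst p *\<^sub>R z) * (z \<bullet> b))"
    using b by (intro exp_growth_mult exp_growth_G growth_arg exp_growth_lin growth_intros)
  from exp_growth_integrable[OF this, of "(\<tau>, x)"] show ?thesis by simp
qed

lemma heat_close: "\<bar>heat \<tau> x - f x\<bar> \<le> L * \<bar>\<tau>\<bar> * (\<integral>z. norm (z::'a) \<partial>gauss)"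
proof -
  have "heat \<tau> x - f x = (\<integral>z. f (x + \<tau> *\<^sub>R z) - f x \<partial>gauss)"
    using int_f by (simp add: heat_def gauss.prob_space[simplified])
  also have "\<bar>\<dots>\<bar> \<le> (\<integral>z. \<bar>f (x + \<tau> *\<^sub>R z) - f x\<bar> \<partial>gauss)"
    by (rule integral_abs_bound)
  also have "\<dots> \<le> (\<integral>z. L * \<bar>\<tau>\<bar> * norm (z::'a) \<partial>gauss)"
  proof (intro integral_mono)
    show "\<bar>f (x + \<tau> *\<^sub>R z) - f x\<bar> \<le> L * \<bar>\<tau>\<bar> * norm z" for z
      using lipschitz[of "x + \<tau> *\<^sub>R z" x] by (simp add: mult.assoc)
  qed (use int_f int_norm in auto)
  finally show ?thesis by simp
qed

lemma heat_moment_bound: "b \<in> Basis \<Longrightarrow> \<bar>heat_moment b \<tau> x\<bar> \<le> L * (\<integral>z. norm (z::'a) \<partial>gauss)"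
proof -
  assume b: "b \<in> Basis"
  have "\<bar>heat_moment b \<tau> x\<bar> \<le> (\<integral>z. \<bar>df b (x + \<tau> *\<^sub>R z) * (z \<bullet> b)\<bar> \<partial>gauss)"
    unfolding heat_moment_def by (rule integral_abs_bound)
  also have "\<dots> \<le> (\<integral>z. L * norm (z::'a) \<partial>gauss)"
    using int_moment[OF b] int_norm L_nonneg df_bound[OF b] Basis_le_norm[OF b]
    by (intro integral_mono integrable_abs) (auto simp: abs_mult intro!: mult_mono)
  finally show ?thesis by simp
qed

lemma heat_partial_bound: "b \<in> Basis \<Longrightarrow> \<bar>heat_partial b \<tau> x\<bar> \<le> L"
proof -
  assume b: "b \<in> Basis"
  have "\<bar>heat_partial b \<tau> x\<bar> \<le> (\<integral>z. \<bar>df b (x + \<tau> *\<^sub>R z)\<bar> \<partial>gauss)"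
    unfolding heat_partial_def by (rule integral_abs_bound)
  also have "\<dots> \<le> (\<integral>z. L \<partial>(gauss::'a measure))"
    using int_df[OF b] df_bound[OF b] by (intro integral_mono integrable_abs) auto
  finally show ?thesis by (simp add: gauss.prob_space[simplified])
qed

lemma heat_time_derivative:
  "((\<lambda>\<tau>. heat \<tau> x) has_real_derivative (\<Sum>b\<in>Basis. heat_moment b \<tau> x)) (at \<tau>)"
proof -
  have arg: "lin_growth (\<lambda>\<tau>::real. \<lambda>z. x + \<tau> *\<^sub>R z)"
    by (intro growth_intros lin_growth_scaleR_param continuous_intros)
  have "((\<lambda>\<tau>. heat \<tau> x) has_real_derivative (\<integral>z. (\<Sum>b\<in>Basis. df b (x + \<tau> *\<^sub>R z) * (z \<bullet> b)) \<partial>gauss)) (at \<tau>)"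
    unfolding heat_def
  proof (rule exp_growth_has_derivative)
    show "exp_growth (\<lambda>\<tau> z. f (x + \<tau> *\<^sub>R z))"
      by (intro exp_growth_lin lin_growth_g arg)
    show "exp_growth (\<lambda>\<tau> z. \<Sum>b\<in>Basis. df b (x + \<tau> *\<^sub>R z) * (z \<bullet> b))"
      by (intro exp_growth_sum exp_growth_mult exp_growth_G arg exp_growth_lin growth_intros)
    show "((\<lambda>\<tau>. f (x + \<tau> *\<^sub>R z)) has_real_derivative (\<Sum>b\<in>Basis. df b (x + \<tau> *\<^sub>R z) * (z \<bullet> b))) (at \<tau>)" for \<tau> z
      using line_derivative[of x z \<tau>] euclidean_inner[of "grad f (x + \<tau> *\<^sub>R z)" z] by simp
  qed
  then show ?thesis
    using int_moment by (simp add: heat_moment_def Bochner_Integration.integral_sum)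
qed

lemma heat_partial_derivative:
  assumes b: "b \<in> Basis"
  shows "((\<lambda>s. heat \<tau> (x + s *\<^sub>R b)) has_real_derivative heat_partial b \<tau> (x + s *\<^sub>R b)) (at s)"
proof -
  have arg: "lin_growth (\<lambda>s::real. \<lambda>z. (x + s *\<^sub>R b) + \<tau> *\<^sub>R z)"
    by (intro growth_intros lin_growth_scaleR_left)
  show ?thesis
    unfolding heat_def heat_partial_def
  proof (rule exp_growth_has_derivative)
    show "exp_growth (\<lambda>s z. f (x + s *\<^sub>R b + \<tau> *\<^sub>R z))"
      by (intro exp_growth_lin lin_growth_g arg)
    show "exp_growth (\<lambda>s z. df b (x + s *\<^sub>R b + \<tau> *\<^sub>R z))"
      by (intro exp_growth_G b arg)
    show "((\<lambda>s. f (x + s *\<^sub>R b + \<tau> *\<^sub>R z)) has_real_derivative df b (x + s *\<^sub>R b + \<tau> *\<^sub>R z)) (at s)" for s z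
      using line_derivative[of "x + \<tau> *\<^sub>R z" b s] by (simp add: add_ac)
  qed
qed

text \<open>The increment \<open>s b\<close> is moved onto the Gaussian density by a translation, since \<open>df b\<close> itself
  has no dominated derivative.\<close>
lemma heat_second_derivative:
  assumes b: "b \<in> Basis" and \<tau>: "\<tau> \<noteq> 0"
  shows "((\<lambda>s. heat_partial b \<tau> (x + s *\<^sub>R b)) has_real_derivative heat_moment b \<tau> x / \<tau>) (at 0)"
proof -
  have [measurable]: "df b \<in> borel_measurable borel" by (rule measG[OF b])
  have arg: "lin_growth (\<lambda>s::real. \<lambda>z. x + \<tau> *\<^sub>R z)"
    by (intro growth_intros lin_growth_scaleR_left)
  let ?e = "\<lambda>s z. exp (s *\<^sub>R (z \<bullet> ((1 / \<tau>) *\<^sub>R b)) - s\<^sup>2 / (2 * \<tau>\<^sup>2))"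
  have e: "exp_growth ?e"
    by (intro exp_growth_exp lin_growth_diff lin_growth_scaleR_param lin_growth_param growth_intros continuous_intros) (use \<tau> in auto)
  have shift: "heat_partial b \<tau> (x + s *\<^sub>R b) = (\<integral>z. df b (x + \<tau> *\<^sub>R z) * ?e s z \<partial>gauss)" for s
  proof -
    have "heat_partial b \<tau> (x + s *\<^sub>R b) = (\<integral>z. df b (x + s *\<^sub>R b + \<tau> *\<^sub>R (z + (- s / \<tau>) *\<^sub>R b)) *
       exp (- (z \<bullet> ((- s / \<tau>) *\<^sub>R b)) - (norm ((- s / \<tau>) *\<^sub>R b))\<^sup>2 / 2) \<partial>gauss)"
      unfolding heat_partial_def by (rule integral_gauss_translate) simp
    also have "\<dots> = (\<integral>z. df b (x + \<tau> *\<^sub>R z) * ?e s z \<partial>gauss)"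
      using b \<tau> by (intro Bochner_Integration.integral_cong refl)
        (simp add: scaleR_add_right power_divide power2_eq_square field_simps)
    finally show ?thesis .
  qed
  have "((\<lambda>s. \<integral>z. df b (x + \<tau> *\<^sub>R z) * ?e s z \<partial>gauss) has_real_derivative
      (\<integral>z. df b (x + \<tau> *\<^sub>R z) * (?e 0 z * (z \<bullet> ((1 / \<tau>) *\<^sub>R b) - 0 / \<tau>\<^sup>2)) \<partial>gauss)) (at 0)"
  proof (rule exp_growth_has_derivative)
    show "exp_growth (\<lambda>s z. df b (x + \<tau> *\<^sub>R z) * ?e s z)"
      by (intro exp_growth_mult exp_growth_G b arg e)
    show "exp_growth (\<lambda>s z. df b (x + \<tau> *\<^sub>R z) * (?e s z * (z \<bullet> ((1 / \<tau>) *\<^sub>R b) - s / \<tau>\<^sup>2)))"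
      by (intro exp_growth_mult exp_growth_G b arg e exp_growth_lin lin_growth_diff lin_growth_param growth_intros continuous_intros)
        (use \<tau> in auto)
    show "((\<lambda>s. df b (x + \<tau> *\<^sub>R z) * ?e s z) has_real_derivative df b (x + \<tau> *\<^sub>R z) * (?e s z * (z \<bullet> ((1 / \<tau>) *\<^sub>R b) - s / \<tau>\<^sup>2))) (at s)" for s z
      using \<tau> by (auto intro!: derivative_eq_intros simp: field_simps)
  qed
  moreover have "(\<integral>z. df b (x + \<tau> *\<^sub>R z) * (?e 0 z * (z \<bullet> ((1 / \<tau>) *\<^sub>R b) - 0 / \<tau>\<^sup>2)) \<partial>gauss) = heat_moment b \<tau> x / \<tau>"
  proof -
    have "df b (x + \<tau> *\<^sub>R z) * (?e 0 z * (z \<bullet> ((1 / \<tau>) *\<^sub>R b) - 0 / \<tau>\<^sup>2)) = df b (x + \<tau> *\<^sub>R z) * (z \<bullet> b) / \<tau>" for z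
      by simp
    then show ?thesis unfolding heat_moment_def by simp
  qed
  ultimately show ?thesis unfolding shift using \<tau> by simp
qed

text \<open>Parabolic maximum principle: \<open>heat\<close> and \<open>f\<close> are compared at a minimum point, where only pointwise
  second derivatives of \<open>f\<close> (which need not be integrable) enter.\<close>
lemma heat_lower_bound:
  assumes lap: "\<And>x. c \<le> laplacian f x" and T: "0 < T"
  shows "f y + c * T\<^sup>2 / 2 \<le> heat T y"
proof (rule ccontr)
  assume less: "\<not> ?thesis"
  define \<delta> where "\<delta> = f y + c * T\<^sup>2 / 2 - heat T y"
  have \<delta>: "0 < \<delta>" using less by (simp add: \<delta>_def)
  \<comment> \<open>Small enough that \<open>D T y\<close> equals \<open>- \<delta> / 2\<close> and
    is still negative, while the term \<open>\<epsilon> * \<tau>\<^sup>2\<close> makes the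
    differential inequality strict. The quadratic term with \<open>\<eta>\<close> confines the
    minimum to a ball; \<open>\<eta>\<close> is scaled so that its Laplacian is exactly
    \<open>\<epsilon>\<close>.\<close>
  define \<epsilon> where "\<epsilon> = \<delta> / (2 * T\<^sup>2)"
  have \<epsilon>: "0 < \<epsilon>" using \<delta> T by (simp add: \<epsilon>_def)
  define \<eta> where "\<eta> = \<epsilon> / (2 * DIM('a))"
  have \<eta>: "0 < \<eta>" using \<epsilon> by (simp add: \<eta>_def)
  define D where "D \<tau> x = heat \<tau> x - f x - c * \<tau>\<^sup>2 / 2 + \<epsilon> * \<tau>\<^sup>2 + \<eta> * (norm (x - y))\<^sup>2" for \<tau> x
  define m where "m = (\<integral>z. norm (z::'a) \<partial>gauss)"
  define B where "B = L * T * m + \<bar>c\<bar> * T\<^sup>2 / 2 + 1"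
  have m: "0 \<le> m" by (simp add: m_def)
  have B: "0 < B" using L_nonneg T m by (simp add: B_def add_nonneg_pos)
  \<comment> \<open>Beyond distance \<open>R\<close> from \<open>y\<close> the quadratic term
    outweighs the lower bound \<open>- B\<close> for the rest, so \<open>D\<close> is nonnegative
    there and its negative minimum over the cylinder is a minimum over all of space.\<close>
  define R where "R = sqrt (B / \<eta>)"
  have R: "0 \<le> R" "\<eta> * R\<^sup>2 = B" using B \<eta> by (auto simp: R_def)
  have Dlow: "\<eta> * (norm (x - y))\<^sup>2 - B \<le> D \<tau> x" if "0 \<le> \<tau>" "\<tau> \<le> T" for \<tau> x
  proof -
    have "\<bar>heat \<tau> x - f x\<bar> \<le> L * T * m"
      using heat_close[of \<tau> x] that L_nonneg m
      by (intro order_trans[OF heat_close]) (auto simp: m_def intro!: mult_right_mono mult_left_mono)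
    moreover have "c * \<tau>\<^sup>2 \<le> \<bar>c\<bar> * T\<^sup>2"
      using that by (intro mult_mono power_mono) auto
    moreover have "0 \<le> \<epsilon> * \<tau>\<^sup>2" using \<epsilon> by simp
    ultimately show ?thesis unfolding D_def B_def by linarith
  qed
  have DTy: "D T y < 0" using T \<delta> by (simp add: D_def \<epsilon>_def) (simp add: \<delta>_def field_simps)
  let ?K = "{0..T} \<times> cball y R"
  have Dcont: "continuous_on ?K (\<lambda>p. D (fst p) (snd p))"
    unfolding D_def by (intro continuous_intros continuous_on_subset[OF heat_cont] continuous_on_compose2[OF f_cont]) auto
  have "compact ?K" by (intro compact_Times) auto
  moreover have "?K \<noteq> {}" using T R by auto
  ultimately obtain p where p: "p \<in> ?K" "\<And>q. q \<in> ?K \<Longrightarrow> D (fst p) (snd p) \<le> D (fst q) (snd q)"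
    using continuous_attains_inf[OF _ _ Dcont] by blast
  define \<tau> where "\<tau> = fst p"
  define x where "x = snd p"
  have \<tau>0: "0 \<le> \<tau>" "\<tau> \<le> T" using p(1) by (auto simp: \<tau>_def)
  have "D \<tau> x \<le> D T y" using p(2)[of "(T, y)"] T R by (simp add: \<tau>_def x_def)
  then have neg: "D \<tau> x < 0" using DTy by simp
  have min: "D \<tau> x \<le> D s z" if "0 \<le> s" "s \<le> T" for s z
  proof (cases "z \<in> cball y R")
    case True
    then show ?thesis using p(2)[of "(s, z)"] that by (simp add: \<tau>_def x_def)
  next
    case False
    then have "R\<^sup>2 \<le> (norm (z - y))\<^sup>2"
      using R by (intro power_mono) (auto simp: dist_norm norm_minus_commute)
    then have "B \<le> \<eta> * (norm (z - y))\<^sup>2"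
      using \<eta> R(2) by (metis less_imp_le mult_left_mono)
    then show ?thesis using Dlow[OF that, of z] neg by linarith
  qed
  have \<tau>: "0 < \<tau>"
  proof (rule ccontr)
    assume "\<not> 0 < \<tau>"
    then have "\<tau> = 0" using \<tau>0 by simp
    then have "0 \<le> D \<tau> x" using \<eta> by (simp add: D_def heat_0)
    then show False using neg by simp
  qed
  let ?S = "\<Sum>b\<in>Basis. heat_moment b \<tau> x"
  \<comment> \<open>The minimum may occur at the final time \<open>T\<close>, so it is compared with
    earlier times only; that fixes the sign of the time derivative but not its vanishing.\<close>
  have time: "?S - c * \<tau> + 2 * \<epsilon> * \<tau> \<le> 0"
  proof (rule ccontr)
    assume pos: "\<not> ?thesis"
    have "((\<lambda>s. D s x) has_real_derivative (?S - c * \<tau> + 2 * \<epsilon> * \<tau>)) (at \<tau>)"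
      unfolding D_def by (rule derivative_eq_intros heat_time_derivative refl | simp)+
    then obtain d where d: "d > 0" "\<And>h. 0 < h \<Longrightarrow> h < d \<Longrightarrow> D (\<tau> - h) x < D \<tau> x"
      using DERIV_pos_inc_left[of "\<lambda>s. D s x"] pos by (metis not_le)
    have "D (\<tau> - min (d / 2) \<tau>) x < D \<tau> x" using d(1) \<tau> by (intro d(2)) auto
    moreover have "D \<tau> x \<le> D (\<tau> - min (d / 2) \<tau>) x" using d(1) \<tau> \<tau>0 by (intro min) auto
    ultimately show False by simp
  qed
  have space: "0 \<le> heat_moment b \<tau> x / \<tau> - frechet_derivative (grad f) (at x) b \<bullet> b + 2 * \<eta>" if b: "b \<in> Basis" for b
  proof (rule second_derivative_nonneg_at_min[where k="\<lambda>s. D \<tau> (x + s *\<^sub>R b)"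
        and k'="\<lambda>s. heat_partial b \<tau> (x + s *\<^sub>R b) - df b (x + s *\<^sub>R b) + \<eta> * (2 * ((x - y) \<bullet> b) + 2 * s)"])
    have n2: "(norm (x + s *\<^sub>R b - y))\<^sup>2 = (norm (x - y))\<^sup>2 + 2 * s * ((x - y) \<bullet> b) + s\<^sup>2" for s
      unfolding power2_norm_eq_inner using b by (simp add: inner_commute algebra_simps power2_eq_square)
    show "((\<lambda>s. D \<tau> (x + s *\<^sub>R b)) has_real_derivative heat_partial b \<tau> (x + s *\<^sub>R b) - df b (x + s *\<^sub>R b) + \<eta> * (2 * ((x - y) \<bullet> b) + 2 * s)) (at s)" for s
      unfolding D_def n2 by (rule derivative_eq_intros heat_partial_derivative[OF b] line_derivative refl | simp)+
    show "((\<lambda>s. heat_partial b \<tau> (x + s *\<^sub>R b) - df b (x + s *\<^sub>R b) + \<eta> * (2 * ((x - y) \<bullet> b) + 2 * s)) has_real_derivative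
       heat_moment b \<tau> x / \<tau> - frechet_derivative (grad f) (at x) b \<bullet> b + 2 * \<eta>) (at 0)"
      by (rule derivative_eq_intros heat_second_derivative[OF b] grad_line_derivative refl | use \<tau> in simp)+
    show "D \<tau> (x + 0 *\<^sub>R b) \<le> D \<tau> (x + s *\<^sub>R b)" for s
      using min[OF \<tau>0] by simp
  qed
  \<comment> \<open>Summed over the basis, the spatial conditions give
    \<open>c * \<tau> \<le> ?S + \<epsilon> * \<tau>\<close>, whereas the time condition gives
    \<open>?S \<le> c * \<tau> - 2 * \<epsilon> * \<tau>\<close>. The two are incompatible for
    positive \<open>\<tau>\<close>.\<close>
  have "0 \<le> (\<Sum>b\<in>Basis. heat_moment b \<tau> x / \<tau> - frechet_derivative (grad f) (at x) b \<bullet> b + 2 * \<eta>)"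
    by (rule sum_nonneg) (rule space)
  also have "\<dots> = ?S / \<tau> - laplacian f x + \<epsilon>"
    by (simp add: sum.distrib sum_subtractf sum_divide_distrib laplacian_def \<eta>_def)
  finally have "c \<le> ?S / \<tau> + \<epsilon>" using lap[of x] by simp
  then have "c * \<tau> \<le> ?S + \<epsilon> * \<tau>" using \<tau> by (simp add: field_simps)
  moreover have "0 < \<epsilon> * \<tau>" using \<epsilon> \<tau> by simp
  ultimately show False using time by simp
qed

end

section \<open>The weak Laplacian bound\<close>

context bounded_gradient
begin

text \<open>The density of the measure \<nu>_x relative to the Gaussian before normalisation by
  \<open>mass\<close>; \<open>mean\<close> is expectation under \<nu>_x.\<close>

definition tilt_exp :: "'a \<Rightarrow> 'a \<Rightarrow> real" where
  "tilt_exp x y = exp (f y + x \<bullet> y)"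

definition mass :: "'a \<Rightarrow> real" where
  "mass x = (\<integral>y. tilt_exp x y \<partial>gauss)"

definition mean :: "('a \<Rightarrow> real) \<Rightarrow> 'a \<Rightarrow> real" where
  "mean h x = (\<integral>y. h y * tilt_exp x y \<partial>gauss) / mass x"

lemma tilt_exp_growth: "exp_growth tilt_exp"
  unfolding tilt_exp_def by (intro exp_growth_exp lin_growth_add lin_growth_g lin_growth_snd lin_growth_inner_param)

lemma tilt_exp_fixed: "exp_growth (\<lambda>_::real. tilt_exp x)"
  unfolding tilt_exp_def by (intro exp_growth_exp lin_growth_g growth_intros)

lemma tilt_exp_pos: "0 < tilt_exp x y"
  by (simp add: tilt_exp_def)

lemma mass_pos: "0 < mass x"
proof -
  have "0 \<le> mass x" unfolding mass_def by (simp add: tilt_exp_def)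
  moreover have "mass x \<noteq> 0"
    using integral_nonneg_eq_0_iff_AE[OF exp_growth_integrable[OF tilt_exp_growth], of x]
    by (simp add: mass_def tilt_exp_def[abs_def])
  ultimately show ?thesis by simp
qed

lemma tilt_exp_line: "((\<lambda>t. tilt_exp x (y + t *\<^sub>R b)) has_real_derivative (df b y + x \<bullet> b) * tilt_exp x y) (at 0)"
  unfolding tilt_exp_def inner_add_right inner_scaleR_right
  by (rule derivative_eq_intros line_derivative refl | simp)+

text \<open>The weak form of \<open>laplacian f \<ge> c\<close>, tested against the density of the tilted measure. It is read off
  from the heat lower bound as \<open>\<tau> \<rightarrow> 0\<close>.\<close>
lemma weak_laplacian_bound:
  assumes lap: "\<And>x. c \<le> laplacian f x"
  shows "c * mass x \<le> (\<Sum>b\<in>Basis. \<integral>y. (y \<bullet> b - (df b y + x \<bullet> b)) * df b y * tilt_exp x y \<partial>gauss)"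
proof (rule ccontr)
  \<comment> \<open>For positive \<open>\<tau>\<close> this is the integral of the Laplacian of
    \<open>heat \<tau>\<close> against \<open>tilt_exp x\<close>, integrated by parts. Only first
    derivatives are left, so it is continuous down to \<open>\<tau> = 0\<close>, where it is the
    right-hand side of the claim.\<close>
  define \<Theta> where "\<Theta> \<tau> = (\<Sum>b\<in>Basis. \<integral>y. (y \<bullet> b - (df b y + x \<bullet> b)) * heat_partial b \<tau> y * tilt_exp x y \<partial>gauss)" for \<tau>
  define \<Psi> where "\<Psi> \<tau> = (\<integral>y. heat \<tau> y * tilt_exp x y \<partial>gauss)" for \<tau>
  assume "\<not> ?thesis"
  then have less: "\<Theta> 0 < c * mass x" by (simp add: \<Theta>_def heat_partial_0)
  have te: "exp_growth (\<lambda>_::real. \<lambda>y. tilt_exp x y)" by (rule tilt_exp_fixed)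
  have gp: "exp_growth (\<lambda>\<tau> y. heat_partial b \<tau> y)" if b: "b \<in> Basis" for b
  proof (rule exp_growth_lin, rule lin_growthI)
    show "continuous_on UNIV (\<lambda>p. heat_partial b (fst p) (snd p))" by (rule heat_partial_cont[OF b])
    show "\<exists>C\<ge>0. \<forall>x z. norm x \<le> R \<longrightarrow> norm (heat_partial b x z) \<le> C * (1 + norm z)" for R
      using heat_partial_bound[OF b] L_nonneg
      by (intro exI[of _ L]) (auto simp: distrib_left intro: order_trans[OF heat_partial_bound[OF b]])
  qed
  have gm: "exp_growth (\<lambda>\<tau> y. heat_moment b \<tau> y)" if b: "b \<in> Basis" for b
  proof (rule exp_growth_lin, rule lin_growthI)
    let ?C = "L * (\<integral>z. norm (z::'a) \<partial>gauss)"
    have "0 \<le> ?C" using L_nonneg by simp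
    show "continuous_on UNIV (\<lambda>p. heat_moment b (fst p) (snd p))" by (rule heat_moment_cont[OF b])
    show "\<exists>C\<ge>0. \<forall>x z. norm x \<le> R \<longrightarrow> norm (heat_moment b x z) \<le> C * (1 + norm z)" for R
    proof (intro exI[of _ ?C] conjI allI impI)
      show "norm (heat_moment b \<tau> z) \<le> ?C * (1 + norm z)" for \<tau> z
        using heat_moment_bound[OF b, of \<tau> z] mult_nonneg_nonneg[OF \<open>0 \<le> ?C\<close> norm_ge_zero[of z]]
        by (simp only: distrib_left real_norm_def)
    qed fact
  qed
  have gh: "exp_growth (\<lambda>\<tau> y. heat \<tau> y)"
  proof (rule exp_growth_lin, rule lin_growthI)
    define m where "m = (\<integral>z. norm (z::'a) \<partial>gauss)"
    have m: "0 \<le> m" by (simp add: m_def)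
    show "continuous_on UNIV (\<lambda>p. heat (fst p) (snd p))" by (rule heat_cont)
    show "\<exists>C\<ge>0. \<forall>x z. norm x \<le> R \<longrightarrow> norm (heat x z) \<le> C * (1 + norm z)" for R :: real
    proof (intro exI[of _ "\<bar>f 0\<bar> + L + L * \<bar>R\<bar> * m"] conjI allI impI)
      show "0 \<le> \<bar>f 0\<bar> + L + L * \<bar>R\<bar> * m" using L_nonneg m by simp
      fix \<tau> :: real and z :: 'a assume t: "norm \<tau> \<le> R"
      have "L * \<bar>\<tau>\<bar> * m \<le> L * \<bar>R\<bar> * m" using t L_nonneg m by (intro mult_right_mono mult_left_mono) auto
      then have "\<bar>heat \<tau> z\<bar> \<le> (\<bar>f 0\<bar> + L) * (1 + norm z) + L * \<bar>R\<bar> * m"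
        using heat_close[of \<tau> z] f_growth[of z] unfolding m_def by linarith
      also have "\<dots> \<le> (\<bar>f 0\<bar> + L + L * \<bar>R\<bar> * m) * (1 + norm z)"
        using L_nonneg m by (simp add: algebra_simps)
      finally show "norm (heat \<tau> z) \<le> (\<bar>f 0\<bar> + L + L * \<bar>R\<bar> * m) * (1 + norm z)" by simp
    qed
  qed
  have fixed: "exp_growth (\<lambda>_::real. H \<tau>)" if "exp_growth H" for H :: "real \<Rightarrow> 'a \<Rightarrow> real" and \<tau>
    by (rule exp_growth_reparam[OF that continuous_on_const])
  have drift: "exp_growth (\<lambda>_::real. \<lambda>y. y \<bullet> b - (df b y + x \<bullet> b))" if "b \<in> Basis" for b
    using that by (intro exp_growth_diff exp_growth_add exp_growth_G exp_growth_lin growth_intros)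
  have \<Theta>_cont: "continuous_on UNIV \<Theta>"
    unfolding \<Theta>_def
    by (intro continuous_on_sum exp_growth_integral_continuous exp_growth_mult drift gp te)
  have \<Psi>_der: "(\<Psi> has_real_derivative (\<integral>y. (\<Sum>b\<in>Basis. heat_moment b \<tau> y) * tilt_exp x y \<partial>gauss)) (at \<tau>)" for \<tau>
    unfolding \<Psi>_def
  proof (rule exp_growth_has_derivative)
    show "((\<lambda>\<tau>. heat \<tau> y * tilt_exp x y) has_real_derivative (\<Sum>b\<in>Basis. heat_moment b \<tau> y) * tilt_exp x y) (at \<tau>)" for \<tau> y
      by (rule DERIV_cmult_right[OF heat_time_derivative])
  qed (intro exp_growth_mult exp_growth_sum gh gm te; assumption)+
  have parts: "(\<integral>y. heat_moment b \<tau> y / \<tau> * tilt_exp x y \<partial>gauss) =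
      (\<integral>y. (y \<bullet> b - (df b y + x \<bullet> b)) * heat_partial b \<tau> y * tilt_exp x y \<partial>gauss)" if b: "b \<in> Basis" and \<tau>: "0 < \<tau>" for b \<tau>
  proof -
    let ?F = "\<lambda>y. heat_partial b \<tau> y * tilt_exp x y"
    let ?G1 = "\<lambda>y. heat_moment b \<tau> y / \<tau> * tilt_exp x y"
    let ?G2 = "\<lambda>y. (df b y + x \<bullet> b) * heat_partial b \<tau> y * tilt_exp x y"
    have F: "exp_growth (\<lambda>_::real. ?F)" by (intro exp_growth_mult fixed[OF gp[OF b]] te)
    have G1: "exp_growth (\<lambda>_::real. ?G1)"
      using exp_growth_mult[OF exp_growth_mult[OF exp_growth_const[of "1 / \<tau>"] fixed[OF gm[OF b], of \<tau>]] te] by simp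
    have G2: "exp_growth (\<lambda>_::real. ?G2)"
      using b by (intro exp_growth_mult exp_growth_add exp_growth_G fixed[OF gp[OF b]] te exp_growth_lin growth_intros)
    have yF: "exp_growth (\<lambda>_::real. \<lambda>y. (y \<bullet> b) * ?F y)"
      by (intro exp_growth_mult[OF _ F] exp_growth_lin growth_intros)
    have "(\<integral>y. ?G1 y + ?G2 y \<partial>gauss) = (\<integral>y. (y \<bullet> b) * ?F y \<partial>gauss)"
    proof (rule gauss_parts[OF F exp_growth_add[OF G1 G2]])
      fix y
      have "((\<lambda>t. heat_partial b \<tau> (y + t *\<^sub>R b) * tilt_exp x (y + t *\<^sub>R b)) has_real_derivative
         heat_moment b \<tau> y / \<tau> * tilt_exp x (y + 0 *\<^sub>R b) + (df b y + x \<bullet> b) * tilt_exp x y * heat_partial b \<tau> (y + 0 *\<^sub>R b)) (at 0)"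
        by (rule DERIV_mult[OF heat_second_derivative[OF b] tilt_exp_line]) (use \<tau> in simp)
      then show "((\<lambda>t. heat_partial b \<tau> (y + t *\<^sub>R b) * tilt_exp x (y + t *\<^sub>R b)) has_real_derivative ?G1 y + ?G2 y) (at 0)"
        by (simp add: mult_ac)
    qed
    then have "(\<integral>y. ?G1 y \<partial>gauss) = (\<integral>y. (y \<bullet> b) * ?F y \<partial>gauss) - (\<integral>y. ?G2 y \<partial>gauss)"
      using exp_growth_integrable[OF G1] exp_growth_integrable[OF G2] by simp
    also have "\<dots> = (\<integral>y. (y \<bullet> b) * ?F y - ?G2 y \<partial>gauss)"
      using exp_growth_integrable[OF yF] exp_growth_integrable[OF G2] by simp
    also have "(\<lambda>y. (y \<bullet> b) * ?F y - ?G2 y) = (\<lambda>y. (y \<bullet> b - (df b y + x \<bullet> b)) * heat_partial b \<tau> y * tilt_exp x y)"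
      by (simp add: algebra_simps)
    finally show ?thesis .
  qed
  have \<Psi>_der': "(\<Psi> has_real_derivative \<tau> * \<Theta> \<tau>) (at \<tau>)" if \<tau>: "0 < \<tau>" for \<tau>
  proof -
    have "(\<integral>y. (\<Sum>b\<in>Basis. heat_moment b \<tau> y) * tilt_exp x y \<partial>gauss) = (\<Sum>b\<in>Basis. \<integral>y. heat_moment b \<tau> y * tilt_exp x y \<partial>gauss)"
      using exp_growth_integrable[OF exp_growth_mult[OF gm te]]
      by (simp add: sum_distrib_right Bochner_Integration.integral_sum)
    also have "\<dots> = (\<Sum>b\<in>Basis. \<tau> * (\<integral>y. heat_moment b \<tau> y / \<tau> * tilt_exp x y \<partial>gauss))"
      using \<tau> by simp
    also have "\<dots> = \<tau> * \<Theta> \<tau>"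
      unfolding \<Theta>_def sum_distrib_left using parts[OF _ \<tau>] by simp
    finally show ?thesis using \<Psi>_der[of \<tau>] by simp
  qed
  have "(\<Theta> \<longlongrightarrow> \<Theta> 0) (at 0)"
    using \<Theta>_cont by (simp add: continuous_on_eq_continuous_at isCont_def)
  from order_tendstoD(2)[OF this less] obtain d where d: "d > 0" "\<And>\<tau>. \<tau> \<noteq> 0 \<Longrightarrow> dist \<tau> 0 < d \<Longrightarrow> \<Theta> \<tau> < c * mass x"
    unfolding eventually_at by auto
  define T where "T = d / 2"
  have T: "0 < T" using d by (simp add: T_def)
  \<comment> \<open>Its derivative is \<open>\<tau> * (\<Theta> \<tau> - c * mass x)\<close>,
    negative for small positive \<open>\<tau>\<close> under the assumption made. The heat lower
    bound, integrated against \<open>tilt_exp x\<close>, forces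
    \<open>\<Phi> 0 \<le> \<Phi> T\<close>.\<close>
  define \<Phi> where "\<Phi> \<tau> = \<Psi> \<tau> - c * mass x * \<tau>\<^sup>2 / 2" for \<tau>
  have "\<Phi> T < \<Phi> 0"
  proof (rule DERIV_neg_imp_decreasing_open[OF T])
    show "\<exists>y. (\<Phi> has_real_derivative y) (at \<tau>) \<and> y < 0" if "0 < \<tau>" "\<tau> < T" for \<tau>
    proof (intro exI conjI)
      show "(\<Phi> has_real_derivative \<tau> * \<Theta> \<tau> - c * mass x * \<tau>) (at \<tau>)"
        unfolding \<Phi>_def by (rule derivative_eq_intros \<Psi>_der' that refl | simp)+
      have "\<tau> * \<Theta> \<tau> < \<tau> * (c * mass x)"
        using d(2)[of \<tau>] that T by (intro mult_strict_left_mono) (auto simp: T_def)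
      then show "\<tau> * \<Theta> \<tau> - c * mass x * \<tau> < 0" by (simp add: mult_ac)
    qed
    show "continuous_on {0..T} \<Phi>"
      unfolding \<Phi>_def using \<Psi>_der by (intro continuous_intros continuous_at_imp_continuous_on) (auto intro: DERIV_isCont)
  qed
  moreover have "\<Phi> 0 \<le> \<Phi> T"
  proof -
    have fi: "integrable gauss (\<lambda>y. heat \<tau> y * tilt_exp x y)" for \<tau>
      using exp_growth_integrable[OF exp_growth_mult[OF gh te]] .
    have ti: "integrable gauss (tilt_exp x)" by (rule exp_growth_integrable[OF tilt_exp_growth])
    have "\<Psi> 0 + c * T\<^sup>2 / 2 * mass x = (\<integral>y. heat 0 y * tilt_exp x y + c * T\<^sup>2 / 2 * tilt_exp x y \<partial>gauss)"
      using fi ti by (simp add: \<Psi>_def mass_def)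
    also have "\<dots> \<le> \<Psi> T"
      unfolding \<Psi>_def
    proof (rule integral_mono)
      fix y
      have "(heat 0 y + c * T\<^sup>2 / 2) * tilt_exp x y \<le> heat T y * tilt_exp x y"
        using heat_lower_bound[OF lap T, of y] tilt_exp_pos[of x y] by (intro mult_right_mono) (auto simp: heat_0)
      then show "heat 0 y * tilt_exp x y + c * T\<^sup>2 / 2 * tilt_exp x y \<le> heat T y * tilt_exp x y"
        by (simp add: distrib_right)
    qed (use fi ti in auto)
    finally show ?thesis by (simp add: \<Phi>_def mult_ac)
  qed
  ultimately show False by simp
qed

end

section \<open>Divergence of the mean gradient\<close>

lemma exp_growth_change_param:
  "exp_growth (\<lambda>_::real. h) \<Longrightarrow> exp_growth (\<lambda>_::'q::euclidean_space. h)"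
  using exp_growth_reparam[of "\<lambda>_::real. h" "\<lambda>_::'q. 0"] by simp

lemma exp_growth_inner: "exp_growth (\<lambda>_::real. \<lambda>y. y \<bullet> b)"
  by (intro exp_growth_lin growth_intros)

text \<open>Truncation by \<open>max\<close> gives a continuous weight of compact support whose
  derivative is missing only on the sphere; every line in a basis direction meets that sphere in at
  most two points.\<close>

definition paraboloid :: "real \<Rightarrow> 'a::euclidean_space \<Rightarrow> real" where
  "paraboloid r x = max 0 (r\<^sup>2 - (norm x)\<^sup>2)"

lemma paraboloid_cont: "continuous_on UNIV (paraboloid r)"
  unfolding paraboloid_def by (intro continuous_intros)

lemma paraboloid_meas [measurable]: "paraboloid r \<in> borel_measurable borel"
  using paraboloid_cont by (rule borel_measurable_continuous_onI)

lemma paraboloid_bounds: "0 \<le> paraboloid r x" "paraboloid r x \<le> r\<^sup>2"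
  by (auto simp: paraboloid_def)

lemma paraboloid_outside: "0 < r \<Longrightarrow> r \<le> norm x \<Longrightarrow> paraboloid r x = 0"
  using power_mono[of r "norm x" 2] by (simp add: paraboloid_def)

lemma paraboloid_line:
  assumes r: "0 < r" and y: "norm y \<noteq> r"
  shows "((\<lambda>t. paraboloid r (y + t *\<^sub>R b)) has_real_derivative (if norm y < r then - 2 * (y \<bullet> b) else 0)) (at 0)"
proof -
  have cont: "continuous_on UNIV (\<lambda>t::real. norm (y + t *\<^sub>R b))" by (intro continuous_intros)
  show ?thesis
  proof (cases "norm y < r")
    case True
    have "((\<lambda>t. r\<^sup>2 - ((norm y)\<^sup>2 + 2 * t * (y \<bullet> b) + t\<^sup>2 * (b \<bullet> b))) has_real_derivative - 2 * (y \<bullet> b)) (at 0)"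
      by (rule derivative_eq_intros refl | simp)+
    then have "((\<lambda>t. paraboloid r (y + t *\<^sub>R b)) has_real_derivative - 2 * (y \<bullet> b)) (at 0)"
    proof (rule has_field_derivative_transform_within_open[where S="{t. norm (y + t *\<^sub>R b) < r}"])
      show "open {t. norm (y + t *\<^sub>R b) < r}" by (intro open_Collect_less cont) simp
      show "r\<^sup>2 - ((norm y)\<^sup>2 + 2 * t * (y \<bullet> b) + t\<^sup>2 * (b \<bullet> b)) = paraboloid r (y + t *\<^sub>R b)"
        if "t \<in> {t. norm (y + t *\<^sub>R b) < r}" for t
      proof -
        have "(norm (y + t *\<^sub>R b))\<^sup>2 \<le> r\<^sup>2" using that by (intro power_mono) auto
        moreover have "(norm (y + t *\<^sub>R b))\<^sup>2 = (norm y)\<^sup>2 + 2 * t * (y \<bullet> b) + t\<^sup>2 * (b \<bullet> b)"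
          unfolding power2_norm_eq_inner by (simp add: inner_commute algebra_simps power2_eq_square)
        ultimately show ?thesis by (simp add: paraboloid_def)
      qed
    qed (use True in auto)
    then show ?thesis using True by simp
  next
    case False
    have "((\<lambda>t::real. 0) has_real_derivative 0) (at 0)" by simp
    then have "((\<lambda>t. paraboloid r (y + t *\<^sub>R b)) has_real_derivative 0) (at 0)"
      by (rule has_field_derivative_transform_within_open[where S="{t. r < norm (y + t *\<^sub>R b)}"])
        (use False y r in \<open>auto intro!: open_Collect_less cont simp: paraboloid_outside\<close>)
    then show ?thesis using False by simp
  qed
qed

lemma finite_line_sphere:
  assumes b: "b \<in> Basis"
  shows "finite {t. norm (x + t *\<^sub>R b) = r}"
proof (rule finite_subset)
  define q where "q = r\<^sup>2 - (norm x)\<^sup>2 + (x \<bullet> b)\<^sup>2"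
  show "{t. norm (x + t *\<^sub>R b) = r} \<subseteq> {- (x \<bullet> b) + sqrt q, - (x \<bullet> b) - sqrt q}"
  proof
    fix t assume "t \<in> {t. norm (x + t *\<^sub>R b) = r}"
    then have "(norm (x + t *\<^sub>R b))\<^sup>2 = r\<^sup>2" by simp
    then have "(t + x \<bullet> b)\<^sup>2 = q"
      unfolding power2_norm_eq_inner q_def using b by (simp add: inner_commute algebra_simps power2_eq_square)
    then have "\<bar>t + x \<bullet> b\<bar> = sqrt q" by (metis real_sqrt_abs)
    then show "t \<in> {- (x \<bullet> b) + sqrt q, - (x \<bullet> b) - sqrt q}" by auto
  qed
qed simp

lemma ball_borel [measurable]: "ball (x::'a::metric_space) r \<in> sets borel"
  by simp

lemma integrable_bounded_ball:
  fixes F :: "'a::euclidean_space \<Rightarrow> real"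
  assumes [measurable]: "F \<in> borel_measurable borel"
    and bd: "\<And>x. norm x < r \<Longrightarrow> \<bar>F x\<bar> \<le> B" and out: "\<And>x. r \<le> norm x \<Longrightarrow> F x = 0"
  shows "integrable lborel F"
proof (rule Bochner_Integration.integrable_bound)
  show "integrable lborel (\<lambda>x::'a. B * indicator (ball 0 r) x)"
    using emeasure_lborel_ball_finite[of "0::'a" r] by (auto intro!: integrable_mult_right)
  show "AE x in lborel. norm (F x) \<le> norm (B * indicator (ball 0 r) x :: real)"
    using bd out by (intro AE_I2) (auto simp: indicator_def not_less intro: order_trans[OF bd abs_ge_self])
qed simp

section \<open>Means under the tilted measures and their derivatives\<close>

context bounded_gradient
begin

text \<open>The covariance of \<open>df b\<close> with the coordinate along \<open>b\<close> under
  \<nu>_x. It is also the partial derivative of \<open>mean (df b)\<close> along \<open>b\<close>,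
  so its sum over the basis is the divergence of the mean gradient.\<close>

definition cov :: "'a \<Rightarrow> 'a \<Rightarrow> real" where
  "cov b x = mean (\<lambda>y. df b y * (y \<bullet> b)) x - mean (df b) x * mean (\<lambda>y. y \<bullet> b) x"

lemma mean_integrable: "exp_growth (\<lambda>_::real. h) \<Longrightarrow> integrable gauss (\<lambda>y. h y * tilt_exp x y)"
  using exp_growth_integrable[OF exp_growth_mult[OF _ tilt_exp_fixed]] .

lemma df_growth: "b \<in> Basis \<Longrightarrow> exp_growth (\<lambda>_::real. df b)"
  by (intro exp_growth_G growth_intros)

lemma mean_add: "exp_growth (\<lambda>_::real. h) \<Longrightarrow> exp_growth (\<lambda>_::real. k) \<Longrightarrow> mean (\<lambda>y. h y + k y) x = mean h x + mean k x"
  using mean_integrable[of h] mean_integrable[of k] by (simp add: mean_def distrib_right add_divide_distrib)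

lemma mean_diff: "exp_growth (\<lambda>_::real. h) \<Longrightarrow> exp_growth (\<lambda>_::real. k) \<Longrightarrow> mean (\<lambda>y. h y - k y) x = mean h x - mean k x"
  using mean_integrable[of h] mean_integrable[of k] by (simp add: mean_def left_diff_distrib diff_divide_distrib)

lemma mean_cmult: "mean (\<lambda>y. a * h y) x = a * mean h x"
  by (simp add: mean_def mult.assoc)

lemma mean_const: "mean (\<lambda>y. a) x = a"
  using mass_pos[of x] by (simp add: mean_def mass_def)

lemma mean_mono:
  assumes "exp_growth (\<lambda>_::real. h)" "exp_growth (\<lambda>_::real. k)" "\<And>y. h y \<le> k y"
  shows "mean h x \<le> mean k x"
  unfolding mean_def using assms mass_pos[of x] tilt_exp_pos[of x]
  by (intro divide_right_mono integral_mono mean_integrable mult_right_mono) (auto simp: less_imp_le)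

lemma mean_sum:
  "(\<And>i. i \<in> I \<Longrightarrow> exp_growth (\<lambda>_::real. h i)) \<Longrightarrow> mean (\<lambda>y. \<Sum>i\<in>I. h i y) x = (\<Sum>i\<in>I. mean (h i) x)"
  using mean_integrable by (simp add: mean_def sum_distrib_right Bochner_Integration.integral_sum sum_divide_distrib)

lemma mean_cont:
  assumes "exp_growth (\<lambda>_::real. h)"
  shows "continuous_on UNIV (mean h)"
  unfolding mean_def mass_def
proof (intro continuous_on_divide exp_growth_integral_continuous tilt_exp_growth ballI)
  show "exp_growth (\<lambda>x y. h y * tilt_exp x y)"
    by (rule exp_growth_mult[OF exp_growth_change_param[OF assms] tilt_exp_growth])
  show "(\<integral>y. tilt_exp x y \<partial>gauss) \<noteq> 0" for x using mass_pos[of x] by (simp add: mass_def)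
qed

text \<open>The tilted measures form an exponential family: moving the parameter along
  \<open>b\<close> brings down a factor \<open>y \<bullet> b\<close>, and the quotient rule for the
  normalisation subtracts the product of the means.\<close>

lemma mean_derivative:
  assumes h: "exp_growth (\<lambda>_::real. h)"
  shows "((\<lambda>t. mean h (x + t *\<^sub>R b)) has_real_derivative mean (\<lambda>y. h y * (y \<bullet> b)) x - mean h x * mean (\<lambda>y. y \<bullet> b) x) (at 0)"
proof -
  have line: "continuous_on UNIV (\<lambda>t::real. x + t *\<^sub>R b)" by (intro continuous_intros)
  have N: "((\<lambda>t. \<integral>y. k y * tilt_exp (x + t *\<^sub>R b) y \<partial>gauss) has_real_derivative (\<integral>y. (k y * (y \<bullet> b)) * tilt_exp (x + 0 *\<^sub>R b) y \<partial>gauss)) (at 0)"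
    if k: "exp_growth (\<lambda>_::real. k)" for k
  proof (rule exp_growth_has_derivative)
    show "((\<lambda>t. k y * tilt_exp (x + t *\<^sub>R b) y) has_real_derivative (k y * (y \<bullet> b)) * tilt_exp (x + t *\<^sub>R b) y) (at t)" for t y
      unfolding tilt_exp_def inner_add_left inner_scaleR_left
      by (rule derivative_eq_intros refl | simp add: inner_commute)+
  qed (intro exp_growth_mult k exp_growth_inner exp_growth_reparam[OF tilt_exp_growth line])+
  have M: "((\<lambda>t. mass (x + t *\<^sub>R b)) has_real_derivative (\<integral>y. (y \<bullet> b) * tilt_exp x y \<partial>gauss)) (at 0)"
    using N[OF exp_growth_const[of 1]] by (simp add: mass_def)
  have "((\<lambda>t. (\<integral>y. h y * tilt_exp (x + t *\<^sub>R b) y \<partial>gauss) / mass (x + t *\<^sub>R b)) has_real_derivative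
     ((\<integral>y. (h y * (y \<bullet> b)) * tilt_exp (x + 0 *\<^sub>R b) y \<partial>gauss) * mass (x + 0 *\<^sub>R b) - (\<integral>y. h y * tilt_exp (x + 0 *\<^sub>R b) y \<partial>gauss) * (\<integral>y. (y \<bullet> b) * tilt_exp x y \<partial>gauss))
      / (mass (x + 0 *\<^sub>R b) * mass (x + 0 *\<^sub>R b))) (at 0)"
    using mass_pos[of x] by (intro DERIV_divide N h M) auto
  then show ?thesis
    using mass_pos[of x] by (simp add: mean_def diff_divide_distrib)
qed

lemma mean_identity:
  assumes b: "b \<in> Basis"
  shows "mean (\<lambda>y. y \<bullet> b) x = mean (df b) x + x \<bullet> b"
proof -
  have g: "exp_growth (\<lambda>_::real. \<lambda>y. df b y + x \<bullet> b)"
    by (intro exp_growth_add df_growth b exp_growth_const)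
  have "(\<integral>y. (df b y + x \<bullet> b) * tilt_exp x y \<partial>gauss) = (\<integral>y. (y \<bullet> b) * tilt_exp x y \<partial>gauss)"
    by (rule gauss_parts[OF tilt_exp_fixed exp_growth_mult[OF g tilt_exp_fixed] tilt_exp_line])
  then have "mean (\<lambda>y. y \<bullet> b) x = mean (\<lambda>y. df b y + x \<bullet> b) x" by (simp add: mean_def)
  then show ?thesis by (simp add: mean_add df_growth b exp_growth_const mean_const)
qed

text \<open>Write \<open>m\<close> for the mean of \<open>df b\<close>. By
  \<open>mean_identity\<close> the coordinate along \<open>b\<close> has mean
  \<open>m + x \<bullet> b\<close>, so \<open>cov b x\<close> is the mean of
  \<open>df b y * (y \<bullet> b)\<close> minus \<open>m * (m + x \<bullet> b)\<close>. Subtracting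
  the corresponding summand of the weak Laplacian bound leaves the mean of the square of
  \<open>df b\<close> minus \<open>m\<^sup>2\<close>.\<close>

lemma variance_le_cov:
  assumes lap: "\<And>x. c \<le> laplacian f x"
  shows "(\<Sum>b\<in>Basis. mean (\<lambda>y. (df b y - mean (df b) x)\<^sup>2) x) \<le> (\<Sum>b\<in>Basis. cov b x) - c"
proof -
  have "c * mass x \<le> (\<Sum>b\<in>Basis. \<integral>y. (y \<bullet> b - (df b y + x \<bullet> b)) * df b y * tilt_exp x y \<partial>gauss)"
    by (rule weak_laplacian_bound[OF lap])
  then have c: "c \<le> (\<Sum>b\<in>Basis. mean (\<lambda>y. (y \<bullet> b - (df b y + x \<bullet> b)) * df b y) x)"
    unfolding mean_def sum_divide_distrib[symmetric] using mass_pos[of x] by (simp add: le_divide_eq)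
  have "mean (\<lambda>y. (df b y - mean (df b) x)\<^sup>2) x = cov b x - mean (\<lambda>y. (y \<bullet> b - (df b y + x \<bullet> b)) * df b y) x"
    if b: "b \<in> Basis" for b
  proof -
    define m where "m = mean (df b) x"
    note G = df_growth[OF b]
    have 2: "exp_growth (\<lambda>_::real. \<lambda>y. (df b y)\<^sup>2)" by (intro exp_growth_power G)
    have y: "exp_growth (\<lambda>_::real. \<lambda>y. df b y * (y \<bullet> b))" by (intro exp_growth_mult G exp_growth_inner)
    have k: "exp_growth (\<lambda>_::real. \<lambda>y. a * df b y)" for a by (intro exp_growth_mult G exp_growth_const)
    have "mean (\<lambda>y. (df b y - m)\<^sup>2) x = mean (\<lambda>y. (df b y)\<^sup>2 - (2 * m) * df b y + m\<^sup>2) x"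
      by (simp add: power2_diff algebra_simps)
    also have "\<dots> = mean (\<lambda>y. (df b y)\<^sup>2) x - 2 * m * m + m\<^sup>2"
      by (simp add: mean_add mean_diff mean_cmult mean_const exp_growth_diff 2 k exp_growth_const flip: m_def)
    finally have 1: "mean (\<lambda>y. (df b y - m)\<^sup>2) x = mean (\<lambda>y. (df b y)\<^sup>2) x - m\<^sup>2" by (simp add: power2_eq_square)
    have "mean (\<lambda>y. (y \<bullet> b - (df b y + x \<bullet> b)) * df b y) x = mean (\<lambda>y. df b y * (y \<bullet> b) - (df b y)\<^sup>2 - (x \<bullet> b) * df b y) x"
      by (simp add: power2_eq_square algebra_simps)
    also have "\<dots> = mean (\<lambda>y. df b y * (y \<bullet> b)) x - mean (\<lambda>y. (df b y)\<^sup>2) x - (x \<bullet> b) * m"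
      by (simp add: mean_diff mean_cmult exp_growth_diff 2 y k flip: m_def)
    finally show ?thesis
      using 1 unfolding cov_def mean_identity[OF b] m_def[symmetric] by (simp add: power2_eq_square algebra_simps)
  qed
  then show ?thesis using c by (simp add: sum_subtractf)
qed

lemma cov_cont: "b \<in> Basis \<Longrightarrow> continuous_on UNIV (cov b)"
  unfolding cov_def by (intro continuous_intros mean_cont exp_growth_mult df_growth exp_growth_inner)

lemma mean_df_bound: "b \<in> Basis \<Longrightarrow> \<bar>mean (df b) x\<bar> \<le> L"
proof -
  assume b: "b \<in> Basis"
  have "mean (df b) x \<le> mean (\<lambda>y. L) x" "mean (\<lambda>y. - L) x \<le> mean (df b) x"
    using df_bound[OF b] by (auto intro!: mean_mono df_growth b exp_growth_const simp: abs_le_iff minus_le_iff)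
  then show ?thesis by (simp add: mean_const)
qed

text \<open>Integration by parts for the product of \<open>paraboloid r\<close> and
  \<open>mean (df b)\<close>: its derivative along \<open>b\<close> is the difference of the two
  integrands, with the factor 2 from the gradient of the paraboloid, and
  \<open>integral_partial_zero\<close> makes the integral of this difference vanish.\<close>

lemma cov_paraboloid:
  assumes b: "b \<in> Basis" and r: "0 < r"
  shows "(\<integral>x. paraboloid r x * cov b x \<partial>lborel) = 2 * (\<integral>x. indicator (ball 0 r) x * ((x \<bullet> b) * mean (df b) x) \<partial>lborel)"
    and "integrable lborel (\<lambda>x. paraboloid r x * cov b x)"
    and "integrable lborel (\<lambda>x. indicator (ball 0 r) x * ((x \<bullet> b) * mean (df b) x))"
proof -
  have [measurable]: "cov b \<in> borel_measurable borel" "mean (df b) \<in> borel_measurable borel"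
    using cov_cont[OF b] mean_cont[OF df_growth[OF b]] by (auto intro: borel_measurable_continuous_onI)
  obtain B where B: "B \<ge> 0" "\<And>x. norm x \<le> r \<Longrightarrow> norm (cov b x) \<le> B"
    using continuous_bounded_on_norm_le[OF cov_cont[OF b], where R=r] by blast
  have b1: "\<bar>paraboloid r x * cov b x\<bar> \<le> r\<^sup>2 * B" for x
  proof (cases "norm x \<le> r")
    case True
    then show ?thesis using B paraboloid_bounds[of r x] by (auto simp: abs_mult intro!: mult_mono)
  qed (use r B in \<open>simp add: paraboloid_outside\<close>)
  have b2: "\<bar>indicator (ball 0 r) x * ((x \<bullet> b) * mean (df b) x)\<bar> \<le> r * L" for x
  proof (cases "norm x < r")
    case True
    have "\<bar>x \<bullet> b\<bar> * \<bar>mean (df b) x\<bar> \<le> r * L"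
      using True Basis_le_norm[OF b, of x] mean_df_bound[OF b, of x] r by (intro mult_mono) auto
    then show ?thesis using True by (simp add: abs_mult)
  qed (use r L_nonneg in simp)
  show i1: "integrable lborel (\<lambda>x. paraboloid r x * cov b x)"
    by (rule integrable_bounded_ball[where r=r, OF _ b1]) (auto simp: paraboloid_outside r)
  show i2: "integrable lborel (\<lambda>x. indicator (ball 0 r) x * ((x \<bullet> b) * mean (df b) x))"
    by (rule integrable_bounded_ball[where r=r, OF _ b2]) auto
  have "(\<integral>x. paraboloid r x * cov b x - 2 * (indicator (ball 0 r) x * ((x \<bullet> b) * mean (df b) x)) \<partial>lborel) = 0"
  proof (rule integral_partial_zero[where F="\<lambda>x. paraboloid r x * mean (df b) x" and b=b])
    show "integrable lborel (\<lambda>x. paraboloid r x * mean (df b) x)"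
    proof (rule integrable_bounded_ball[where r=r])
      show "\<bar>paraboloid r x * mean (df b) x\<bar> \<le> r\<^sup>2 * L" for x
        using paraboloid_bounds[of r x] mean_df_bound[OF b, of x] by (auto simp: abs_mult intro!: mult_mono)
    qed (auto simp: paraboloid_outside r)
    show "integrable lborel (\<lambda>x. paraboloid r x * cov b x - 2 * (indicator (ball 0 r) x * ((x \<bullet> b) * mean (df b) x)))"
      using i1 i2 by auto
    show "\<bar>paraboloid r x * cov b x - 2 * (indicator (ball 0 r) x * ((x \<bullet> b) * mean (df b) x))\<bar> \<le> r\<^sup>2 * B + 2 * (r * L)" for x
      using b1[of x] b2[of x] by linarith
    show "continuous_on UNIV (\<lambda>t. paraboloid r (x + t *\<^sub>R b) * mean (df b) (x + t *\<^sub>R b))" for x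
      by (intro continuous_intros continuous_on_compose2[OF paraboloid_cont] continuous_on_compose2[OF mean_cont[OF df_growth[OF b]]]) auto
    fix x
    show "\<exists>N. finite N \<and> (\<forall>t. t \<notin> N \<longrightarrow> ((\<lambda>t. paraboloid r (x + t *\<^sub>R b) * mean (df b) (x + t *\<^sub>R b)) has_real_derivative
        paraboloid r (x + t *\<^sub>R b) * cov b (x + t *\<^sub>R b) -
        2 * (indicator (ball 0 r) (x + t *\<^sub>R b) * (((x + t *\<^sub>R b) \<bullet> b) * mean (df b) (x + t *\<^sub>R b)))) (at t))"
    proof (intro exI[of _ "{t. norm (x + t *\<^sub>R b) = r}"] conjI allI impI finite_line_sphere b)
      fix t assume t: "t \<notin> {t. norm (x + t *\<^sub>R b) = r}"
      define y where "y = x + t *\<^sub>R b"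
      let ?F = "\<lambda>y. paraboloid r y * mean (df b) y"
      let ?D = "paraboloid r y * cov b y - 2 * (indicator (ball 0 r) y * ((y \<bullet> b) * mean (df b) y))"
      have "((\<lambda>s. ?F (y + s *\<^sub>R b)) has_real_derivative ?D) (at 0)"
        using DERIV_mult[OF paraboloid_line[of r y b] mean_derivative[OF df_growth[OF b], of y b]] t r
        by (auto simp: y_def[symmetric] cov_def indicator_def algebra_simps split: if_splits)
      moreover have "(\<lambda>s. ?F (x + (s + t) *\<^sub>R b)) = (\<lambda>s. ?F (y + s *\<^sub>R b))"
        by (simp add: y_def algebra_simps)
      ultimately show "((\<lambda>t. ?F (x + t *\<^sub>R b)) has_real_derivative
        paraboloid r (x + t *\<^sub>R b) * cov b (x + t *\<^sub>R b) -
        2 * (indicator (ball 0 r) (x + t *\<^sub>R b) * (((x + t *\<^sub>R b) \<bullet> b) * mean (df b) (x + t *\<^sub>R b)))) (at t)"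
        using DERIV_shift[of "\<lambda>t. ?F (x + t *\<^sub>R b)" ?D 0 t] by (simp add: y_def)
    qed
  qed
  then show "(\<integral>x. paraboloid r x * cov b x \<partial>lborel) = 2 * (\<integral>x. indicator (ball 0 r) x * ((x \<bullet> b) * mean (df b) x) \<partial>lborel)"
    using i1 i2 by simp
qed

text \<open>A minimiser over the closed ball, which exists by continuity, lies below every weighted
  average. After integration by parts the average contains \<open>x\<close> paired with the mean
  gradient at \<open>x\<close>; as a mean of numbers \<open>grad f y \<bullet> x\<close> this is at
  most \<open>h x\<close>.\<close>

lemma exists_small_divergence:
  assumes r: "0 < r" and h: "\<And>y x. grad f y \<bullet> x \<le> h x" and hi: "integrable lborel (\<lambda>x. indicator (ball 0 r) x * h x)"
  shows "\<exists>x0. norm x0 \<le> r \<and> (\<Sum>b\<in>Basis. cov b x0) * (\<integral>x. paraboloid r (x::'a) \<partial>lborel) \<le> 2 * (\<integral>x. indicator (ball 0 r) x * h x \<partial>lborel)"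
proof -
  let ?div = "\<lambda>x. \<Sum>b\<in>Basis. cov b x"
  have pull: "(\<lambda>x. indicator (ball 0 r) x * (\<Sum>b\<in>Basis. (x \<bullet> b) * mean (df b) x)) =
      (\<lambda>x. \<Sum>b\<in>Basis. indicator (ball 0 r) x * ((x \<bullet> b) * mean (df b) x))"
    by (simp only: sum_distrib_left)
  have "continuous_on (cball 0 r) ?div"
    by (intro continuous_on_sum continuous_on_subset[OF cov_cont]) auto
  moreover have "cball (0::'a) r \<noteq> {}" using r by simp
  ultimately obtain x0 where x0: "norm x0 \<le> r" "\<And>x. norm x \<le> r \<Longrightarrow> ?div x0 \<le> ?div x"
    using continuous_attains_inf[of "cball 0 r" ?div] by auto
  have ip: "integrable lborel (paraboloid r :: 'a \<Rightarrow> real)"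
  proof (rule integrable_bounded_ball[where r=r])
    show "\<bar>paraboloid r x\<bar> \<le> r\<^sup>2" for x :: 'a
      using paraboloid_bounds[of r x] by simp
  qed (auto simp: paraboloid_outside r)
  have "?div x0 * (\<integral>x. paraboloid r (x::'a) \<partial>lborel) = (\<integral>x. paraboloid r (x::'a) * ?div x0 \<partial>lborel)"
    by simp
  also have "\<dots> \<le> (\<integral>x. (\<Sum>b\<in>Basis. paraboloid r x * cov b x) \<partial>lborel)"
  proof (rule integral_mono)
    show "paraboloid r x * ?div x0 \<le> (\<Sum>b\<in>Basis. paraboloid r x * cov b x)" for x
    proof (cases "norm x \<le> r")
      case True
      then show ?thesis using x0(2)[OF True] paraboloid_bounds[of r x]
        by (simp add: mult_left_mono flip: sum_distrib_left)
    qed (simp add: paraboloid_outside r)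
  qed (use ip cov_paraboloid(2)[OF _ r] in \<open>auto intro!: Bochner_Integration.integrable_sum\<close>)
  also have "\<dots> = (\<Sum>b\<in>Basis. 2 * (\<integral>x. indicator (ball 0 r) x * ((x \<bullet> b) * mean (df b) x) \<partial>lborel))"
    using cov_paraboloid[OF _ r] by (simp add: Bochner_Integration.integral_sum)
  also have "\<dots> = 2 * (\<integral>x. indicator (ball 0 r) x * (\<Sum>b\<in>Basis. (x \<bullet> b) * mean (df b) x) \<partial>lborel)"
    unfolding pull using cov_paraboloid(3)[OF _ r]
    by (subst Bochner_Integration.integral_sum) (auto simp only: sum_distrib_left)
  also have "\<dots> \<le> 2 * (\<integral>x. indicator (ball 0 r) x * h x \<partial>lborel)"
  proof (rule mult_left_mono[OF integral_mono[OF _ hi]])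
    show "integrable lborel (\<lambda>x. indicator (ball 0 r) x * (\<Sum>b\<in>Basis. (x \<bullet> b) * mean (df b) x))"
      unfolding pull using cov_paraboloid(3)[OF _ r] by (intro Bochner_Integration.integrable_sum) auto
    show "indicator (ball 0 r) x * (\<Sum>b\<in>Basis. (x \<bullet> b) * mean (df b) x) \<le> indicator (ball 0 r) x * h x" for x
    proof (rule mult_left_mono)
      have "(\<Sum>b\<in>Basis. (x \<bullet> b) * mean (df b) x) = mean (\<lambda>y. \<Sum>b\<in>Basis. (x \<bullet> b) * df b y) x"
        by (subst mean_sum) (auto simp: mean_cmult intro!: exp_growth_mult exp_growth_const df_growth)
      also have "\<dots> \<le> mean (\<lambda>y. h x) x"
      proof (intro mean_mono exp_growth_sum exp_growth_mult exp_growth_const df_growth)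
        show "(\<Sum>b\<in>Basis. (x \<bullet> b) * df b y) \<le> h x" for y
          using h[of y x] euclidean_inner[of x "grad f y"] by (simp add: inner_commute)
      qed
      finally show "(\<Sum>b\<in>Basis. (x \<bullet> b) * mean (df b) x) \<le> h x" by (simp add: mean_const)
    qed simp
  qed simp
  finally show ?thesis using x0(1) by blast
qed

end

section \<open>Homogeneous functions\<close>

lemma nn_integral_lborel_scale:
  fixes h :: "'a::euclidean_space \<Rightarrow> ennreal"
  assumes [measurable]: "h \<in> borel_measurable borel" and c: "0 < c"
  shows "(\<integral>\<^sup>+x. h x \<partial>lborel) = ennreal (c ^ DIM('a)) * (\<integral>\<^sup>+x. h (c *\<^sub>R x) \<partial>lborel)"
  by (subst lborel_affine[of c 0])
    (use c in \<open>auto simp: nn_integral_density nn_integral_distr nn_integral_cmult ennreal_power\<close>)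

text \<open>Nonnegativity allows Tonelli and scaling to be used with extended values before any
  integral is known to be finite.\<close>

locale homogeneous =
  fixes h :: "'a::euclidean_space \<Rightarrow> real" and d :: nat
  assumes meas [measurable]: "h \<in> borel_measurable borel" and nonneg: "\<And>x. 0 \<le> h x"
    and homog: "\<And>c x. 0 < c \<Longrightarrow> h (c *\<^sub>R x) = c ^ d * h x"
begin

definition ball_integral :: "real \<Rightarrow> ennreal" where
  "ball_integral s = (\<integral>\<^sup>+x. indicator (ball 0 s) x * ennreal (h x) \<partial>lborel)"

lemma ball_integral_scale: "0 < s \<Longrightarrow> ball_integral s = ennreal (s ^ (DIM('a) + d)) * ball_integral 1"
proof -
  assume s: "0 < s"
  have "ball_integral s = ennreal (s ^ DIM('a)) * (\<integral>\<^sup>+x. indicator (ball 0 s) (s *\<^sub>R x) * ennreal (h (s *\<^sub>R x)) \<partial>lborel)"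
    unfolding ball_integral_def by (rule nn_integral_lborel_scale[OF _ s]) measurable
  also have "(\<integral>\<^sup>+x. indicator (ball 0 s) (s *\<^sub>R x) * ennreal (h (s *\<^sub>R x)) \<partial>lborel) =
      (\<integral>\<^sup>+x. ennreal (s ^ d) * (indicator (ball 0 1) x * ennreal (h x)) \<partial>lborel)"
    using s by (intro nn_integral_cong) (auto simp: indicator_def homog ennreal_mult nonneg)
  also have "\<dots> = ennreal (s ^ d) * ball_integral 1"
    unfolding ball_integral_def by (rule nn_integral_cmult) measurable
  finally show ?thesis
    using s by (simp add: power_add ennreal_mult mult.assoc)
qed

text \<open>Layer cake in place of polar coordinates: a weight of the form \<integral> of
  \<open>k\<close> over \<open>{norm x<..}\<close> is a superposition of indicators of balls, and
  the integral of \<open>h\<close> over a ball of radius \<open>s\<close> is a pure power of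
  \<open>s\<close>. It is applied to the Gaussian density, the paraboloid and the cone
  \<open>1 - norm x\<close>.\<close>

lemma radial_integral:
  assumes [measurable]: "k \<in> borel_measurable borel"
  shows "(\<integral>\<^sup>+x. ennreal (h x) * (\<integral>\<^sup>+s. k s * indicator {norm x<..} s \<partial>lborel) \<partial>lborel) =
    (\<integral>\<^sup>+s. k s * ennreal (s ^ (DIM('a) + d)) * indicator {0<..} s \<partial>lborel) * ball_integral 1"
proof -
  have "(\<integral>\<^sup>+x. ennreal (h x) * (\<integral>\<^sup>+s. k s * indicator {norm x<..} s \<partial>lborel) \<partial>lborel) =
     (\<integral>\<^sup>+x. \<integral>\<^sup>+s. ennreal (h x) * (k s * (if norm x < s then 1 else 0)) \<partial>lborel \<partial>lborel)"
  proof (rule nn_integral_cong)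
    fix x
    show "ennreal (h x) * (\<integral>\<^sup>+s. k s * indicator {norm x<..} s \<partial>lborel) = (\<integral>\<^sup>+s. ennreal (h x) * (k s * (if norm x < s then 1 else 0)) \<partial>lborel)"
      by (subst nn_integral_cmult[symmetric]) (auto intro!: nn_integral_cong simp: indicator_def)
  qed
  also have "\<dots> = (\<integral>\<^sup>+s. \<integral>\<^sup>+x. ennreal (h x) * (k s * (if norm x < s then 1 else 0)) \<partial>lborel \<partial>lborel)"
    by (rule lborel_pair.Fubini') measurable
  also have "\<dots> = (\<integral>\<^sup>+s. (k s * ennreal (s ^ (DIM('a) + d)) * indicator {0<..} s) * ball_integral 1 \<partial>lborel)"
  proof (rule nn_integral_cong)
    fix s :: real
    have "(\<integral>\<^sup>+x. ennreal (h x) * (k s * (if norm x < s then 1 else 0)) \<partial>lborel) = (\<integral>\<^sup>+x. k s * (indicator (ball 0 s) x * ennreal (h x)) \<partial>lborel)"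
      by (intro nn_integral_cong) (auto simp: indicator_def mult.commute)
    also have "\<dots> = k s * ball_integral s"
      unfolding ball_integral_def by (rule nn_integral_cmult) measurable
    also have "\<dots> = (k s * ennreal (s ^ (DIM('a) + d)) * indicator {0<..} s) * ball_integral 1"
    proof (cases "0 < s")
      case True
      then show ?thesis using ball_integral_scale[OF True] by (simp add: mult.assoc)
    next
      case False
      then have e: "ball (0::'a) s = {}" by simp
      show ?thesis using False unfolding ball_integral_def e by simp
    qed
    finally show "(\<integral>\<^sup>+x. ennreal (h x) * (k s * (if norm x < s then 1 else 0)) \<partial>lborel) = (k s * ennreal (s ^ (DIM('a) + d)) * indicator {0<..} s) * ball_integral 1" .
  qed
  also have "\<dots> = (\<integral>\<^sup>+s. k s * ennreal (s ^ (DIM('a) + d)) * indicator {0<..} s \<partial>lborel) * ball_integral 1"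
    by (rule nn_integral_multc) simp
  finally show ?thesis .
qed

end

section \<open>Radial weights as layers, and explicit integrals over balls\<close>

lemma nn_integral_Ioi_Ici:
  "(\<integral>\<^sup>+s. k s * indicator {a<..} s \<partial>lborel) = (\<integral>\<^sup>+s. k s * indicator {a..} s \<partial>(lborel :: real measure))"
  using AE_lborel_singleton[of a] by (intro nn_integral_cong_AE) (auto simp: indicator_def elim: eventually_mono)

lemma gdens_layer:
  fixes x :: "'a::euclidean_space"
  shows "(\<integral>\<^sup>+s. ennreal (gdens (0::'a) * (s * exp (- (s\<^sup>2 / 2)))) * indicator {norm x<..} s \<partial>lborel) = ennreal (gdens x)"
proof -
  have "(\<integral>\<^sup>+s. ennreal (gdens (0::'a) * (s * exp (- (s\<^sup>2 / 2)))) * indicator {norm x..} s \<partial>lborel) =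
    ennreal (0 - - (gdens (0::'a) * exp (- ((norm x)\<^sup>2 / 2))))"
  proof (rule nn_integral_FTC_atLeast[where F="\<lambda>s. - (gdens (0::'a) * exp (- (s\<^sup>2 / 2)))"])
    show "((\<lambda>s. - (gdens (0::'a) * exp (- (s\<^sup>2 / 2)))) has_real_derivative gdens (0::'a) * (s * exp (- (s\<^sup>2 / 2)))) (at s)" for s
      by (rule derivative_eq_intros refl | simp)+
    have "((\<lambda>s::real. exp (- (s\<^sup>2 / 2))) \<longlongrightarrow> 0) at_top" by real_asymp
    from tendsto_mult_left[OF this, of "- gdens (0::'a)"]
    show "((\<lambda>s. - (gdens (0::'a) * exp (- (s\<^sup>2 / 2)))) \<longlongrightarrow> 0) at_top" by simp
    show "0 \<le> gdens (0::'a) * (s * exp (- (s\<^sup>2 / 2)))" if "norm x \<le> s" for s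
      using that order_trans[OF norm_ge_zero that] by simp
  qed simp
  then show ?thesis unfolding nn_integral_Ioi_Ici by (simp add: gdens_def)
qed

lemma paraboloid_layer:
  assumes r: "0 < r"
  shows "(\<integral>\<^sup>+s. ennreal (2 * s * indicator {..r} s) * indicator {norm x<..} s \<partial>lborel) = ennreal (paraboloid r x)"
proof (cases "norm x \<le> r")
  case True
  have "(\<integral>\<^sup>+s. ennreal (2 * s * indicator {..r} s) * indicator {norm x..} s \<partial>lborel) = (\<integral>\<^sup>+s. ennreal (2 * s) * indicator {norm x..r} s \<partial>lborel)"
    by (intro nn_integral_cong) (auto simp: indicator_def)
  also have "\<dots> = ennreal (r\<^sup>2 - (norm x)\<^sup>2)"
  proof (rule nn_integral_FTC_Icc[where F="\<lambda>s. s\<^sup>2"])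
    show "((\<lambda>s. s\<^sup>2) has_real_derivative 2 * s) (at s)" for s :: real
      by (rule derivative_eq_intros refl | simp)+
    show "0 \<le> 2 * s" if "s \<in> {norm x..r}" for s using that order_trans[OF norm_ge_zero] by auto
  qed (use True in auto)
  finally show ?thesis
    using True power_mono[OF True, of 2] unfolding nn_integral_Ioi_Ici by (simp add: paraboloid_def)
next
  case False
  then have "(\<lambda>s. ennreal (2 * s * indicator {..r} s) * indicator {norm x<..} s) = (\<lambda>s. 0)"
    by (auto simp: indicator_def)
  then show ?thesis using False r by (simp add: paraboloid_outside)
qed

lemma cone_layer: "(\<integral>\<^sup>+s. indicator {..<1} s * indicator {norm x<..} s \<partial>lborel) = ennreal (1 - norm x)"
proof -
  have "(\<integral>\<^sup>+s. indicator {..<1} s * indicator {norm x<..} s \<partial>lborel) = (\<integral>\<^sup>+s. indicator {norm x<..<1} s \<partial>lborel)"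
    by (intro nn_integral_cong) (auto simp: indicator_def)
  also have "\<dots> = ennreal (1 - norm x)"
    by (cases "norm x \<le> 1") (auto simp: ennreal_neg)
  finally show ?thesis .
qed

lemma nn_integral_power: "0 < r \<Longrightarrow> (\<integral>\<^sup>+s. ennreal (s ^ n) * indicator {0..r} s \<partial>lborel) = ennreal (r ^ Suc n / Suc n)"
proof -
  assume r: "0 < r"
  have "(\<integral>\<^sup>+s. ennreal (s ^ n) * indicator {0..r} s \<partial>lborel) = ennreal (r ^ Suc n / Suc n - 0 ^ Suc n / Suc n)"
  proof (rule nn_integral_FTC_Icc[where F="\<lambda>s. s ^ Suc n / Suc n"])
    show "((\<lambda>s. s ^ Suc n / Suc n) has_real_derivative s ^ n) (at s)" for s :: real
      using DERIV_cdivide[OF DERIV_pow[of "Suc n" s], of "Suc n"] by (simp del: power_Suc)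
  qed (use r in auto)
  then show ?thesis by simp
qed

interpretation one: homogeneous "\<lambda>x::'a::euclidean_space. 1" 0
  by unfold_locales auto

interpretation norm: homogeneous "norm :: 'a::euclidean_space \<Rightarrow> real" 1
  by unfold_locales auto

lemma one_ball: "one.ball_integral TYPE('a::euclidean_space) 1 = ennreal (measure lborel (ball (0::'a) 1))"
  using emeasure_lborel_ball_finite[of "0::'a" 1]
  by (simp add: one.ball_integral_def emeasure_eq_ennreal_measure less_top[symmetric] nn_integral_cmult_indicator)

lemma ball_measure_pos: "0 < measure lborel (ball (0::'a::euclidean_space) 1)"
  using content_ball_pos[of 1 "0::'a"] by simp

lemma integral_paraboloid:
  assumes r: "0 < r"
  shows "(\<integral>x. paraboloid r (x::'a::euclidean_space) \<partial>lborel) = 2 * r ^ (DIM('a) + 2) / (DIM('a) + 2) * measure lborel (ball (0::'a) 1)"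
proof -
  let ?V = "measure lborel (ball (0::'a) 1)"
  have "(\<integral>\<^sup>+x. ennreal (paraboloid r (x::'a)) \<partial>lborel) =
     (\<integral>\<^sup>+s. ennreal (2 * s * indicator {..r} s) * ennreal (s ^ (DIM('a) + 0)) * indicator {0<..} s \<partial>lborel) * ennreal ?V"
    using one.radial_integral[of "\<lambda>s. ennreal (2 * s * indicator {..r} s)", where 'a='a]
    by (simp add: paraboloid_layer[OF r] one_ball)
  also have "(\<integral>\<^sup>+s. ennreal (2 * s * indicator {..r} s) * ennreal (s ^ (DIM('a) + 0)) * indicator {0<..} s \<partial>lborel) =
     (\<integral>\<^sup>+s. ennreal 2 * (ennreal (s ^ (DIM('a) + 1)) * indicator {0..r} s) \<partial>lborel)"
    by (intro nn_integral_cong) (auto simp: indicator_def ennreal_mult[symmetric] mult_ac simp del: ennreal_numeral)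
  also have "\<dots> = ennreal (2 * r ^ (DIM('a) + 2) / (DIM('a) + 2))"
    using nn_integral_power[OF r, of "DIM('a) + 1"] r
    by (simp add: nn_integral_cmult ennreal_mult[symmetric] mult.commute del: ennreal_numeral power_Suc)
  finally have "(\<integral>\<^sup>+x. ennreal (paraboloid r (x::'a)) \<partial>lborel) = ennreal (2 * r ^ (DIM('a) + 2) / (DIM('a) + 2) * ?V)"
    using r by (simp add: ennreal_mult[symmetric])
  then show ?thesis
    using r by (subst integral_eq_nn_integral) (auto simp: paraboloid_bounds)
qed

text \<open>The norm increases with the radius, so the layer formula is applied to the decreasing
  cone \<open>1 - norm x\<close>, and the result is subtracted from the volume of the ball.\<close>

lemma integral_norm_ball:
  "(\<integral>x. indicator (ball 0 1) x * norm (x::'a::euclidean_space) \<partial>lborel) = DIM('a) / (DIM('a) + 1) * measure lborel (ball (0::'a) 1)"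
proof -
  let ?V = "measure lborel (ball (0::'a) 1)"
  have "(\<integral>\<^sup>+x. ennreal (1 - norm (x::'a)) \<partial>lborel) =
     (\<integral>\<^sup>+s. indicator {..<1} s * ennreal (s ^ (DIM('a) + 0)) * indicator {0<..} s \<partial>lborel) * ennreal ?V"
    using one.radial_integral[of "indicator {..<1}", where 'a='a] by (simp add: cone_layer one_ball)
  also have "(\<integral>\<^sup>+s. indicator {..<1} s * ennreal (s ^ (DIM('a) + 0)) * indicator {0<..} s \<partial>lborel) =
     (\<integral>\<^sup>+s. ennreal (s ^ DIM('a)) * indicator {0..1} s \<partial>lborel)"
  proof (rule nn_integral_cong_AE)
    show "AE s in lborel. indicator {..<1} s * ennreal (s ^ (DIM('a) + 0)) * indicator {0<..} s = ennreal (s ^ DIM('a)) * indicator {0..1} s"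
      using AE_lborel_singleton[of "0::real"] AE_lborel_singleton[of "1::real"]
      by eventually_elim (auto simp: indicator_def)
  qed
  also have "\<dots> = ennreal (1 / (DIM('a) + 1))"
    using nn_integral_power[of 1 "DIM('a)"] by (simp add: add.commute)
  finally have 1: "(\<integral>\<^sup>+x. ennreal (1 - norm (x::'a)) \<partial>lborel) = ennreal (1 / (DIM('a) + 1) * ?V)"
    by (simp add: ennreal_mult[symmetric])
  have i1: "integrable lborel (\<lambda>x::'a. indicator (ball 0 1) x * norm x)"
    by (rule integrable_bounded_ball[where r=1 and B=1]) (auto simp: indicator_def)
  have i0: "integrable lborel (\<lambda>x::'a. indicator (ball 0 1) x :: real)"
    using emeasure_lborel_ball_finite[of "0::'a" 1] by auto
  have "(\<integral>x. indicator (ball 0 1) x - indicator (ball 0 1) x * norm (x::'a) \<partial>lborel) = 1 / (DIM('a) + 1) * ?V"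
  proof (subst integral_eq_nn_integral)
    have "(\<integral>\<^sup>+x. ennreal (indicator (ball 0 1) x - indicator (ball 0 1) x * norm (x::'a)) \<partial>lborel) = (\<integral>\<^sup>+x. ennreal (1 - norm (x::'a)) \<partial>lborel)"
      by (intro nn_integral_cong) (auto simp: indicator_def ennreal_neg)
    then show "enn2real (\<integral>\<^sup>+x. ennreal (indicator (ball 0 1) x - indicator (ball 0 1) x * norm (x::'a)) \<partial>lborel) = 1 / (DIM('a) + 1) * ?V"
      by (simp add: 1)
  qed (auto simp: indicator_def)
  then have "?V - (\<integral>x. indicator (ball 0 1) x * norm (x::'a) \<partial>lborel) = 1 / (DIM('a) + 1) * ?V"
    using i0 i1 by simp
  then show ?thesis by (simp add: field_simps)
qed

text \<open>The radial factor does not depend on \<open>h\<close>. Hence for functions of degree one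
  the Gaussian integral and the ball integral are proportional with a common constant, which can be
  eliminated by comparing with the norm.\<close>

lemma homogeneous_gauss:
  fixes h :: "'a::euclidean_space \<Rightarrow> real"
  assumes "homogeneous h 1"
  shows "(\<integral>\<^sup>+x. ennreal (h x) \<partial>gauss) =
    (\<integral>\<^sup>+s. ennreal (gdens (0::'a) * (s * exp (- (s\<^sup>2 / 2)))) * ennreal (s ^ (DIM('a) + 1)) * indicator {0<..} s \<partial>lborel)
      * (\<integral>\<^sup>+x. indicator (ball 0 1) x * ennreal (h x) \<partial>lborel)"
proof -
  interpret homogeneous h 1 by fact
  have "(\<integral>\<^sup>+x. ennreal (h x) \<partial>gauss) = (\<integral>\<^sup>+x. ennreal (h x) * ennreal (gdens x) \<partial>lborel)"
    by (subst nn_integral_gauss) (auto simp: mult.commute)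
  then show ?thesis
    using radial_integral[of "\<lambda>s. ennreal (gdens (0::'a) * (s * exp (- (s\<^sup>2 / 2))))"]
    by (simp add: gdens_layer ball_integral_def)
qed

section \<open>Comparison of ball integrals with Gaussian means\<close>

lemma integrable_norm_gauss: "integrable gauss (\<lambda>z::'a::euclidean_space. norm z)"
  using exp_growth_integrable[OF exp_growth_lin[OF lin_growth_norm[OF lin_growth_snd]]] .

text \<open>Machin's formula together with \<open>arctan (1 / 5) \<le> 1 / 5\<close>. The use made
  of it is \<open>9 / 16 \<le> 2 / pi\<close>, that is \<open>pi \<le> 32 / 9\<close>, so the crude
  estimate suffices.\<close>

lemma pi_le: "pi \<le> 16 / 5"
proof -
  have "arctan (1 / 5) \<le> 1 / 5" by (rule arctan_le_self) simp
  moreover have "0 \<le> arctan (1 / 239)" by simp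
  ultimately show ?thesis using pi_machin by linarith
qed

text \<open>By Cauchy-Schwarz the l1 norm is at most sqrt n times the Euclidean norm, and its
  Gaussian mean is \<open>n * sqrt (2 / pi)\<close>. The value 3/4 is the least constant for which
  the later inequality \<open>n * (n + 2) \<le> 2 * sqrt n * (3 / 4 * sqrt n) * (n + 1)\<close>
  holds for all dimensions; \<open>n = 1\<close> gives equality.\<close>

lemma integral_norm_gauss_ge: "3 / 4 * sqrt (DIM('a)) \<le> (\<integral>x. norm (x::'a::euclidean_space) \<partial>gauss)"
proof -
  have abs1: "(\<integral>s. \<bar>s\<bar> \<partial>gauss) = sqrt (2 / pi)"
    using integral_std_normal_moment_abs_odd[of 0] by (subst integral_gauss) (auto simp: gdens_real)
  have ia: "integrable gauss (\<lambda>x::'a. \<bar>x \<bullet> b\<bar>)" for b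
    using exp_growth_integrable[OF exp_growth_abs[OF exp_growth_inner]] .
  have coord: "(\<integral>x. \<bar>(x::'a) \<bullet> b\<bar> \<partial>gauss) = sqrt (2 / pi)" if b: "b \<in> Basis" for b
  proof -
    have "(\<integral>\<^sup>+x. ennreal \<bar>(x::'a) \<bullet> b\<bar> \<partial>gauss) = (\<integral>\<^sup>+s. ennreal \<bar>s\<bar> \<partial>gauss)"
      using gauss_on_line[OF b, of "\<lambda>x. ennreal \<bar>x \<bullet> b\<bar>"] by (simp add: on_line_inner[OF b] gauss.emeasure_space_1[simplified])
    then show ?thesis
      unfolding abs1[symmetric] by (subst (1 2) integral_eq_nn_integral) auto
  qed
  have l1: "(\<Sum>b\<in>Basis. \<bar>x \<bullet> b\<bar>) \<le> sqrt (DIM('a)) * norm x" for x :: 'a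
  proof (rule power2_le_imp_le)
    have "(\<Sum>b\<in>Basis. \<bar>x \<bullet> b\<bar>)\<^sup>2 \<le> (\<Sum>b\<in>Basis. \<bar>x \<bullet> b\<bar>\<^sup>2) * DIM('a)"
      by (rule sum_squared_le_sum_of_squares)
    also have "(\<Sum>b\<in>Basis. \<bar>x \<bullet> b\<bar>\<^sup>2) = (norm x)\<^sup>2"
      unfolding power2_norm_eq_inner euclidean_inner[of x x] by (simp add: power2_eq_square)
    finally show "(\<Sum>b\<in>Basis. \<bar>x \<bullet> b\<bar>)\<^sup>2 \<le> (sqrt (DIM('a)) * norm x)\<^sup>2"
      by (simp add: power_mult_distrib mult.commute)
  qed simp
  have "DIM('a) * sqrt (2 / pi) = (\<integral>x. (\<Sum>b\<in>Basis. \<bar>(x::'a) \<bullet> b\<bar>) \<partial>gauss)"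
    using ia coord by (simp add: Bochner_Integration.integral_sum)
  also have "\<dots> \<le> (\<integral>x. sqrt (DIM('a)) * norm (x::'a) \<partial>gauss)"
    using ia integrable_norm_gauss l1 by (intro integral_mono Bochner_Integration.integrable_sum) auto
  finally have "sqrt (DIM('a)) * (sqrt (DIM('a)) * sqrt (2 / pi)) \<le> sqrt (DIM('a)) * (\<integral>x. norm (x::'a) \<partial>gauss)"
    by (simp flip: mult.assoc)
  then have E: "sqrt (DIM('a)) * sqrt (2 / pi) \<le> (\<integral>x. norm (x::'a) \<partial>gauss)"
    by simp
  have "9 / 16 \<le> 2 / pi" using pi_le pi_gt_zero by (simp add: field_simps)
  then have "sqrt (9 / 16) \<le> sqrt (2 / pi)" by (rule real_sqrt_le_mono)
  moreover have "sqrt (9 / 16) = 3 / 4" by (rule real_sqrt_unique) (auto simp: power2_eq_square)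
  ultimately have "3 / 4 \<le> sqrt (2 / pi)" by linarith
  then have "sqrt (DIM('a)) * (3 / 4) \<le> sqrt (DIM('a)) * sqrt (2 / pi)" by (rule mult_left_mono) simp
  then show ?thesis using E by linarith
qed

text \<open>Both integrals of the homogeneous function are compared with those of the norm.\<close>
lemma ball_integral_le_gauss_integral:
  fixes h :: "'a::euclidean_space \<Rightarrow> real"
  assumes [measurable]: "h \<in> borel_measurable borel"
    and bd: "\<And>x. \<bar>h x\<bar> \<le> L * norm x" and hom: "\<And>c x. 0 < c \<Longrightarrow> h (c *\<^sub>R x) = c * h x"
    and J0: "0 \<le> (\<integral>x. h x \<partial>gauss)" and r: "0 < r"
  shows "2 * (\<integral>x. indicator (ball 0 r) x * h x \<partial>lborel) \<le>
     2 * sqrt (DIM('a)) / r * (\<integral>x. h x \<partial>gauss) * (\<integral>x. paraboloid r (x::'a) \<partial>lborel)"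
    and "integrable lborel (\<lambda>x. indicator (ball 0 r) x * h x)"
    and "integrable gauss h"
proof -
  \<comment> \<open>\<open>h\<close> may take negative values, while the layer formula is for
    nonnegative functions. Adding \<open>L * norm x\<close> keeps the degree of homogeneity, and the
    contribution of the norm is subtracted again from each identity.\<close>
  define g where "g x = h x + L * norm x" for x
  have [measurable]: "g \<in> borel_measurable borel" unfolding g_def by measurable
  have g0: "0 \<le> g x" for x using bd[of x] by (simp add: g_def abs_le_iff)
  interpret g: homogeneous g 1
    by unfold_locales (auto simp: g_def hom distrib_left mult.left_commute intro: g0[unfolded g_def])
  obtain b :: 'a where b: "b \<in> Basis" using nonempty_Basis by blast
  have L: "0 \<le> L" using order_trans[OF abs_ge_zero bd[of b]] b by simp
  show ih: "integrable gauss h"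
    by (rule Bochner_Integration.integrable_bound[OF integrable_mult_right[OF integrable_norm_gauss, of L]])
      (use bd L in auto)
  have ihb: "integrable lborel (\<lambda>x. indicator (ball 0 s) x * h x)" and inb: "integrable lborel (\<lambda>x::'a. indicator (ball 0 s) x * norm x)"
    if s: "0 < s" for s
  proof -
    show "integrable lborel (\<lambda>x. indicator (ball 0 s) x * h x)"
    proof (rule integrable_bounded_ball[where r=s])
      show "\<bar>indicator (ball 0 s) x * h x\<bar> \<le> L * s" if "norm x < s" for x
        using that order_trans[OF bd mult_left_mono[OF less_imp_le[OF that] L]] by (simp add: abs_mult)
    qed auto
    show "integrable lborel (\<lambda>x::'a. indicator (ball 0 s) x * norm x)"
      by (rule integrable_bounded_ball[where r=s and B=s]) auto
  qed
  show "integrable lborel (\<lambda>x. indicator (ball 0 r) x * h x)" by (rule ihb[OF r])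
  define A where "A s = (\<integral>x. indicator (ball 0 s) x * h x \<partial>lborel)" for s
  define N where "N s = (\<integral>x. indicator (ball 0 s) x * norm (x::'a) \<partial>lborel)" for s
  define J where "J = (\<integral>x. h x \<partial>gauss)"
  define E where "E = (\<integral>x. norm (x::'a) \<partial>gauss)"
  have N0: "0 \<le> N s" for s unfolding N_def by (simp add: integral_nonneg_AE)
  have gi: "(\<integral>x. indicator (ball 0 s) x * g x \<partial>lborel) = A s + L * N s"
    and gint: "integrable lborel (\<lambda>x. indicator (ball 0 s) x * g x)" if "0 < s" for s
    using ihb[OF that] inb[OF that] integrable_mult_right[OF inb[OF that], of L]
    by (simp_all add: g_def A_def N_def distrib_left mult.left_commute[of _ L])
  have A0: "0 \<le> A s + L * N s" if "0 < s" for s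
    unfolding gi[OF that, symmetric] by (simp add: integral_nonneg_AE g0)
  have bg: "g.ball_integral s = ennreal (A s + L * N s)" if s: "0 < s" for s
  proof -
    have "g.ball_integral s = (\<integral>\<^sup>+x. ennreal (indicator (ball 0 s) x * g x) \<partial>lborel)"
      unfolding g.ball_integral_def by (intro nn_integral_cong) (auto simp: indicator_def)
    then show ?thesis
      using gint[OF s] g0 unfolding gi[OF s, symmetric] by (simp add: nn_integral_eq_integral)
  qed
  have bn: "norm.ball_integral TYPE('a) s = ennreal (N s)" if s: "0 < s" for s
  proof -
    have "norm.ball_integral TYPE('a) s = (\<integral>\<^sup>+x. ennreal (indicator (ball 0 s) x * norm (x::'a)) \<partial>lborel)"
      unfolding norm.ball_integral_def by (intro nn_integral_cong) (auto simp: indicator_def)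
    then show ?thesis
      using inb[OF s] unfolding N_def by (simp add: nn_integral_eq_integral)
  qed
  have "N r = r ^ (DIM('a) + 1) * N 1"
    using norm.ball_integral_scale[OF r, where 'a='a] bn[of 1] bn[OF r] r N0
    by (simp add: ennreal_mult[symmetric] del: power_Suc)
  moreover have "A r + L * N r = r ^ (DIM('a) + 1) * (A 1 + L * N 1)"
    using g.ball_integral_scale[OF r] bg[of 1] bg[OF r] r A0[of 1] A0[OF r]
    by (simp add: ennreal_mult[symmetric] del: power_Suc)
  ultimately have Ar: "A r = r ^ (DIM('a) + 1) * A 1" by (simp add: algebra_simps)
  define \<kappa> where "\<kappa> = (\<integral>\<^sup>+s. ennreal (gdens (0::'a) * (s * exp (- (s\<^sup>2 / 2)))) * ennreal (s ^ (DIM('a) + 1)) * indicator {0<..} s \<partial>lborel)"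
  let ?V = "measure lborel (ball (0::'a) 1)"
  have N1: "N 1 = DIM('a) / (DIM('a) + 1) * ?V"
    unfolding N_def by (rule integral_norm_ball)
  have N1_pos: "0 < N 1" unfolding N1 using ball_measure_pos[where 'a='a] by simp
  have E0: "0 \<le> E" unfolding E_def by (simp add: integral_nonneg_AE)
  have \<kappa>E: "ennreal E = \<kappa> * ennreal (N 1)"
    using homogeneous_gauss[OF norm.homogeneous_axioms, where 'a='a] bn[of 1] integrable_norm_gauss[where 'a='a]
    by (simp add: \<kappa>_def norm.ball_integral_def E_def nn_integral_eq_integral)
  have "\<kappa> \<noteq> \<infinity>"
    using \<kappa>E N1_pos by (auto simp: ennreal_top_mult)
  \<comment> \<open>The common radial factor is finite because the Gaussian mean of the norm is
    finite and its ball integral is positive.\<close>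
  then obtain k where k: "\<kappa> = ennreal k" "0 \<le> k" by (cases \<kappa>) auto
  have E: "E = k * N 1"
    using \<kappa>E k E0 N1_pos by (simp add: ennreal_mult[symmetric])
  have ig: "integrable gauss g" "(\<integral>x. g x \<partial>gauss) = J + L * E"
    using ih integrable_norm_gauss[where 'a='a] by (auto simp: g_def[abs_def] J_def E_def)
  have JE0: "0 \<le> J + L * E" unfolding ig(2)[symmetric] by (simp add: integral_nonneg_AE g0)
  have "ennreal (J + L * E) = \<kappa> * ennreal (A 1 + L * N 1)"
    using homogeneous_gauss[OF g.homogeneous_axioms] bg[of 1] ig g0
    by (simp add: \<kappa>_def g.ball_integral_def nn_integral_eq_integral)
  then have "J + L * E = k * (A 1 + L * N 1)"
    using k JE0 A0[of 1] by (simp add: ennreal_mult[symmetric])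
  then have J: "J = k * A 1" by (simp add: E algebra_simps)
  let ?n = "real DIM('a)"
  have n: "1 \<le> ?n" using DIM_positive[where 'a='a] by linarith
  have V: "0 < ?V" by (rule ball_measure_pos)
  have Eg: "3 / 4 * sqrt ?n \<le> E" unfolding E_def by (rule integral_norm_gauss_ge)
  have "0 < sqrt ?n" using n by simp
  then have E_pos: "0 < E" using Eg by linarith
  \<comment> \<open>Eliminates the factor \<open>k\<close>: ball integral and Gaussian mean of
    \<open>h\<close> are in the same ratio as those of the norm.\<close>
  have A1: "A 1 * E = J * N 1" by (simp add: J E)
  have "2 * A r * E = 2 * r ^ (DIM('a) + 1) * J * (?n / (?n + 1) * ?V)"
  proof -
    have "2 * A r * E = 2 * r ^ (DIM('a) + 1) * (A 1 * E)" unfolding Ar by (simp only: mult_ac)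
    also have "\<dots> = 2 * r ^ (DIM('a) + 1) * J * (?n / (?n + 1) * ?V)"
      unfolding A1 N1 by (simp only: mult.assoc of_nat_add of_nat_1)
    finally show ?thesis .
  qed
  also have "\<dots> \<le> (2 * sqrt ?n / r * J * (2 * r ^ (DIM('a) + 2) / (?n + 2) * ?V)) * E"
  proof -
    \<comment> \<open>After cancelling \<open>?n\<close> this is
      \<open>2 * (?n + 2) \<le> 3 * (?n + 1)\<close>, which is the condition
      \<open>1 \<le> ?n\<close>.\<close>
    have "?n * (?n + 2) \<le> 2 * sqrt ?n * (3 / 4 * sqrt ?n) * (?n + 1)"
      using n by (simp add: algebra_simps)
    also have "\<dots> \<le> 2 * sqrt ?n * E * (?n + 1)"
      using Eg n by (intro mult_right_mono mult_left_mono) auto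
    finally have "?n / (?n + 1) \<le> 2 * sqrt ?n * E / (?n + 2)"
      using n by (simp add: field_simps)
    then have "2 * r ^ (DIM('a) + 1) * J * ?V * (?n / (?n + 1)) \<le> 2 * r ^ (DIM('a) + 1) * J * ?V * (2 * sqrt ?n * E / (?n + 2))"
      using J0 V r by (intro mult_left_mono) (auto simp: J_def)
    then show ?thesis using r by (simp add: field_simps)
  qed
  finally have le: "2 * A r \<le> 2 * sqrt ?n / r * J * (2 * r ^ (DIM('a) + 2) / (?n + 2) * ?V)"
    using E_pos by (rule mult_right_le_imp_le)
  have P: "(\<integral>x. paraboloid r (x::'a) \<partial>lborel) = 2 * r ^ (DIM('a) + 2) / (?n + 2) * ?V"
    unfolding integral_paraboloid[OF r] by simp
  from le show "2 * (\<integral>x. indicator (ball 0 r) x * h x \<partial>lborel) \<le> 2 * sqrt ?n / r * (\<integral>x. h x \<partial>gauss) * (\<integral>x. paraboloid r (x::'a) \<partial>lborel)"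
    unfolding P A_def J_def .
qed

section \<open>Gaussian width and Wasserstein distance\<close>

lemma emeasure_gauss_open_pos:
  assumes "open U" "x \<in> U"
  shows "emeasure gauss (U :: 'a::euclidean_space set) \<noteq> 0"
proof
  assume z: "emeasure gauss U = 0"
  have U: "U \<in> sets borel" using assms by simp
  then have "U \<in> null_sets gauss" using z by (simp add: null_sets_def)
  then have "AE y in lborel. y \<in> U \<longrightarrow> ennreal (gdens y) = 0"
    unfolding gauss_eq by (subst (asm) null_sets_density_iff) auto
  then have ae: "AE y in lborel. y \<notin> U"
    by (rule eventually_mono) (metis ennreal_eq_0_iff gdens_pos not_le)
  obtain e where e: "0 < e" "ball x e \<subseteq> U" using assms openE by blast
  have "AE y in lborel. y \<notin> ball x e" using ae by (rule eventually_mono) (use e(2) in blast)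
  then have "emeasure lborel (ball x e) = 0"
    using AE_iff_measurable[of "ball x e" lborel "\<lambda>y. y \<notin> ball x e"] by (auto simp: ball_def)
  then show False using content_ball_pos[OF e(1), of x] by (simp add: measure_def)
qed

text \<open>If \<open>y\<^sub>k \<in> K\<close> tends to infinity in the direction \<open>\<theta>\<close>, the supremum is infinite on the half space \<open>\<theta> \<bullet> g > 0\<close>.\<close>
lemma gaussian_width_unbounded:
  assumes "\<not> bounded K"
  shows "gaussian_width (K :: 'a::euclidean_space set) = \<infinity>"
proof -
  have "\<exists>y\<in>K. real (Suc k) < norm y" for k
    using assms unfolding bounded_iff by (auto simp: not_le)
  then obtain y where y: "\<And>k. y k \<in> K" "\<And>k. real (Suc k) < norm (y k)" by metis
  define u where "u k = y k /\<^sub>R norm (y k)" for k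
  have ny: "0 < norm (y k)" for k
    using y(2)[of k] of_nat_0_le_iff[of "Suc k", where 'a=real] by linarith
  have "u k \<in> sphere 0 1" for k
    using ny[of k] by (simp add: u_def)
  then obtain \<theta> \<sigma> where \<theta>: "\<theta> \<in> sphere 0 1" "strict_mono \<sigma>" "(u \<circ> \<sigma>) \<longlonglongrightarrow> \<theta>"
    using compact_sphere[of "0::'a" 1] unfolding compact_def by metis
  let ?H = "{g. 0 < \<theta> \<bullet> g}"
  have sup: "(SUP x\<in>K. ereal (x \<bullet> g)) = \<infinity>" if g: "g \<in> ?H" for g
  proof (rule SUP_PInfty)
    fix n :: nat
    have "filterlim (\<lambda>k. norm (y (\<sigma> k))) at_top sequentially"
    proof (rule filterlim_at_top_mono[OF filterlim_real_sequentially])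
      show "\<forall>\<^sub>F k in sequentially. real k \<le> norm (y (\<sigma> k))"
      proof (intro always_eventually allI)
        fix k
        show "real k \<le> norm (y (\<sigma> k))"
          using y(2)[of "\<sigma> k"] seq_suble[OF \<theta>(2), of k] by linarith
      qed
    qed
    moreover have "(\<lambda>k. u (\<sigma> k) \<bullet> g) \<longlonglongrightarrow> \<theta> \<bullet> g"
      using \<theta>(3) by (intro tendsto_inner) (auto simp: comp_def)
    ultimately have "filterlim (\<lambda>k. (u (\<sigma> k) \<bullet> g) * norm (y (\<sigma> k))) at_top sequentially"
      using g by (intro filterlim_tendsto_pos_mult_at_top[of _ "\<theta> \<bullet> g"]) auto
    then have "\<forall>\<^sub>F k in sequentially. real n \<le> (u (\<sigma> k) \<bullet> g) * norm (y (\<sigma> k))"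
      by (simp add: filterlim_at_top)
    then obtain k where "real n \<le> (u (\<sigma> k) \<bullet> g) * norm (y (\<sigma> k))"
      unfolding eventually_sequentially by auto
    then have "real n \<le> y (\<sigma> k) \<bullet> g"
      using ny[of "\<sigma> k"] by (simp add: u_def field_simps)
    then show "\<exists>x\<in>K. ereal (real n) \<le> ereal (x \<bullet> g)" using y(1) by auto
  qed
  have Hm: "?H \<in> sets borel" by measurable
  have "open ?H" by (intro open_Collect_less continuous_intros)
  then have H: "emeasure gauss ?H \<noteq> 0"
    using \<theta>(1) by (intro emeasure_gauss_open_pos[of _ \<theta>]) (auto simp: dot_square_norm)
  have "\<infinity> * emeasure gauss ?H = (\<integral>\<^sup>+g. (\<infinity> :: ennreal) * indicator ?H g \<partial>gauss)"
    using Hm by (simp add: nn_integral_cmult_indicator)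
  also have "\<dots> \<le> (\<integral>\<^sup>+ g. e2ennreal (SUP x\<in>K. ereal (x \<bullet> g)) \<partial>gauss)"
    by (rule nn_integral_mono) (auto simp: indicator_def sup infinity_ennreal_def top_ereal_def)
  finally have P: "(\<integral>\<^sup>+ g. e2ennreal (SUP x\<in>K. ereal (x \<bullet> g)) \<partial>gauss) = \<infinity>"
    using H by (simp add: ennreal_top_mult top_unique)
  \<comment> \<open>The negative part is finite since the supremum is at least the value at the
    single point \<open>y 0\<close>; the width is therefore infinity minus a finite number.\<close>
  have "(\<integral>\<^sup>+ g. e2ennreal (- (SUP x\<in>K. ereal (x \<bullet> g))) \<partial>gauss) \<le> (\<integral>\<^sup>+ g. ennreal (norm (y 0) * norm (g::'a)) \<partial>gauss)"
  proof (rule nn_integral_mono)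
    fix g
    have "ereal (y 0 \<bullet> g) \<le> (SUP x\<in>K. ereal (x \<bullet> g))" using y(1) by (intro SUP_upper) auto
    then have "- (SUP x\<in>K. ereal (x \<bullet> g)) \<le> - ereal (y 0 \<bullet> g)" by (simp add: ereal_uminus_le_reorder)
    also have "\<dots> \<le> ereal (norm (y 0) * norm g)"
      using Cauchy_Schwarz_ineq2[of "y 0" g] by simp
    finally have "e2ennreal (- (SUP x\<in>K. ereal (x \<bullet> g))) \<le> e2ennreal (ereal (norm (y 0) * norm g))"
      by (rule e2ennreal_mono)
    then show "e2ennreal (- (SUP x\<in>K. ereal (x \<bullet> g))) \<le> ennreal (norm (y 0) * norm g)"
      by simp
  qed
  also have "\<dots> < \<infinity>"
    using integrable_mult_right[OF integrable_norm_gauss[where 'a='a], of "norm (y 0)"]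
    by (subst nn_integral_eq_integral) auto
  finally have "(\<integral>\<^sup>+ g. e2ennreal (- (SUP x\<in>K. ereal (x \<bullet> g))) \<partial>gauss) < \<infinity>" .
  then obtain a where "(\<integral>\<^sup>+ g. e2ennreal (- (SUP x\<in>K. ereal (x \<bullet> g))) \<partial>gauss) = ennreal a" "0 \<le> a"
    by (cases "\<integral>\<^sup>+ g. e2ennreal (- (SUP x\<in>K. ereal (x \<bullet> g))) \<partial>gauss") auto
  then show ?thesis
    unfolding gaussian_width_def P by (simp add: enn2ereal_ennreal)
qed

lemma integral_inner_gauss: "(\<integral>x. v \<bullet> (x::'a::euclidean_space) \<partial>gauss) = 0"
  using gauss_parts[of "\<lambda>_. 1" "\<lambda>_. 0" v] by (simp add: exp_growth_const inner_commute)

section \<open>Support function of the gradients, the coupling and the choice of the tilt\<close>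

context bounded_gradient
begin

text \<open>The real-valued supremum is meaningful because the gradients are bounded;
  \<open>supp_ereal\<close> identifies it with the extended supremum inside
  \<open>gaussian_width\<close>.\<close>

definition supp :: "'a \<Rightarrow> real" where
  "supp x = (SUP y. grad f y \<bullet> x)"

lemma grad_inner_bound: "\<bar>grad f y \<bullet> x\<bar> \<le> L * norm x"
  using order_trans[OF Cauchy_Schwarz_ineq2 mult_right_mono[OF grad_bound]] by auto

lemma supp_upper: "grad f y \<bullet> x \<le> supp x"
  unfolding supp_def
  by (rule cSUP_upper) (use grad_inner_bound in \<open>auto intro!: bdd_aboveI2[of _ _ "L * norm x"] dest: abs_le_D1\<close>)

lemma supp_least: "(\<And>y. grad f y \<bullet> x \<le> a) \<Longrightarrow> supp x \<le> a"
  unfolding supp_def by (rule cSUP_least) auto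

lemma supp_bound: "\<bar>supp x\<bar> \<le> L * norm x"
proof -
  have "supp x \<le> L * norm x"
    by (rule supp_least) (use grad_inner_bound abs_le_D1 in blast)
  moreover have "- (L * norm x) \<le> supp x"
    using supp_upper[of 0 x] grad_inner_bound[of 0 x] by linarith
  ultimately show ?thesis by linarith
qed

lemma supp_scale:
  assumes "0 < c" shows "supp (c *\<^sub>R x) = c * supp x"
proof (rule antisym)
  show "supp (c *\<^sub>R x) \<le> c * supp x"
    using assms supp_upper by (intro supp_least) simp
  have "supp x \<le> supp (c *\<^sub>R x) / c"
  proof (rule supp_least)
    show "grad f y \<bullet> x \<le> supp (c *\<^sub>R x) / c" for y
      using supp_upper[of y "c *\<^sub>R x"] assms by (simp add: field_simps)
  qed
  then show "c * supp x \<le> supp (c *\<^sub>R x)" using assms by (simp add: field_simps)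
qed

lemma supp_lipschitz: "\<bar>supp x - supp y\<bar> \<le> L * norm (x - y)"
proof -
  have "supp x \<le> supp y + L * norm (x - y)" for x y
  proof (rule supp_least)
    fix z
    have "grad f z \<bullet> x = grad f z \<bullet> y + grad f z \<bullet> (x - y)" by (simp add: inner_diff_right)
    then show "grad f z \<bullet> x \<le> supp y + L * norm (x - y)"
      using supp_upper[of z y] grad_inner_bound[of z "x - y"] by linarith
  qed
  from this[of x y] this[of y x] show ?thesis by (simp add: norm_minus_commute abs_le_iff)
qed

lemma supp_meas [measurable]: "supp \<in> borel_measurable borel"
proof -
  have "L-lipschitz_on UNIV supp"
    using supp_lipschitz L_nonneg by (intro lipschitz_onI) (auto simp: dist_norm)
  then show ?thesis
    by (intro borel_measurable_continuous_onI lipschitz_on_continuous_on)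
qed

lemma supp_ereal: "(SUP y\<in>range (grad f). ereal (y \<bullet> g)) = ereal (supp g)"
proof (rule SUP_eqI)
  show "ereal (y \<bullet> g) \<le> ereal (supp g)" if "y \<in> range (grad f)" for y
    using that supp_upper by auto
  show "ereal (supp g) \<le> z" if "\<And>y. y \<in> range (grad f) \<Longrightarrow> ereal (y \<bullet> g) \<le> z" for z
    using that supp_least[of g "real_of_ereal z"] by (cases z) auto
qed

lemma supp_integrable: "integrable gauss supp"
  by (rule Bochner_Integration.integrable_bound[OF integrable_mult_right[OF integrable_norm_gauss, of L]])
    (use supp_bound L_nonneg in auto)

lemma grad_complexity_eq: "grad_complexity f = ereal (\<integral>g. supp g \<partial>gauss)"
proof -
  have "(\<integral>\<^sup>+g. ennreal (supp g) \<partial>gauss) < \<infinity>" "(\<integral>\<^sup>+g. ennreal (- supp g) \<partial>gauss) < \<infinity>"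
    using supp_integrable by (auto simp: real_integrable_def less_top)
  then obtain a b where ab: "(\<integral>\<^sup>+g. ennreal (supp g) \<partial>gauss) = ennreal a" "0 \<le> a"
      "(\<integral>\<^sup>+g. ennreal (- supp g) \<partial>gauss) = ennreal b" "0 \<le> b"
    by (cases "\<integral>\<^sup>+g. ennreal (supp g) \<partial>gauss"; cases "\<integral>\<^sup>+g. ennreal (- supp g) \<partial>gauss") auto
  have "(\<integral>g. supp g \<partial>gauss) = a - b"
    using real_lebesgue_integral_def[OF supp_integrable] ab by simp
  then show ?thesis
    using ab by (simp add: grad_complexity_def gaussian_width_def supp_ereal enn2ereal_ennreal)
qed

text \<open>The support function dominates the linear functional given by \<open>grad f 0\<close>,
  which has Gaussian mean zero. The sign is what permits enlarging the numerical factor in front of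
  this integral when balls are compared with the Gaussian.\<close>

lemma integral_supp_nonneg: "0 \<le> (\<integral>g. supp g \<partial>gauss)"
proof -
  have "integrable gauss (\<lambda>g. grad f 0 \<bullet> g)"
    using exp_growth_integrable[OF exp_growth_inner[of "grad f 0"]] by (simp add: inner_commute)
  then have "(\<integral>g. grad f 0 \<bullet> g \<partial>gauss) \<le> (\<integral>g. supp g \<partial>gauss)"
    using supp_integrable supp_upper by (intro integral_mono) auto
  then show ?thesis by (simp add: integral_inner_gauss)
qed

lemma tilt_nu: "tilt (nu_of f) x = density gauss (\<lambda>y. ennreal (tilt_exp x y / mass x))"
proof -
  have [measurable]: "tilt_exp x \<in> borel_measurable borel"
    by (rule exp_growth_measurable[OF tilt_exp_growth])
  have "(\<integral>\<^sup>+z. ennreal (exp (x \<bullet> z)) \<partial>nu_of f) = (\<integral>\<^sup>+z. ennreal (tilt_exp x z) \<partial>gauss)"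
    unfolding nu_of_def by (subst nn_integral_density) (auto simp: tilt_exp_def exp_add ennreal_mult)
  also have "\<dots> = ennreal (mass x)"
    unfolding mass_def using exp_growth_integrable[OF tilt_exp_growth] tilt_exp_pos
    by (intro nn_integral_eq_integral) (auto simp: less_imp_le)
  finally have "tilt (nu_of f) x = density gauss (\<lambda>y. ennreal (exp (f y)) * (ennreal (exp (x \<bullet> y)) / ennreal (mass x)))"
    unfolding tilt_def nu_of_def by (subst density_density_eq[symmetric]) auto
  also have "(\<lambda>y. ennreal (exp (f y)) * (ennreal (exp (x \<bullet> y)) / ennreal (mass x))) = (\<lambda>y. ennreal (tilt_exp x y / mass x))"
    using mass_pos[of x] by (simp add: tilt_exp_def exp_add divide_ennreal ennreal_mult[symmetric])
  finally show ?thesis .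
qed

lemma centroid_inner:
  assumes "b \<in> Basis"
  shows "centroid (tilt (nu_of f) x) \<bullet> b = mean (\<lambda>y. y \<bullet> b) x"
proof -
  have [measurable]: "tilt_exp x \<in> borel_measurable borel"
    by (rule exp_growth_measurable[OF tilt_exp_growth])
  have "exp_growth (\<lambda>_::real. \<lambda>y. norm y * tilt_exp x y)"
    by (intro exp_growth_mult tilt_exp_fixed exp_growth_lin lin_growth_norm lin_growth_snd)
  from exp_growth_integrable[OF this]
  have "integrable gauss (\<lambda>y. norm y * tilt_exp x y)" .
  then have "integrable gauss (\<lambda>y. norm y * tilt_exp x y / mass x)" by simp
  then have i: "integrable gauss (\<lambda>y. (tilt_exp x y / mass x) *\<^sub>R y)"
    by (rule Bochner_Integration.integrable_bound)
      (use tilt_exp_pos[of x] mass_pos[of x] in \<open>auto simp: mult.commute less_imp_le\<close>)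
  have "centroid (tilt (nu_of f) x) = (\<integral>y. (tilt_exp x y / mass x) *\<^sub>R y \<partial>gauss)"
    unfolding centroid_def tilt_nu using tilt_exp_pos mass_pos
    by (intro integral_density) (auto simp: less_imp_le)
  then have "centroid (tilt (nu_of f) x) \<bullet> b = (\<integral>y. ((tilt_exp x y / mass x) *\<^sub>R y) \<bullet> b \<partial>gauss)"
    using integral_inner_left[of b gauss "\<lambda>y. (tilt_exp x y / mass x) *\<^sub>R y"] i by simp
  then show ?thesis by (simp only: inner_scaleR_left mean_def) (simp add: mult.commute)
qed

text \<open>Translating by the centroid \<open>u\<close> makes the target the standard Gaussian. The
  translated measure has log density \<open>g\<close> with gradient
  \<open>grad f (y + u) + x - u\<close>, and \<open>u - x\<close> is the mean gradient by
  \<open>mean_identity\<close>. The Fisher information bounding the transport cost is thus the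
  variance of \<open>grad f\<close> under \<nu>_x.\<close>

lemma W2_le_variance:
  "W2_sq (tilt (nu_of f) x) (gauss_centered (centroid (tilt (nu_of f) x))) \<le>
    ennreal (\<Sum>b\<in>Basis. mean (\<lambda>y. (df b y - mean (df b) x)\<^sup>2) x)"
proof -
  define u where "u = centroid (tilt (nu_of f) x)"
  \<comment> \<open>The quadratic and linear terms in \<open>u\<close> are the Cameron-Martin
    exponent of the translation; \<open>ln (mass x)\<close> normalises.\<close>
  define g where "g y = f (y + u) + x \<bullet> (y + u) - u \<bullet> y - (norm u)\<^sup>2 / 2 - ln (mass x)" for y
  define G where "G b y = df b (y + u) + x \<bullet> b - u \<bullet> b" for b y
  have [measurable]: "tilt_exp x \<in> borel_measurable borel"
    by (rule exp_growth_measurable[OF tilt_exp_growth])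
  have g_cont: "continuous_on UNIV g"
    unfolding g_def by (intro continuous_intros continuous_on_compose2[OF f_cont]) auto
  then have [measurable]: "g \<in> borel_measurable borel" by (rule borel_measurable_continuous_onI)
  have eg: "exp (g y) = tilt_exp x (y + u) / mass x * exp (- (y \<bullet> u) - (norm u)\<^sup>2 / 2)" for y
  proof -
    have "g y = (f (y + u) + x \<bullet> (y + u)) - ln (mass x) + (- (y \<bullet> u) - (norm u)\<^sup>2 / 2)"
      by (simp add: g_def inner_commute)
    then show ?thesis using mass_pos[of x] by (simp only: tilt_exp_def exp_add exp_diff[of _ "ln (mass x)"] exp_ln)
  qed
  have change: "(\<integral>\<^sup>+y. h (y + u) * ennreal (exp (g y)) \<partial>gauss) = (\<integral>\<^sup>+y. h y * ennreal (tilt_exp x y / mass x) \<partial>gauss)"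
    if [measurable]: "h \<in> borel_measurable borel" for h
  proof -
    have "ennreal (exp (g y)) = ennreal (tilt_exp x (y + u) / mass x) * ennreal (exp (- (y \<bullet> u) - (norm u)\<^sup>2 / 2))" for y
      unfolding eg using tilt_exp_pos mass_pos[of x] by (intro ennreal_mult) (auto simp: less_imp_le)
    then have "(\<integral>\<^sup>+y. h (y + u) * ennreal (exp (g y)) \<partial>gauss) =
        (\<integral>\<^sup>+y. h (y + u) * ennreal (tilt_exp x (y + u) / mass x) * ennreal (exp (- (y \<bullet> u) - (norm u)\<^sup>2 / 2)) \<partial>gauss)"
      by (simp only: mult.assoc)
    also have "\<dots> = (\<integral>\<^sup>+y. h y * ennreal (tilt_exp x y / mass x) \<partial>gauss)"
      by (rule nn_integral_gauss_translate[symmetric]) simp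
    finally show ?thesis .
  qed
  have dens_eq: "(\<integral>\<^sup>+y. ennreal (h y) * ennreal (tilt_exp x y / mass x) \<partial>gauss) = ennreal (mean h x)"
    if h: "exp_growth (\<lambda>_::real. h)" and h0: "\<And>y. 0 \<le> h y" for h
  proof -
    have "(\<integral>\<^sup>+y. ennreal (h y) * ennreal (tilt_exp x y / mass x) \<partial>gauss) = (\<integral>\<^sup>+y. ennreal (h y * tilt_exp x y / mass x) \<partial>gauss)"
      using h0 tilt_exp_pos mass_pos[of x] by (simp add: ennreal_mult[symmetric] less_imp_le)
    also have "\<dots> = ennreal (\<integral>y. h y * tilt_exp x y / mass x \<partial>gauss)"
      using mean_integrable[OF h] h0 tilt_exp_pos mass_pos[of x] by (intro nn_integral_eq_integral) (auto simp: less_imp_le)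
    finally show ?thesis by (simp add: mean_def)
  qed
  have C1: "C1_bounded g G (L + norm x + norm u)"
    unfolding C1_bounded_def
  proof (intro conjI ballI allI g_cont)
    have "lin_growth (\<lambda>_::real. g)"
      unfolding g_def by (intro lin_growth_g growth_intros)
    then obtain C where "C \<ge> 0" "\<And>t z. norm (t::real) \<le> 0 \<Longrightarrow> norm (g z) \<le> C * (1 + norm z)"
      using lin_growthE[where R=0] by blast
    then show "\<exists>C. \<forall>y. \<bar>g y\<bar> \<le> C * (1 + norm y)"
      by (intro exI[of _ C]) (metis norm_zero order_refl real_norm_def)
    fix b :: 'a assume b: "b \<in> Basis"
    show "continuous_on UNIV (G b)"
      unfolding G_def by (intro continuous_intros continuous_on_compose2[OF grad_cont]) auto
    fix y
    show "\<bar>G b y\<bar> \<le> L + norm x + norm u"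
      using df_bound[OF b, of "y + u"] Basis_le_norm[OF b, of x] Basis_le_norm[OF b, of u] by (simp add: G_def)
    have "((\<lambda>t. f ((y + u) + t *\<^sub>R b)) has_real_derivative df b (y + u)) (at 0)"
      using line_derivative[of "y + u" b 0] by simp
    then show "((\<lambda>t. g (y + t *\<^sub>R b)) has_real_derivative G b y) (at 0)"
      unfolding g_def G_def by (auto intro!: derivative_eq_intros simp: add_ac inner_add_right inner_commute)
  qed
  have tot: "(\<integral>\<^sup>+y. ennreal (exp (g y)) \<partial>gauss) = 1"
    using change[of "\<lambda>_. 1"] dens_eq[OF exp_growth_const[of 1]] by (simp add: mean_const)
  obtain S where [measurable]: "S \<in> borel_measurable borel"
    and S: "\<And>h. h \<in> borel_measurable borel \<Longrightarrow> (\<integral>\<^sup>+y. h (S y) * ennreal (exp (g y)) \<partial>gauss) = (\<integral>\<^sup>+y. h y \<partial>gauss)"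
    and cost: "(\<integral>\<^sup>+y. ennreal ((norm (S y - y))\<^sup>2 * exp (g y)) \<partial>gauss) \<le> (\<Sum>b\<in>Basis. \<integral>\<^sup>+y. ennreal ((G b y)\<^sup>2 * exp (g y)) \<partial>gauss)"
    using gaussian_transport[OF C1 tot] by blast
  let ?M = "density gauss (\<lambda>y. ennreal (exp (g y)))"
  \<comment> \<open>With \<open>y\<close> distributed by the density \<open>exp (g y)\<close>, the
    point \<open>y + u\<close> has the tilted law and \<open>S y + u\<close> the Gaussian law with
    centre \<open>u\<close>; the common shift drops out of the distance.\<close>
  define \<pi> where "\<pi> = distr ?M borel (\<lambda>y. (y + u, S y + u))"
  have pm: "(\<lambda>y. (y + u, S y + u)) \<in> measurable ?M borel"
    by (simp add: borel_measurable_Pair)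
  have em: "emeasure (distr ?M borel F) A = (\<integral>\<^sup>+y. indicator A (F y) * ennreal (exp (g y)) \<partial>gauss)"
    if [measurable]: "F \<in> borel_measurable borel" "A \<in> sets borel" for F :: "'a \<Rightarrow> 'a" and A
  proof -
    have "emeasure (distr ?M borel F) A = (\<integral>\<^sup>+y. indicator A y \<partial>distr ?M borel F)" by simp
    also have "\<dots> = (\<integral>\<^sup>+y. ennreal (exp (g y)) * indicator A (F y) \<partial>gauss)"
      by (subst nn_integral_distr) (auto simp: nn_integral_density)
    finally show ?thesis by (simp add: mult.commute)
  qed
  have "distr \<pi> borel fst = tilt (nu_of f) x"
  proof (rule measure_eqI)
    fix A assume "A \<in> sets (distr \<pi> borel fst)"
    then have A[measurable]: "A \<in> sets borel" by simp
    have "distr \<pi> borel fst = distr ?M borel (\<lambda>y. y + u)"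
      unfolding \<pi>_def by (subst distr_distr[OF _ pm]) (auto simp: comp_def borel_measurable_continuous_onI continuous_on_fst)
    then have "emeasure (distr \<pi> borel fst) A = (\<integral>\<^sup>+y. indicator A (y + u) * ennreal (exp (g y)) \<partial>gauss)"
      by (simp add: em)
    also have "\<dots> = (\<integral>\<^sup>+y. indicator A y * ennreal (tilt_exp x y / mass x) \<partial>gauss)"
      by (rule change) simp
    finally show "emeasure (distr \<pi> borel fst) A = emeasure (tilt (nu_of f) x) A"
      by (simp add: tilt_nu emeasure_density mult.commute)
  qed (simp add: tilt_nu)
  moreover have "distr \<pi> borel snd = gauss_centered u"
  proof (rule measure_eqI)
    fix A assume "A \<in> sets (distr \<pi> borel snd)"
    then have A[measurable]: "A \<in> sets borel" by simp
    have "distr \<pi> borel snd = distr ?M borel (\<lambda>y. S y + u)"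
      unfolding \<pi>_def by (subst distr_distr[OF _ pm]) (auto simp: comp_def borel_measurable_continuous_onI continuous_on_snd)
    then have "emeasure (distr \<pi> borel snd) A = (\<integral>\<^sup>+y. indicator A (S y + u) * ennreal (exp (g y)) \<partial>gauss)"
      by (simp add: em)
    also have "\<dots> = (\<integral>\<^sup>+y. indicator A (y + u) \<partial>gauss)"
      by (rule S[of "\<lambda>y. indicator A (y + u)"]) simp
    also have "\<dots> = (\<integral>\<^sup>+y. indicator A y \<partial>gauss_centered u)"
      unfolding gauss_centered_def by (subst nn_integral_distr) auto
    finally show "emeasure (distr \<pi> borel snd) A = emeasure (gauss_centered u) A"
      by (simp add: gauss_centered_def)
  qed (simp add: gauss_centered_def)
  ultimately have "\<pi> \<in> couplings (tilt (nu_of f) x) (gauss_centered u)"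
    by (simp add: couplings_def \<pi>_def)
  then have "W2_sq (tilt (nu_of f) x) (gauss_centered u) \<le> (\<integral>\<^sup>+p. ennreal ((norm (fst p - snd p))\<^sup>2) \<partial>\<pi>)"
    unfolding W2_sq_def by (rule INF_lower)
  also have "\<dots> = (\<integral>\<^sup>+y. ennreal ((norm (S y - y))\<^sup>2 * exp (g y)) \<partial>gauss)"
    unfolding \<pi>_def
    by (subst nn_integral_distr[OF pm])
      (auto simp: nn_integral_density norm_minus_commute ennreal_mult mult.commute
        intro!: borel_measurable_continuous_onI continuous_intros)
  also note cost
  also have "(\<Sum>b\<in>Basis. \<integral>\<^sup>+y. ennreal ((G b y)\<^sup>2 * exp (g y)) \<partial>gauss) = (\<Sum>b\<in>Basis. ennreal (mean (\<lambda>y. (df b y - mean (df b) x)\<^sup>2) x))"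
  proof (rule sum.cong[OF refl])
    fix b :: 'a assume b: "b \<in> Basis"
    have ub: "u \<bullet> b = mean (df b) x + x \<bullet> b"
      unfolding u_def centroid_inner[OF b] by (rule mean_identity[OF b])
    have [measurable]: "df b \<in> borel_measurable borel" by (rule measG[OF b])
    have eg: "exp_growth (\<lambda>_::real. \<lambda>y. (df b y - mean (df b) x)\<^sup>2)"
      by (intro exp_growth_power exp_growth_diff df_growth b exp_growth_const)
    have "(\<integral>\<^sup>+y. ennreal ((G b y)\<^sup>2 * exp (g y)) \<partial>gauss) = (\<integral>\<^sup>+y. ennreal ((df b (y + u) - mean (df b) x)\<^sup>2) * ennreal (exp (g y)) \<partial>gauss)"
      by (simp add: G_def ub ennreal_mult)
    also have "\<dots> = ennreal (mean (\<lambda>y. (df b y - mean (df b) x)\<^sup>2) x)"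
      using change[of "\<lambda>y. ennreal ((df b y - mean (df b) x)\<^sup>2)"] dens_eq[OF eg] by simp
    finally show "(\<integral>\<^sup>+y. ennreal ((G b y)\<^sup>2 * exp (g y)) \<partial>gauss) = ennreal (mean (\<lambda>y. (df b y - mean (df b) x)\<^sup>2) x)" .
  qed
  also have "\<dots> = ennreal (\<Sum>b\<in>Basis. mean (\<lambda>y. (df b y - mean (df b) x)\<^sup>2) x)"
  proof (rule sum_ennreal)
    show "0 \<le> mean (\<lambda>y. (df b y - mean (df b) x)\<^sup>2) x" for b
      unfolding mean_def using mass_pos[of x] tilt_exp_pos[of x]
      by (intro divide_nonneg_pos integral_nonneg_AE) (auto simp: less_imp_le)
  qed
  finally show ?thesis by (simp add: u_def)
qed

lemma exists_tilt:
  assumes lap: "\<And>x. c \<le> laplacian f x" and r: "0 < r"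
  shows "\<exists>x0. norm x0 \<le> r \<and> (\<Sum>b\<in>Basis. mean (\<lambda>y. (df b y - mean (df b) x0)\<^sup>2) x0) \<le>
     2 * sqrt (DIM('a)) / r * (\<integral>g. supp g \<partial>gauss) - c"
proof -
  note B = ball_integral_le_gauss_integral[OF supp_meas supp_bound supp_scale integral_supp_nonneg r]
  obtain x0 where x0: "norm x0 \<le> r"
    "(\<Sum>b\<in>Basis. cov b x0) * (\<integral>x. paraboloid r (x::'a) \<partial>lborel) \<le> 2 * (\<integral>x. indicator (ball 0 r) x * supp x \<partial>lborel)"
    using exists_small_divergence[OF r supp_upper B(2)] by blast
  have P: "0 < (\<integral>x. paraboloid r (x::'a) \<partial>lborel)"
    unfolding integral_paraboloid[OF r] using r ball_measure_pos[where 'a='a] by simp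
  have "(\<Sum>b\<in>Basis. cov b x0) \<le> 2 * sqrt (DIM('a)) / r * (\<integral>g. supp g \<partial>gauss)"
    using order_trans[OF x0(2) B(1)] P by (rule mult_right_le_imp_le)
  then show ?thesis using variance_le_cov[OF lap, of x0] x0(1) by (intro exI[of _ x0]) linarith
qed

end

theorem theorem2p1:
  fixes f :: "'a::euclidean_space \<Rightarrow> real" and r :: real
  assumes "twice_differentiable f"
    and "r > 0"
  shows "\<exists>x0::'a. norm x0 \<le> r \<and>
    enn2ereal (W2_sq (tilt (nu_of f) x0) (gauss_centered (centroid (tilt (nu_of f) x0))))
      \<le> ereal (2 * sqrt (real DIM('a)) / r) * grad_complexity f
         - (INF y. ereal (laplacian f y))"
proof -
  let ?I = "INF y. ereal (laplacian f y)"
  have "?I \<le> ereal (laplacian f 0)" by (rule INF_lower) simp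
  then have I: "?I \<noteq> \<infinity>" by auto
  \<comment> \<open>An infinite right-hand side is attained exactly in the situations outside the
    analysis above, namely unbounded gradients or a Laplacian unbounded below; any point of the ball
    then serves, for instance the origin.\<close>
  have triv: ?thesis if "ereal (2 * sqrt (real DIM('a)) / r) * grad_complexity f - ?I = \<infinity>"
    by (rule exI[of _ 0]) (use that assms(2) in simp)
  show ?thesis
  proof (cases "bounded (range (grad f))")
    case False
    have "0 < 2 * sqrt (real DIM('a)) / r" using assms(2) by simp
    then have e: "ereal (2 * sqrt (real DIM('a)) / r) * grad_complexity f = \<infinity>"
      using assms(2) by (simp add: grad_complexity_def gaussian_width_unbounded[OF False])
    have "\<infinity> - ?I = \<infinity>" using I by (cases ?I) auto
    then show ?thesis by (intro triv) (simp only: e)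
  next
    case True
    then obtain L where L: "\<And>x. norm (grad f x) \<le> L" unfolding bounded_iff by auto
    interpret bounded_gradient f L by unfold_locales (use assms(1) L in auto)
    show ?thesis
    proof (cases ?I)
      case (real c)
      have lap: "c \<le> laplacian f x" for x
      proof -
        have "?I \<le> ereal (laplacian f x)" by (rule INF_lower) simp
        then show ?thesis using real by simp
      qed
      obtain x0 where x0: "norm x0 \<le> r" "(\<Sum>b\<in>Basis. mean (\<lambda>y. (df b y - mean (df b) x0)\<^sup>2) x0) \<le>
         2 * sqrt (DIM('a)) / r * (\<integral>g. supp g \<partial>gauss) - c" (is "?s \<le> ?t")
        using exists_tilt[OF lap assms(2)] by blast
      have "W2_sq (tilt (nu_of f) x0) (gauss_centered (centroid (tilt (nu_of f) x0))) \<le> ennreal ?t"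
        using W2_le_variance[of x0] x0(2) by (meson ennreal_leI order_trans)
      \<comment> \<open>\<open>ennreal\<close> sends negative numbers to 0, so a bound by
        \<open>ennreal ?t\<close> becomes one by \<open>ereal ?t\<close> only for nonnegative
        \<open>?t\<close>; the variance below it supplies the sign.\<close>
      moreover have "0 \<le> ?t"
      proof -
        have "0 \<le> ?s"
          unfolding mean_def using mass_pos tilt_exp_pos
          by (intro sum_nonneg divide_nonneg_pos integral_nonneg_AE) (auto simp: less_imp_le)
        then show ?thesis using x0(2) by linarith
      qed
      ultimately have "enn2ereal (W2_sq (tilt (nu_of f) x0) (gauss_centered (centroid (tilt (nu_of f) x0)))) \<le> ereal ?t"
        by (metis enn2ereal_ennreal less_eq_ennreal.rep_eq)
      then show ?thesis using x0(1) real by (intro exI[of _ x0]) (simp add: grad_complexity_eq)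
    next
      case PInf
      then show ?thesis using I by simp
    next
      case MInf
      then show ?thesis by (intro triv) (simp add: grad_complexity_eq)
    qed
  qed
qed

end
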